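(* Let $(M,g,V)$ be a $G$-manifold with invariant intrinsic torsion such that $V^G=\{0\}$ and such that the intrinsic torsion is skew-symmetric. Then the intrinsic torsion is parallel with respect to the minimal connection.
   Context: All representations are real and identified with their duals; $\mathfrak{so}(V)\cong\Lambda^2V$. A $G$-manifold $(M,g,V)$ is a Riemannian manifold $(M^n,g)$ together with a reduction $P$ of the orthonormal frame bundle to a Lie subgroup $G\subset O(n)$, where $V\cong\mathbb R^n$ is the induced representation of $G$ on tangent spaces. Tensor fields are identified with $G$-equivariant maps from $P$ to tensor powers of $V$, and "take values in" a submodule if this map does. Let $\mathfrak g\subset\mathfrak{so}(n)$ be the Lie algebra of $G$, $\mathfrak g^\perp$ its orthogonal complement. A $G$-connection is a connection whose holonomy group acts on tangent spaces as a subgroup of $G$. For a $G$-connection $\hat\nabla$ put $\eta=\nabla^g-\hat\nabla\in V\otimes\mathfrak{so}(n)$, $\nabla^g$ the Levi-Civita connection; the component $\xi$ of $\eta$ in $V\otimes\mathfrak g^\perp$ is independent of $\hat\nabla$ and is called the intrinsic torsion, and $\tilde\nabla=\nabla^g-\xi$ is the minimal connection. The intrinsic torsion is invariant if it takes values in a trivial $G$-submodule ($W\cong k\mathbb R$) of $V\otimes\mathfrak g^\perp$, skew-symmetric if it takes values in $\Lambda^3V\subset V\otimes\Lambda^2V$, and parallel with respect to the minimal connection if $\tilde\nabla\xi=0$. $V^G$ denotes the $G$-invariant vectors of $V$. *)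

theory Defs
  imports "HOL-Analysis.Analysis" "HOL-Library.Function_Algebras"
begin

section \<open>Smooth maps between normed spaces\<close>

text \<open>To be used for an open set \<open>S\<close> of a finite-dimensional space, where
  \<open>Ck_on k\<close> is the usual class of $k$ times continuously differentiable maps.\<close>

fun Ck_on :: "nat \<Rightarrow> 'a::real_normed_vector set \<Rightarrow> ('a \<Rightarrow> 'b::real_normed_vector) \<Rightarrow> bool" where
  "Ck_on 0 S f \<longleftrightarrow> continuous_on S f"
| "Ck_on (Suc k) S f \<longleftrightarrow> (\<forall>x\<in>S. f differentiable (at x)) \<and>
     (\<forall>v. Ck_on k S (\<lambda>x. frechet_derivative f (at x) v))"

definition smooth_on :: "'a::real_normed_vector set \<Rightarrow> ('a \<Rightarrow> 'b::real_normed_vector) \<Rightarrow> bool" where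
  "smooth_on S f \<longleftrightarrow> (\<forall>k. Ck_on k S f)"


section \<open>Manifolds and tangent vectors\<close>

text \<open>A manifold is a topological space, given as a type, together with an atlas. A chart is a pair
  of an open domain and a coordinate map, which is only relevant on the domain.\<close>

type_synonym ('m, 'n) chart = "'m set \<times> ('m \<Rightarrow> real^'n)"

type_synonym ('m, 'n) atlas = "('m, 'n) chart set"

definition chart_inv :: "('m, 'n) chart \<Rightarrow> real^'n \<Rightarrow> 'm" where
  "chart_inv c = inv_into (fst c) (snd c)"

definition transition :: "('m, 'n) chart \<Rightarrow> ('m, 'n) chart \<Rightarrow> real^'n \<Rightarrow> real^'n" where
  "transition c d = snd d \<circ> chart_inv c"

definition smooth_atlas :: "('m::topological_space, 'n::finite) atlas \<Rightarrow> bool" where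
  "smooth_atlas A \<longleftrightarrow>
     (\<Union>c\<in>A. fst c) = UNIV \<and>
     (\<forall>c\<in>A. open (fst c) \<and> open (snd c ` fst c) \<and>
        homeomorphism (fst c) (snd c ` fst c) (snd c) (chart_inv c)) \<and>
     (\<forall>c\<in>A. \<forall>d\<in>A. smooth_on (snd c ` (fst c \<inter> fst d)) (transition c d))"

text \<open>A tangent vector at \<open>p\<close> is the family of its coordinate vectors in all charts around \<open>p\<close>,
  related by the differentials of the coordinate changes. It is \<open>0\<close> by convention at the other
  charts, so that the tangent space is an $n$-dimensional subspace of the vector space of all
  families, with pointwise operations.\<close>

instantiation "fun" :: (type, real_vector) real_vector
begin

definition scaleR_fun :: "real \<Rightarrow> ('a \<Rightarrow> 'b) \<Rightarrow> 'a \<Rightarrow> 'b" where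
  "scaleR_fun r f = (\<lambda>x. r *\<^sub>R f x)"

instance
  by standard (auto simp: scaleR_fun_def plus_fun_def fun_eq_iff algebra_simps)

end

type_synonym ('m, 'n) tvec = "('m, 'n) chart \<Rightarrow> real^'n"

definition tangent_space :: "('m, 'n::finite) atlas \<Rightarrow> 'm \<Rightarrow> ('m, 'n) tvec set" where
  "tangent_space A p = {v.
     (\<forall>c. \<not> (c \<in> A \<and> p \<in> fst c) \<longrightarrow> v c = 0) \<and>
     (\<forall>c\<in>A. \<forall>d\<in>A. p \<in> fst c \<inter> fst d \<longrightarrow>
        v d = frechet_derivative (transition c d) (at (snd c p)) (v c))}"

definition smooth_fun ::
  "('m, 'n::finite) atlas \<Rightarrow> 'm set \<Rightarrow> ('m \<Rightarrow> 'b::real_normed_vector) \<Rightarrow> bool" where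
  "smooth_fun A U f \<longleftrightarrow> (\<forall>c\<in>A. smooth_on (snd c ` (U \<inter> fst c)) (f \<circ> chart_inv c))"

definition smooth_field ::
  "('m, 'n::finite) atlas \<Rightarrow> 'm set \<Rightarrow> ('m \<Rightarrow> ('m, 'n) tvec) \<Rightarrow> bool" where
  "smooth_field A U X \<longleftrightarrow> (\<forall>p\<in>U. X p \<in> tangent_space A p) \<and>
     (\<forall>c\<in>A. smooth_on (snd c ` (U \<inter> fst c)) (\<lambda>x. X (chart_inv c x) c))"

definition smooth_fun_near ::
  "('m::topological_space, 'n::finite) atlas \<Rightarrow> 'm \<Rightarrow> ('m \<Rightarrow> 'b::real_normed_vector) \<Rightarrow> bool" where
  "smooth_fun_near A p f \<longleftrightarrow> (\<exists>U. open U \<and> p \<in> U \<and> smooth_fun A U f)"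

definition smooth_field_near ::
  "('m::topological_space, 'n::finite) atlas \<Rightarrow> 'm \<Rightarrow> ('m \<Rightarrow> ('m, 'n) tvec) \<Rightarrow> bool" where
  "smooth_field_near A p X \<longleftrightarrow> (\<exists>U. open U \<and> p \<in> U \<and> smooth_field A U X)"

definition some_chart :: "('m, 'n) atlas \<Rightarrow> 'm \<Rightarrow> ('m, 'n) chart" where
  "some_chart A p = (SOME c. c \<in> A \<and> p \<in> fst c)"

text \<open>The derivative of \<open>f\<close> in the direction of \<open>v \<in> tangent_space A p\<close>; by the chain rule it does
  not depend on the chart.\<close>

definition dir_deriv ::
  "('m, 'n::finite) atlas \<Rightarrow> 'm \<Rightarrow> ('m, 'n) tvec \<Rightarrow> ('m \<Rightarrow> 'b::real_normed_vector) \<Rightarrow> 'b" where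
  "dir_deriv A p v f = (let c = some_chart A p in
     frechet_derivative (f \<circ> chart_inv c) (at (snd c p)) (v c))"

definition lie_bracket ::
  "('m, 'n::finite) atlas \<Rightarrow> ('m \<Rightarrow> ('m, 'n) tvec) \<Rightarrow> ('m \<Rightarrow> ('m, 'n) tvec) \<Rightarrow> 'm \<Rightarrow> ('m, 'n) tvec" where
  "lie_bracket A X Y p = (\<lambda>c. if c \<in> A \<and> p \<in> fst c then
       frechet_derivative (\<lambda>x. Y (chart_inv c x) c) (at (snd c p)) (X p c)
     - frechet_derivative (\<lambda>x. X (chart_inv c x) c) (at (snd c p)) (Y p c)
     else 0)"


section \<open>Metrics and connections\<close>

definition riemannian_metric ::
  "('m::topological_space, 'n::finite) atlas \<Rightarrow> ('m \<Rightarrow> ('m, 'n) tvec \<Rightarrow> ('m, 'n) tvec \<Rightarrow> real) \<Rightarrow> bool" where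
  "riemannian_metric A g \<longleftrightarrow>
     (\<forall>p. \<forall>u\<in>tangent_space A p. \<forall>v\<in>tangent_space A p. \<forall>w\<in>tangent_space A p. \<forall>a b.
        g p (a *\<^sub>R u + b *\<^sub>R v) w = a * g p u w + b * g p v w) \<and>
     (\<forall>p. \<forall>v\<in>tangent_space A p. \<forall>w\<in>tangent_space A p. g p v w = g p w v) \<and>
     (\<forall>p. \<forall>v\<in>tangent_space A p. v \<noteq> 0 \<longrightarrow> g p v v > 0) \<and>
     (\<forall>U X Y. open U \<and> smooth_field A U X \<and> smooth_field A U Y \<longrightarrow>
        smooth_fun A U (\<lambda>p. g p (X p) (Y p)))"

text \<open>\<open>D p v Y\<close> is the covariant derivative at \<open>p\<close> of the local vector field \<open>Y\<close> in the direction
  of \<open>v\<close>. Only vector fields that are smooth near \<open>p\<close> matter.\<close>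

type_synonym ('m, 'n) conn = "'m \<Rightarrow> ('m, 'n) tvec \<Rightarrow> ('m \<Rightarrow> ('m, 'n) tvec) \<Rightarrow> ('m, 'n) tvec"

definition linear_connection ::
  "('m::topological_space, 'n::finite) atlas \<Rightarrow> ('m, 'n) conn \<Rightarrow> bool" where
  "linear_connection A D \<longleftrightarrow>
     (\<forall>p Y. smooth_field_near A p Y \<longrightarrow>
        (\<forall>v\<in>tangent_space A p. D p v Y \<in> tangent_space A p) \<and>
        (\<forall>v\<in>tangent_space A p. \<forall>w\<in>tangent_space A p. \<forall>a b.
           D p (a *\<^sub>R v + b *\<^sub>R w) Y = a *\<^sub>R D p v Y + b *\<^sub>R D p w Y) \<and>
        (\<forall>v\<in>tangent_space A p. \<forall>Z. smooth_field_near A p Z \<longrightarrow>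
           D p v (\<lambda>q. Y q + Z q) = D p v Y + D p v Z) \<and>
        (\<forall>v\<in>tangent_space A p. \<forall>f :: 'm \<Rightarrow> real. smooth_fun_near A p f \<longrightarrow>
           D p v (\<lambda>q. f q *\<^sub>R Y q) = dir_deriv A p v f *\<^sub>R Y p + f p *\<^sub>R D p v Y) \<and>
        (\<forall>v\<in>tangent_space A p. \<forall>Z U. open U \<and> p \<in> U \<and> (\<forall>q\<in>U. Z q = Y q) \<longrightarrow>
           D p v Z = D p v Y)) \<and>
     (\<forall>U X Y. open U \<and> smooth_field A U X \<and> smooth_field A U Y \<longrightarrow>
        smooth_field A U (\<lambda>p. D p (X p) Y))"

definition metric_connection ::
  "('m::topological_space, 'n::finite) atlas \<Rightarrow> ('m \<Rightarrow> ('m, 'n) tvec \<Rightarrow> ('m, 'n) tvec \<Rightarrow> real) \<Rightarrow>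
   ('m, 'n) conn \<Rightarrow> bool" where
  "metric_connection A g D \<longleftrightarrow>
     (\<forall>p Y Z. smooth_field_near A p Y \<and> smooth_field_near A p Z \<longrightarrow>
        (\<forall>v\<in>tangent_space A p.
           dir_deriv A p v (\<lambda>q. g q (Y q) (Z q)) = g p (D p v Y) (Z p) + g p (Y p) (D p v Z)))"

definition torsion_free ::
  "('m::topological_space, 'n::finite) atlas \<Rightarrow> ('m, 'n) conn \<Rightarrow> bool" where
  "torsion_free A D \<longleftrightarrow>
     (\<forall>p X Y. smooth_field_near A p X \<and> smooth_field_near A p Y \<longrightarrow>
        D p (X p) Y - D p (Y p) X = lie_bracket A X Y p)"

definition levi_civita ::
  "('m::topological_space, 'n::finite) atlas \<Rightarrow> ('m \<Rightarrow> ('m, 'n) tvec \<Rightarrow> ('m, 'n) tvec \<Rightarrow> real) \<Rightarrow>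
   ('m, 'n) conn \<Rightarrow> bool" where
  "levi_civita A g D \<longleftrightarrow> linear_connection A D \<and> metric_connection A g D \<and> torsion_free A D"

subsection \<open>Parallel fields along curves\<close>

text \<open>The intervals \<open>I\<close> below are open.\<close>

definition smooth_curve ::
  "('m::topological_space, 'n::finite) atlas \<Rightarrow> real set \<Rightarrow> (real \<Rightarrow> 'm) \<Rightarrow> bool" where
  "smooth_curve A I \<gamma> \<longleftrightarrow> continuous_on I \<gamma> \<and>
     (\<forall>c\<in>A. smooth_on {t\<in>I. \<gamma> t \<in> fst c} (snd c \<circ> \<gamma>))"

definition velocity :: "('m, 'n::finite) atlas \<Rightarrow> (real \<Rightarrow> 'm) \<Rightarrow> real \<Rightarrow> ('m, 'n) tvec" where
  "velocity A \<gamma> t = (\<lambda>c. if c \<in> A \<and> \<gamma> t \<in> fst c then vector_derivative (snd c \<circ> \<gamma>) (at t) else 0)"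

definition smooth_field_along ::
  "('m, 'n::finite) atlas \<Rightarrow> real set \<Rightarrow> (real \<Rightarrow> 'm) \<Rightarrow> (real \<Rightarrow> ('m, 'n) tvec) \<Rightarrow> bool" where
  "smooth_field_along A I \<gamma> Y \<longleftrightarrow> (\<forall>t\<in>I. Y t \<in> tangent_space A (\<gamma> t)) \<and>
     (\<forall>c\<in>A. smooth_on {t\<in>I. \<gamma> t \<in> fst c} (\<lambda>t. Y t c))"

definition coord_field ::
  "('m, 'n::finite) atlas \<Rightarrow> ('m, 'n) chart \<Rightarrow> 'n \<Rightarrow> 'm \<Rightarrow> ('m, 'n) tvec" where
  "coord_field A c i p = (\<lambda>d. if d \<in> A \<and> p \<in> fst c \<inter> fst d
     then frechet_derivative (transition c d) (at (snd c p)) (axis i 1) else 0)"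

text \<open>With $Y = \sum_i Y^i\,\partial_i$ in a chart, the covariant derivative along \<open>\<gamma>\<close> is
  $\sum_i (Y^i)'\,\partial_i + Y^i\,\nabla_{\gamma'}\partial_i$.\<close>

definition cov_deriv_along ::
  "('m, 'n::finite) atlas \<Rightarrow> ('m, 'n) conn \<Rightarrow> (real \<Rightarrow> 'm) \<Rightarrow> (real \<Rightarrow> ('m, 'n) tvec) \<Rightarrow> real \<Rightarrow>
   ('m, 'n) tvec" where
  "cov_deriv_along A D \<gamma> Y t = (let c = some_chart A (\<gamma> t) in
     \<Sum>i\<in>UNIV. vector_derivative (\<lambda>s. Y s c $ i) (at t) *\<^sub>R coord_field A c i (\<gamma> t)
            + (Y t c $ i) *\<^sub>R D (\<gamma> t) (velocity A \<gamma> t) (coord_field A c i))"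

definition parallel_along ::
  "('m, 'n::finite) atlas \<Rightarrow> ('m, 'n) conn \<Rightarrow> real set \<Rightarrow> (real \<Rightarrow> 'm) \<Rightarrow> (real \<Rightarrow> ('m, 'n) tvec) \<Rightarrow>
   bool" where
  "parallel_along A D I \<gamma> Y \<longleftrightarrow>
     smooth_field_along A I \<gamma> Y \<and> (\<forall>t\<in>I. cov_deriv_along A D \<gamma> Y t = 0)"


section \<open>The structure group\<close>

text \<open>A Lie subgroup of $O(n)$ need not be closed: it is a subgroup carrying the structure of a
  (Hausdorff, second countable) Lie group for which the inclusion is an immersion. In terms of the
  topology \<open>T\<close> of that structure, this says that \<open>(G, T)\<close> is a topological group which is locally
  parametrised by smooth immersions \<open>\<psi>\<close> of open subsets of a vector space \<open>E\<close> into the matrices; the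
  model space \<open>E\<close> is taken inside the matrices because its dimension varies. A smooth map on
  \<open>B \<inter> E\<close> is given as the restriction of one on \<open>B\<close>. Smoothness of the parameter changes and of the
  group operations follows from their continuity with respect to \<open>T\<close>, as the \<open>\<psi>\<close> are immersions.\<close>

definition lie_subgroup_On :: "(real^'n::finite^'n) set \<Rightarrow> bool" where
  "lie_subgroup_On G \<longleftrightarrow>
     (\<forall>a\<in>G. orthogonal_matrix a) \<and> mat 1 \<in> G \<and>
     (\<forall>a\<in>G. \<forall>b\<in>G. a ** b \<in> G) \<and> (\<forall>a\<in>G. matrix_inv a \<in> G) \<and>
     (\<exists>T E. topspace T = G \<and> Hausdorff_space T \<and> second_countable T \<and>
        continuous_map (prod_topology T T) T (\<lambda>(a, b). a ** b) \<and> continuous_map T T matrix_inv \<and>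
        subspace E \<and>
        (\<forall>a\<in>G. \<exists>U B (\<psi> :: real^'n^'n \<Rightarrow> real^'n^'n). openin T U \<and> a \<in> U \<and> open B \<and>
           homeomorphic_map (top_of_set (B \<inter> E)) (subtopology T U) \<psi> \<and>
           smooth_on B \<psi> \<and> (\<forall>x\<in>B \<inter> E. inj_on (frechet_derivative \<psi> (at x)) E)))"

text \<open>The Lie algebra as the tangent space at the identity. A smooth curve of matrices that lies in a
  Lie subgroup in the sense above is also smooth as a curve in the Lie group, so that all of the
  velocities below are tangent to \<open>G\<close>.\<close>

definition lie_algebra :: "(real^'n::finite^'n) set \<Rightarrow> (real^'n^'n) set" where
  "lie_algebra G = {X. \<exists>\<gamma> e. e > 0 \<and> smooth_on {-e<..<e} \<gamma> \<and> (\<forall>t\<in>{-e<..<e}. \<gamma> t \<in> G) \<and>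
     \<gamma> 0 = mat 1 \<and> (\<gamma> has_vector_derivative X) (at 0)}"

definition so :: "(real^'n::finite^'n) set" where
  "so = {X. transpose X = - X}"

definition lie_algebra_perp :: "(real^'n::finite^'n) set \<Rightarrow> (real^'n^'n) set" where
  "lie_algebra_perp G = {X\<in>so. \<forall>Y\<in>lie_algebra G. X \<bullet> Y = 0}"

definition perp_component :: "(real^'n::finite^'n) set \<Rightarrow> real^'n^'n \<Rightarrow> real^'n^'n" where
  "perp_component G X = (THE Z. Z \<in> lie_algebra_perp G \<and> X - Z \<in> lie_algebra G)"

definition invariant_vectors :: "(real^'n::finite^'n) set \<Rightarrow> (real^'n) set" where
  "invariant_vectors G = {v. \<forall>a\<in>G. a *v v = v}"

text \<open>An element \<open>T\<close> of $V \otimes \mathfrak{gl}(V)$ is written as \<open>T :: real^'n^'n^'n\<close>, where the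
  matrix \<open>T $ k\<close> is the value of the map $V \to \mathfrak{gl}(V)$ at the \<open>k\<close>-th basis vector. An
  orthogonal matrix \<open>a\<close> acts by $(a \cdot T)(x) = a\, T(a^{-1} x)\, a^{-1}$.\<close>

definition tensor_act :: "real^'n::finite^'n \<Rightarrow> real^'n^'n^'n \<Rightarrow> real^'n^'n^'n" where
  "tensor_act a T = (\<chi> k. \<Sum>l\<in>UNIV. (a $ k $ l) *\<^sub>R (a ** T $ l ** matrix_inv a))"

definition V_tensor_perp :: "(real^'n::finite^'n) set \<Rightarrow> (real^'n^'n^'n) set" where
  "V_tensor_perp G = {T. \<forall>k. T $ k \<in> lie_algebra_perp G}"

definition trivial_submodule :: "(real^'n::finite^'n) set \<Rightarrow> (real^'n^'n^'n) set \<Rightarrow> bool" where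
  "trivial_submodule G W \<longleftrightarrow>
     subspace W \<and> W \<subseteq> V_tensor_perp G \<and> (\<forall>a\<in>G. \<forall>T\<in>W. tensor_act a T = T)"

definition Lambda3 :: "(real^'n::finite^'n^'n) set" where
  "Lambda3 = {T. \<forall>k i j. T $ k $ i $ j = - T $ k $ j $ i \<and> T $ k $ i $ j = - T $ i $ k $ j}"


section \<open>G-manifolds and their intrinsic torsion\<close>

type_synonym ('m, 'n) frame = "'n \<Rightarrow> ('m, 'n) tvec"

definition orthonormal_frame ::
  "('m, 'n::finite) atlas \<Rightarrow> ('m \<Rightarrow> ('m, 'n) tvec \<Rightarrow> ('m, 'n) tvec \<Rightarrow> real) \<Rightarrow> 'm \<Rightarrow>
   ('m, 'n) frame \<Rightarrow> bool" where
  "orthonormal_frame A g p u \<longleftrightarrow>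
     (\<forall>i. u i \<in> tangent_space A p) \<and> (\<forall>i j. g p (u i) (u j) = (if i = j then 1 else 0))"

definition frame_act :: "('m, 'n::finite) frame \<Rightarrow> real^'n^'n \<Rightarrow> ('m, 'n) frame" where
  "frame_act u a = (\<lambda>j. \<Sum>i\<in>UNIV. (a $ i $ j) *\<^sub>R u i)"

text \<open>\<open>P p\<close> is the fibre over \<open>p\<close> of the reduction: one orbit of \<open>G\<close>, with smooth local sections.
  The transition functions of such sections are smooth maps to $O(n)$ with values in \<open>G\<close>, hence
  smooth maps to \<open>G\<close>, also if \<open>G\<close> is not closed.\<close>

definition reduction ::
  "('m::topological_space, 'n::finite) atlas \<Rightarrow> ('m \<Rightarrow> ('m, 'n) tvec \<Rightarrow> ('m, 'n) tvec \<Rightarrow> real) \<Rightarrow>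
   (real^'n^'n) set \<Rightarrow> ('m \<Rightarrow> ('m, 'n) frame set) \<Rightarrow> bool" where
  "reduction A g G P \<longleftrightarrow>
     (\<forall>p. \<forall>u\<in>P p. orthonormal_frame A g p u \<and> P p = frame_act u ` G) \<and>
     (\<forall>p. \<exists>U s. open U \<and> p \<in> U \<and> (\<forall>q\<in>U. s q \<in> P q) \<and> (\<forall>i. smooth_field A U (\<lambda>q. s q i)))"

definition G_manifold ::
  "('m::topological_space, 'n::finite) atlas \<Rightarrow> ('m \<Rightarrow> ('m, 'n) tvec \<Rightarrow> ('m, 'n) tvec \<Rightarrow> real) \<Rightarrow>
   (real^'n^'n) set \<Rightarrow> ('m \<Rightarrow> ('m, 'n) frame set) \<Rightarrow> bool" where
  "G_manifold A g G P \<longleftrightarrow>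
     smooth_atlas A \<and> riemannian_metric A g \<and> lie_subgroup_On G \<and> reduction A g G P"

text \<open>Parallel transport along every smooth curve maps frames in \<open>P\<close> to frames in \<open>P\<close>. In
  particular the holonomy group at \<open>p\<close>, read in a frame belonging to \<open>P p\<close>, lies in \<open>G\<close>.\<close>

definition G_connection ::
  "('m::topological_space, 'n::finite) atlas \<Rightarrow> ('m \<Rightarrow> ('m, 'n) frame set) \<Rightarrow> ('m, 'n) conn \<Rightarrow> bool" where
  "G_connection A P D \<longleftrightarrow> linear_connection A D \<and>
     (\<forall>a b \<gamma>. smooth_curve A {a<..<b} \<gamma> \<longrightarrow>
        (\<forall>t\<^sub>0\<in>{a<..<b}. \<forall>u\<^sub>0\<in>P (\<gamma> t\<^sub>0). \<exists>u. u t\<^sub>0 = u\<^sub>0 \<and>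
           (\<forall>i. parallel_along A D {a<..<b} \<gamma> (\<lambda>t. u t i)) \<and> (\<forall>t\<in>{a<..<b}. u t \<in> P (\<gamma> t))))"

text \<open>The tensor $(\nabla - \nabla')_v w$, where \<open>w\<close> is extended to a vector field near \<open>p\<close>.\<close>

definition conn_diff ::
  "('m::topological_space, 'n::finite) atlas \<Rightarrow> ('m, 'n) conn \<Rightarrow> ('m, 'n) conn \<Rightarrow>
   'm \<Rightarrow> ('m, 'n) tvec \<Rightarrow> ('m, 'n) tvec \<Rightarrow> ('m, 'n) tvec" where
  "conn_diff A D D' p v w =
     (let Y = (SOME Y. smooth_field_near A p Y \<and> Y p = w) in D p v Y - D' p v Y)"

text \<open>A tensor field with values in $V \otimes \mathfrak{gl}(V)$ as the map on orthonormal frames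
  that sends \<open>u\<close> to the components of the tensor with respect to \<open>u\<close>.\<close>

definition frame_components ::
  "('m \<Rightarrow> ('m, 'n::finite) tvec \<Rightarrow> ('m, 'n) tvec \<Rightarrow> real) \<Rightarrow>
   ('m \<Rightarrow> ('m, 'n) tvec \<Rightarrow> ('m, 'n) tvec \<Rightarrow> ('m, 'n) tvec) \<Rightarrow> 'm \<Rightarrow> ('m, 'n) frame \<Rightarrow> real^'n^'n^'n" where
  "frame_components g \<eta> p u = (\<chi> k i j. g p (\<eta> p (u k) (u j)) (u i))"

text \<open>Conversely, the tensor field belonging to a \<open>G\<close>-equivariant map \<open>\<tau>\<close> on \<open>P\<close>; by equivariance it
  does not depend on the frame.\<close>

definition tensor_field_of ::
  "('m \<Rightarrow> ('m, 'n::finite) tvec \<Rightarrow> ('m, 'n) tvec \<Rightarrow> real) \<Rightarrow> ('m \<Rightarrow> ('m, 'n) frame set) \<Rightarrow>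
   ('m \<Rightarrow> ('m, 'n) frame \<Rightarrow> real^'n^'n^'n) \<Rightarrow>
   'm \<Rightarrow> ('m, 'n) tvec \<Rightarrow> ('m, 'n) tvec \<Rightarrow> ('m, 'n) tvec" where
  "tensor_field_of g P \<tau> p v w = (let u = (SOME u. u \<in> P p) in
     \<Sum>k\<in>UNIV. \<Sum>i\<in>UNIV. \<Sum>j\<in>UNIV. (g p v (u k) * g p w (u j) * \<tau> p u $ k $ i $ j) *\<^sub>R u i)"

text \<open>The component in $V \otimes \mathfrak{g}^\perp$ of $\eta = \nabla^g - \hat\nabla$, for the
  Levi-Civita connection \<open>D\<close> and a \<open>G\<close>-connection \<open>D'\<close>.\<close>

definition intrinsic_torsion ::
  "('m::topological_space, 'n::finite) atlas \<Rightarrow> ('m \<Rightarrow> ('m, 'n) tvec \<Rightarrow> ('m, 'n) tvec \<Rightarrow> real) \<Rightarrow>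
   (real^'n^'n) set \<Rightarrow> ('m, 'n) conn \<Rightarrow> ('m, 'n) conn \<Rightarrow> 'm \<Rightarrow> ('m, 'n) frame \<Rightarrow> real^'n^'n^'n" where
  "intrinsic_torsion A g G D D' p u =
     (\<chi> k. perp_component G (frame_components g (conn_diff A D D') p u $ k))"

definition takes_values_in ::
  "('m \<Rightarrow> ('m, 'n::finite) frame set) \<Rightarrow> ('m \<Rightarrow> ('m, 'n) frame \<Rightarrow> real^'n^'n^'n) \<Rightarrow>
   (real^'n^'n^'n) set \<Rightarrow> bool" where
  "takes_values_in P \<tau> W \<longleftrightarrow> (\<forall>p. \<forall>u\<in>P p. \<tau> p u \<in> W)"

definition minimal_connection ::
  "('m \<Rightarrow> ('m, 'n::finite) tvec \<Rightarrow> ('m, 'n) tvec \<Rightarrow> real) \<Rightarrow> ('m \<Rightarrow> ('m, 'n) frame set) \<Rightarrow>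
   ('m, 'n) conn \<Rightarrow> ('m \<Rightarrow> ('m, 'n) frame \<Rightarrow> real^'n^'n^'n) \<Rightarrow> ('m, 'n) conn" where
  "minimal_connection g P D \<xi> p v Y = D p v Y - tensor_field_of g P \<xi> p v (Y p)"

text \<open>Vanishing of
  $(\nabla_v S)(Y, Z) = \nabla_v (S(Y, Z)) - S(\nabla_v Y, Z) - S(Y, \nabla_v Z)$.\<close>

definition parallel_tensor_field ::
  "('m::topological_space, 'n::finite) atlas \<Rightarrow> ('m, 'n) conn \<Rightarrow>
   ('m \<Rightarrow> ('m, 'n) tvec \<Rightarrow> ('m, 'n) tvec \<Rightarrow> ('m, 'n) tvec) \<Rightarrow> bool" where
  "parallel_tensor_field A D S \<longleftrightarrow>
     (\<forall>p Y Z. smooth_field_near A p Y \<and> smooth_field_near A p Z \<longrightarrow>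
        (\<forall>v\<in>tangent_space A p.
           D p v (\<lambda>q. S q (Y q) (Z q)) - S p (D p v Y) (Z p) - S p (Y p) (D p v Z) = 0))"

end

theory Submission
  imports Defs
begin

text \<open>In a local section \<open>s\<close> of the reduction, the intrinsic torsion is the projection of the
  Levi-Civita connection form to $\mathfrak g^\perp$, and by invariance it is a function with values
  in a fixed vector space \<open>W\<close> of invariant 3-forms. The minimal connection acts trivially on \<open>W\<close>, so
  the theorem says that this function has derivative zero. The Jacobi identity for the frame \<open>s\<close> is
  the first Bianchi identity: it relates the derivative \<open>\<theta>\<close> of the torsion, the curvature of the
  minimal connection, whose values lie in $\mathfrak g$, and a term quadratic in the torsion. Contracted
  with \<open>\<theta>\<close>, whose values lie in $V \otimes \mathfrak g^\perp$, the curvature can be eliminated, and the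
  quadratic term yields invariant vectors, which are zero. What remains is
  $\langle\theta, \theta\rangle = \langle\theta, \theta'\rangle$, where \<open>\<theta>'\<close> is \<open>\<theta>\<close> with the first two
  arguments swapped. Hence \<open>\<theta>\<close> is symmetric in its first two and skew in its last three arguments,
  that is, \<open>\<theta> = 0\<close>.\<close>

section \<open>Smooth maps\<close>

text \<open>The contraction needs care because orthogonality of the Lie algebra and its complement
  removes only two of the three curvature terms when the Bianchi identity is paired with
  \<open>\<theta> x y z t\<close>. In the third term, \<open>r y z t x\<close>, the direction
  \<open>x\<close> of differentiation is an index of the curvature matrix. Pairing with
  \<open>\<theta> t x y z\<close> instead gives three copies of the negative of this term; this is
  the origin of the weight 1/3. The quadratic terms pair two copies of the torsion with its
  derivative in a fixed direction, all of them invariant; one index stays free, so the result is an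
  element of V^G. The ordinary derivative of the torsion serves as the covariant one because the
  connection form acts on \<open>W\<close> by zero. The \<open>G\<close>-connection is known only
  through its parallel frames; to place its connection form in the Lie algebra, such a frame is
  compared with a section, which gives a curve in \<open>G\<close> to be differentiated.\<close>

lemma Ck_on_Suc_imp: "Ck_on (Suc k) S f \<Longrightarrow> Ck_on k S f"
proof (induction k arbitrary: f)
  case 0
  then show ?case
    by (auto intro!: differentiable_imp_continuous_on simp: differentiable_on_def
        intro: differentiable_at_withinI differentiable_at_imp_differentiable_on)
next
  case (Suc k)
  then show ?case by (metis Ck_on.simps(2))
qed

text \<open>Derivatives are taken at points of \<open>S\<close> with respect to the whole space, so
  agreement on \<open>S\<close> determines them because \<open>S\<close> is open.\<close>

lemma Ck_on_cong:
  assumes "open S" "\<And>x. x \<in> S \<Longrightarrow> f x = g x"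
  shows "Ck_on k S f \<longleftrightarrow> Ck_on k S g"
proof -
  have *: "Ck_on k S g" if "Ck_on k S f" "\<And>x. x \<in> S \<Longrightarrow> f x = g x" for f g :: "'a \<Rightarrow> 'b"
    using that
  proof (induction k arbitrary: f g)
    case 0
    then show ?case by (simp cong: continuous_on_cong)
  next
    case (Suc k)
    have d: "(g has_derivative frechet_derivative f (at x)) (at x)" if "x \<in> S" for x
    proof (rule has_derivative_transform_within_open)
      show "(f has_derivative frechet_derivative f (at x)) (at x)"
        using Suc.prems(1) that by (simp add: frechet_derivative_works[THEN iffD1])
    qed (use that assms(1) Suc.prems in auto)
    then have "frechet_derivative g (at x) = frechet_derivative f (at x)" if "x \<in> S" for x
      using that frechet_derivative_at by fastforce
    then have "Ck_on k S (\<lambda>x. frechet_derivative g (at x) v)" for v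
      using Suc.IH[of "\<lambda>x. frechet_derivative f (at x) v" "\<lambda>x. frechet_derivative g (at x) v"] Suc.prems(1)
      by simp
    then show ?case using d by (auto simp: differentiable_def)
  qed
  from *[of f g] *[of g f] assms(2) show ?thesis by auto
qed

lemma Ck_on_subset: "Ck_on k S f \<Longrightarrow> T \<subseteq> S \<Longrightarrow> Ck_on k T f"
  by (induction k arbitrary: f) (auto intro: continuous_on_subset)

text \<open>Lets a closed formula \<open>f'\<close> stand in for \<open>frechet_derivative\<close>,
  so that the closure properties below follow by induction on \<open>k\<close> from the usual
  differentiation rules.\<close>

lemma Ck_on_SucI:
  assumes "open S" "\<And>x. x \<in> S \<Longrightarrow> (f has_derivative f' x) (at x)" "\<And>v. Ck_on k S (\<lambda>x. f' x v)"
  shows "Ck_on (Suc k) S f"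
proof -
  have "frechet_derivative f (at x) = f' x" if "x \<in> S" for x
    using assms(2)[OF that] frechet_derivative_at by metis
  then have "Ck_on k S (\<lambda>x. frechet_derivative f (at x) v)" for v
    using assms(3)[of v] Ck_on_cong[OF assms(1), of "\<lambda>x. frechet_derivative f (at x) v" "\<lambda>x. f' x v" k]
    by simp
  then show ?thesis using assms(2) by (auto simp: differentiable_def)
qed

lemma Ck_on_SucD:
  assumes "Ck_on (Suc k) S f"
  shows "x \<in> S \<Longrightarrow> (f has_derivative frechet_derivative f (at x)) (at x)"
    "Ck_on k S (\<lambda>x. frechet_derivative f (at x) v)"
  using assms by (auto simp: frechet_derivative_works)

lemma Ck_on_const [simp]: "open S \<Longrightarrow> Ck_on k S (\<lambda>x. c)"
proof (induction k arbitrary: c)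
  case (Suc k)
  show ?case by (rule Ck_on_SucI[where f' = "\<lambda>_ _. 0"]) (use Suc in auto)
qed simp

lemma Ck_on_bounded_linear:
  assumes "bounded_linear h" "open S" "Ck_on k S f"
  shows "Ck_on k S (\<lambda>x. h (f x))"
  using assms(3)
proof (induction k arbitrary: f)
  case 0
  then show ?case using bounded_linear.continuous_on[OF assms(1)] by auto
next
  case (Suc k)
  show ?case
    by (rule Ck_on_SucI[where f' = "\<lambda>x v. h (frechet_derivative f (at x) v)"])
      (use assms Suc in \<open>auto intro!: bounded_linear.has_derivative[OF assms(1)] simp: frechet_derivative_works[THEN iffD1]\<close>)
qed

lemma Ck_on_add:
  assumes "open S" "Ck_on k S f" "Ck_on k S g"
  shows "Ck_on k S (\<lambda>x. f x + g x)"
  using assms(2,3)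
proof (induction k arbitrary: f g)
  case 0
  then show ?case by (auto intro: continuous_on_add)
next
  case (Suc k)
  show ?case
    by (rule Ck_on_SucI[where f' = "\<lambda>x v. frechet_derivative f (at x) v + frechet_derivative g (at x) v"])
      (use assms Suc in \<open>auto intro!: has_derivative_add simp: frechet_derivative_works[THEN iffD1]\<close>)
qed

lemma Ck_on_sum:
  assumes "open S" "\<And>i. i \<in> I \<Longrightarrow> Ck_on k S (f i)"
  shows "Ck_on k S (\<lambda>x. \<Sum>i\<in>I. f i x)"
  using assms(2) by (induction I rule: infinite_finite_induct) (auto intro: Ck_on_add simp: assms(1))

lemma Ck_on_bounded_bilinear:
  assumes "bounded_bilinear h" "open S" "Ck_on k S f" "Ck_on k S g"
  shows "Ck_on k S (\<lambda>x. h (f x) (g x))"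
  using assms(3,4)
proof (induction k arbitrary: f g)
  case 0
  then show ?case using bounded_bilinear.continuous_on[OF assms(1)] by auto
next
  case (Suc k)
  show ?case
  proof (rule Ck_on_SucI[OF assms(2)])
    show "((\<lambda>x. h (f x) (g x)) has_derivative
        (\<lambda>v. h (f x) (frechet_derivative g (at x) v) + h (frechet_derivative f (at x) v) (g x))) (at x)"
      if "x \<in> S" for x
      by (rule bounded_bilinear.FDERIV[OF assms(1)]) (use that Suc.prems in \<open>auto simp: frechet_derivative_works[THEN iffD1]\<close>)
    show "Ck_on k S (\<lambda>x. h (f x) (frechet_derivative g (at x) v) + h (frechet_derivative f (at x) v) (g x))" for v
      by (rule Ck_on_add[OF assms(2) Suc.IH[OF Ck_on_Suc_imp[OF Suc.prems(1)] Ck_on_SucD(2)[OF Suc.prems(2)]]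
            Suc.IH[OF Ck_on_SucD(2)[OF Suc.prems(1)] Ck_on_Suc_imp[OF Suc.prems(2)]]])
  qed
qed

text \<open>\<open>Ck_on\<close> controls derivatives along fixed vectors, whereas the chain rule
  evaluates the derivative of \<open>f\<close> at the moving vector
  \<open>frechet_derivative g (at x) v\<close>. Expanding that vector in a basis turns the
  derivative into a finite sum of products covered by the induction hypothesis; hence the Euclidean
  middle space.\<close>

lemma Ck_on_compose:
  fixes f :: "'b::euclidean_space \<Rightarrow> 'c::real_normed_vector"
  assumes "open S" "g ` S \<subseteq> T" "Ck_on k T f" "Ck_on k S g"
  shows "Ck_on k S (\<lambda>x. f (g x))"
  using assms(3,4)
proof (induction k arbitrary: f)
  case 0
  then show ?case using assms(2) by (auto intro: continuous_on_compose2)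
next
  case (Suc k)
  show ?case
  proof (rule Ck_on_SucI[OF assms(1)])
    show "((\<lambda>x. f (g x)) has_derivative
        (\<lambda>v. \<Sum>b\<in>Basis. (frechet_derivative g (at x) v \<bullet> b) *\<^sub>R frechet_derivative f (at (g x)) b)) (at x)"
      if "x \<in> S" for x
    proof -
      have gx: "g x \<in> T" using that assms(2) by auto
      have 1: "(f has_derivative frechet_derivative f (at (g x))) (at (g x))"
        using Ck_on_SucD(1)[OF Suc.prems(1) gx] .
      have 2: "(g has_derivative frechet_derivative g (at x)) (at x)"
        using Ck_on_SucD(1)[OF Suc.prems(2) that] .
      have "(f \<circ> g has_derivative frechet_derivative f (at (g x)) \<circ> frechet_derivative g (at x)) (at x)"
        by (rule diff_chain_at[OF 2 1])
      moreover have "frechet_derivative f (at (g x)) \<circ> frechet_derivative g (at x) =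
          (\<lambda>v. \<Sum>b\<in>Basis. (frechet_derivative g (at x) v \<bullet> b) *\<^sub>R frechet_derivative f (at (g x)) b)"
      proof
        fix v
        define w where "w = frechet_derivative g (at x) v"
        have l: "linear (frechet_derivative f (at (g x)))" using 1 has_derivative_linear by blast
        have "frechet_derivative f (at (g x)) w = frechet_derivative f (at (g x)) (\<Sum>b\<in>Basis. (w \<bullet> b) *\<^sub>R b)"
          by (simp add: euclidean_representation)
        also have "\<dots> = (\<Sum>b\<in>Basis. (w \<bullet> b) *\<^sub>R frechet_derivative f (at (g x)) b)"
          by (simp add: linear_sum[OF l] linear_scale[OF l])
        finally show "(frechet_derivative f (at (g x)) \<circ> frechet_derivative g (at x)) v =
            (\<Sum>b\<in>Basis. (frechet_derivative g (at x) v \<bullet> b) *\<^sub>R frechet_derivative f (at (g x)) b)"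
          by (simp only: w_def o_apply)
      qed
      ultimately show ?thesis by (simp only: o_def)
    qed
    fix v
    have 1: "Ck_on k S (\<lambda>x. frechet_derivative g (at x) v)"
      by (rule Ck_on_SucD(2)[OF Suc.prems(2)])
    have 2: "Ck_on k S (\<lambda>x. frechet_derivative g (at x) v \<bullet> b)" for b
      by (rule Ck_on_bounded_linear[OF bounded_linear_inner_left assms(1) 1])
    have 3: "Ck_on k T (\<lambda>x. frechet_derivative f (at x) b)" for b
      by (rule Ck_on_SucD(2)[OF Suc.prems(1)])
    have 4: "Ck_on k S (\<lambda>x. frechet_derivative f (at (g x)) b)" for b
      using Suc.IH[OF 3 Ck_on_Suc_imp[OF Suc.prems(2)]] .
    have 5: "Ck_on k S (\<lambda>x. (frechet_derivative g (at x) v \<bullet> b) *\<^sub>R frechet_derivative f (at (g x)) b)" for b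
      by (rule Ck_on_bounded_bilinear[OF bounded_bilinear_scaleR assms(1) 2 4])
    show "Ck_on k S (\<lambda>x. \<Sum>b\<in>Basis. (frechet_derivative g (at x) v \<bullet> b) *\<^sub>R frechet_derivative f (at (g x)) b)"
      by (rule Ck_on_sum[OF assms(1) 5])
  qed
qed

lemma smooth_on_cong:
  "open S \<Longrightarrow> (\<And>x. x \<in> S \<Longrightarrow> f x = g x) \<Longrightarrow> smooth_on S f \<longleftrightarrow> smooth_on S g"
  using Ck_on_cong[of S f g] by (simp add: smooth_on_def)

lemma smooth_on_subset: "smooth_on S f \<Longrightarrow> T \<subseteq> S \<Longrightarrow> smooth_on T f"
  by (auto simp: smooth_on_def intro: Ck_on_subset)

lemma smooth_on_derivative: "smooth_on S f \<Longrightarrow> smooth_on S (\<lambda>x. frechet_derivative f (at x) v)"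
  unfolding smooth_on_def by (metis Ck_on.simps(2))

lemma smooth_on_has_derivative:
  "smooth_on S f \<Longrightarrow> x \<in> S \<Longrightarrow> (f has_derivative frechet_derivative f (at x)) (at x)"
  unfolding smooth_on_def using Ck_on_SucD(1) by blast

lemma smooth_on_const [simp]: "open S \<Longrightarrow> smooth_on S (\<lambda>x. c)"
  by (simp add: smooth_on_def)

lemma smooth_on_bounded_linear:
  "bounded_linear h \<Longrightarrow> open S \<Longrightarrow> smooth_on S f \<Longrightarrow> smooth_on S (\<lambda>x. h (f x))"
  by (simp add: smooth_on_def Ck_on_bounded_linear)

lemma smooth_on_bounded_bilinear:
  "bounded_bilinear h \<Longrightarrow> open S \<Longrightarrow> smooth_on S f \<Longrightarrow> smooth_on S g \<Longrightarrow> smooth_on S (\<lambda>x. h (f x) (g x))"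
  by (simp add: smooth_on_def Ck_on_bounded_bilinear)

lemma smooth_on_scaleR:
  "open S \<Longrightarrow> smooth_on S f \<Longrightarrow> smooth_on S g \<Longrightarrow> smooth_on S (\<lambda>x. f x *\<^sub>R g x)"
  by (rule smooth_on_bounded_bilinear[OF bounded_bilinear_scaleR])

lemma smooth_on_add:
  "open S \<Longrightarrow> smooth_on S f \<Longrightarrow> smooth_on S g \<Longrightarrow> smooth_on S (\<lambda>x. f x + g x)"
  by (simp add: smooth_on_def Ck_on_add)

lemma smooth_on_sum:
  "open S \<Longrightarrow> (\<And>i. i \<in> I \<Longrightarrow> smooth_on S (f i)) \<Longrightarrow> smooth_on S (\<lambda>x. \<Sum>i\<in>I. f i x)"
  by (simp add: smooth_on_def Ck_on_sum)

lemma smooth_on_compose: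
  fixes f :: "'b::euclidean_space \<Rightarrow> 'c::real_normed_vector"
  shows "open S \<Longrightarrow> g ` S \<subseteq> T \<Longrightarrow> smooth_on T f \<Longrightarrow> smooth_on S g \<Longrightarrow> smooth_on S (\<lambda>x. f (g x))"
  unfolding smooth_on_def using Ck_on_compose by blast

lemma smooth_on_id: "open S \<Longrightarrow> smooth_on S (\<lambda>x. x)"
  unfolding smooth_on_def
proof
  fix k assume "open S"
  then show "Ck_on k S (\<lambda>x. x)"
    by (cases k) (auto intro!: Ck_on_SucI[where f' = "\<lambda>_ v. v"])
qed

section \<open>Symmetry of second derivatives\<close>

lemma second_derivative_symmetric_real:
  fixes f :: "'a::real_normed_vector \<Rightarrow> real"
  assumes "open S" "Ck_on 2 S f" "x \<in> S"
  shows "frechet_derivative (\<lambda>y. frechet_derivative f (at y) u) (at x) v =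
         frechet_derivative (\<lambda>y. frechet_derivative f (at y) v) (at x) u"
proof -
  define d where "d u y = frechet_derivative f (at y) u" for u y
  define dd where "dd u v y = frechet_derivative (d u) (at y) v" for u v y
  have C2: "Ck_on (Suc (Suc 0)) S f" using assms(2) by (simp add: numeral_2_eq_2)
  have fd: "(f has_derivative (\<lambda>u. d u y)) (at y)" if "y \<in> S" for y
    using Ck_on_SucD(1)[OF C2 that] by (simp add: d_def)
  have C1: "Ck_on (Suc 0) S (d u)" for u
    unfolding d_def[abs_def] by (rule Ck_on_SucD(2)[OF C2])
  have dd: "(d u has_derivative (\<lambda>v. dd u v y)) (at y)" if "y \<in> S" for u y
    using Ck_on_SucD(1)[OF C1 that] by (simp add: dd_def)
  have cont: "continuous_on S (dd u v)" for u v
    using Ck_on_SucD(2)[OF C1, of u v] by (simp add: dd_def[abs_def])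
  have lin: "d (r *\<^sub>R u) y = r * d u y" if "y \<in> S" for r u y
    using linear_scale[OF has_derivative_linear[OF fd[OF that]]] by simp
  have lin2: "dd u (r *\<^sub>R v) y = r * dd u v y" if "y \<in> S" for r u v y
    using linear_scale[OF has_derivative_linear[OF dd[OF that]]] by simp
  obtain r where r: "r > 0" "ball x r \<subseteq> S" using assms(1,3) open_contains_ball by blast
  text \<open>Both mixed derivatives are limits of the same second difference quotient.\<close>
  have mvt: "\<exists>a\<in>{0<..<t}. \<exists>b\<in>{0<..<t}.
      f (x + t *\<^sub>R u + t *\<^sub>R v) - f (x + t *\<^sub>R u) - f (x + t *\<^sub>R v) + f x = t * t * dd u v (x + a *\<^sub>R u + b *\<^sub>R v)"
    if t: "t > 0" "t * (norm u + norm v) < r" for t u v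
  proof -
    have inS: "x + a *\<^sub>R u + b *\<^sub>R v \<in> S" if "0 \<le> a" "a \<le> t" "0 \<le> b" "b \<le> t" for a b
    proof -
      have "norm (a *\<^sub>R u + b *\<^sub>R v) \<le> a * norm u + b * norm v"
        using norm_triangle_ineq[of "a *\<^sub>R u" "b *\<^sub>R v"] that by simp
      also have "\<dots> \<le> t * norm u + t * norm v"
        using that by (intro add_mono mult_right_mono) auto
      also have "\<dots> < r" using t by (simp add: algebra_simps)
      finally show ?thesis using r(2) by (auto simp: dist_norm norm_minus_commute algebra_simps subset_iff)
    qed
    \<comment> \<open>A difference in the direction \<open>v\<close>. The mean value theorem is
      applied to \<open>h\<close>, which moves along \<open>u\<close>, and then along
      \<open>v\<close> to the derivative so obtained; this yields the two intermediate
      points.\<close>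
    define h where "h a = f (x + a *\<^sub>R u + t *\<^sub>R v) - f (x + a *\<^sub>R u)" for a
    have "(h has_real_derivative (d u (x + a *\<^sub>R u + t *\<^sub>R v) - d u (x + a *\<^sub>R u))) (at a)" if a: "0 \<le> a" "a \<le> t" for a
    proof -
      have 1: "x + a *\<^sub>R u + t *\<^sub>R v \<in> S" and 2: "x + a *\<^sub>R u \<in> S"
        using inS[OF a, of t] inS[OF a, of 0] t by auto
      have "((\<lambda>a. f (x + a *\<^sub>R u + t *\<^sub>R v)) has_derivative (\<lambda>r. d (r *\<^sub>R u) (x + a *\<^sub>R u + t *\<^sub>R v))) (at a)"
        by (rule has_derivative_compose[where f = "\<lambda>a. x + a *\<^sub>R u + t *\<^sub>R v", OF _ fd[OF 1]])
          (auto intro!: derivative_eq_intros)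
      moreover have "((\<lambda>a. f (x + a *\<^sub>R u)) has_derivative (\<lambda>r. d (r *\<^sub>R u) (x + a *\<^sub>R u))) (at a)"
        by (rule has_derivative_compose[where f = "\<lambda>a. x + a *\<^sub>R u", OF _ fd[OF 2]])
          (auto intro!: derivative_eq_intros)
      ultimately have "(h has_derivative (\<lambda>r. d (r *\<^sub>R u) (x + a *\<^sub>R u + t *\<^sub>R v) - d (r *\<^sub>R u) (x + a *\<^sub>R u))) (at a)"
        unfolding h_def by (rule has_derivative_diff)
      then show ?thesis
        unfolding has_field_derivative_def lin[OF 1] lin[OF 2] by (simp add: left_diff_distrib[symmetric] mult_commute_abs flip: right_diff_distrib)
    qed
    from MVT2[OF t(1) this] obtain a where a: "0 < a" "a < t"
      "h t - h 0 = t * (d u (x + a *\<^sub>R u + t *\<^sub>R v) - d u (x + a *\<^sub>R u))" by auto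
    define k where "k b = d u (x + a *\<^sub>R u + b *\<^sub>R v)" for b
    have "(k has_real_derivative (dd u v (x + a *\<^sub>R u + b *\<^sub>R v))) (at b)" if b: "0 \<le> b" "b \<le> t" for b
    proof -
      have 1: "x + a *\<^sub>R u + b *\<^sub>R v \<in> S" using inS[OF _ _ b, of a] a by auto
      have "(k has_derivative (\<lambda>r. dd u (r *\<^sub>R v) (x + a *\<^sub>R u + b *\<^sub>R v))) (at b)"
        unfolding k_def
        by (rule has_derivative_compose[where f = "\<lambda>b. x + a *\<^sub>R u + b *\<^sub>R v", OF _ dd[OF 1]])
          (auto intro!: derivative_eq_intros)
      then show ?thesis
        unfolding has_field_derivative_def lin2[OF 1] by (simp add: mult_commute_abs)
    qed
    from MVT2[OF t(1) this] obtain b where b: "0 < b" "b < t"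
      "k t - k 0 = t * dd u v (x + a *\<^sub>R u + b *\<^sub>R v)" by auto
    show ?thesis
      using a b unfolding h_def k_def
      by (intro bexI[of _ a] bexI[of _ b]) (auto simp: algebra_simps)
  qed
  have lim: "((\<lambda>t. (f (x + t *\<^sub>R u + t *\<^sub>R v) - f (x + t *\<^sub>R u) - f (x + t *\<^sub>R v) + f x) / (t * t)) \<longlongrightarrow> dd u v x) (at_right 0)"
    for u v
  proof (rule tendstoI)
    fix e :: real assume e: "e > 0"
    obtain s where s: "s > 0" "\<And>y. y \<in> S \<Longrightarrow> dist y x < s \<Longrightarrow> dist (dd u v y) (dd u v x) < e"
      using cont[of u v] assms(3) e unfolding continuous_on_iff by metis
    \<comment> \<open>For \<open>t < m\<close> the parallelogram spanned by
      \<open>t *\<^sub>R u\<close> and \<open>t *\<^sub>R v\<close> at \<open>x\<close> stays within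
      distance \<open>min r s\<close>; the summand 1 covers \<open>u = v = 0\<close>.\<close>
    define m where "m = min r s / (norm u + norm v + 1)"
    have np: "norm u + norm v + 1 > 0" by (smt (verit) norm_ge_zero)
    have m: "m > 0" using r s np by (simp add: m_def)
    have "dist ((f (x + t *\<^sub>R u + t *\<^sub>R v) - f (x + t *\<^sub>R u) - f (x + t *\<^sub>R v) + f x) / (t * t)) (dd u v x) < e"
      if t: "0 < t" "t < m" for t
    proof -
      have "t * (norm u + norm v + 1) < min r s" using t np by (simp add: m_def pos_less_divide_eq)
      then have tr: "t * (norm u + norm v) < min r s" using t by (simp add: algebra_simps)
      then obtain a b where ab: "0 < a" "a < t" "0 < b" "b < t"
        "f (x + t *\<^sub>R u + t *\<^sub>R v) - f (x + t *\<^sub>R u) - f (x + t *\<^sub>R v) + f x = t * t * dd u v (x + a *\<^sub>R u + b *\<^sub>R v)"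
        using mvt[of t u v] t by auto
      have "norm (a *\<^sub>R u + b *\<^sub>R v) \<le> a * norm u + b * norm v"
        using norm_triangle_ineq[of "a *\<^sub>R u" "b *\<^sub>R v"] ab by simp
      also have "\<dots> \<le> t * norm u + t * norm v"
        using ab by (intro add_mono mult_right_mono) auto
      also have "\<dots> < min r s" using tr by (simp add: algebra_simps)
      finally have n: "norm (a *\<^sub>R u + b *\<^sub>R v) < min r s" .
      then have "x + a *\<^sub>R u + b *\<^sub>R v \<in> S" "dist (x + a *\<^sub>R u + b *\<^sub>R v) x < s"
        using r(2) by (auto simp: dist_norm norm_minus_commute algebra_simps subset_iff)
      then show ?thesis using s(2) ab t by simp
    qed
    then show "\<forall>\<^sub>F t in at_right 0. dist ((f (x + t *\<^sub>R u + t *\<^sub>R v) - f (x + t *\<^sub>R u) - f (x + t *\<^sub>R v) + f x) / (t * t)) (dd u v x) < e"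
      using m by (auto simp: eventually_at_right_field)
  qed
  have "((\<lambda>t. (f (x + t *\<^sub>R u + t *\<^sub>R v) - f (x + t *\<^sub>R u) - f (x + t *\<^sub>R v) + f x) / (t * t)) \<longlongrightarrow> dd v u x) (at_right 0)"
    using lim[of v u] by (simp add: algebra_simps)
  with lim[of u v] have "dd u v x = dd v u x" using tendsto_unique trivial_limit_at_right_real by blast
  then show ?thesis by (simp add: dd_def d_def[abs_def])
qed

lemma second_derivative_symmetric:
  fixes f :: "'a::real_normed_vector \<Rightarrow> 'b::euclidean_space"
  assumes "open S" "smooth_on S f" "x \<in> S"
  shows "frechet_derivative (\<lambda>y. frechet_derivative f (at y) u) (at x) v =
         frechet_derivative (\<lambda>y. frechet_derivative f (at y) v) (at x) u"
proof (rule euclidean_eqI)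
  fix b :: 'b assume "b \<in> Basis"
  define h where "h y = f y \<bullet> b" for y
  have fd: "(f has_derivative frechet_derivative f (at y)) (at y)" if "y \<in> S" for y
    using smooth_on_has_derivative[OF assms(2) that] .
  have hd: "frechet_derivative h (at y) w = frechet_derivative f (at y) w \<bullet> b" if "y \<in> S" for y w
  proof -
    have "(h has_derivative (\<lambda>w. frechet_derivative f (at y) w \<bullet> b)) (at y)"
      unfolding h_def by (intro has_derivative_inner_left fd that)
    then show ?thesis using frechet_derivative_at by metis
  qed
  have hdd: "frechet_derivative (\<lambda>y. frechet_derivative h (at y) u) (at x) v =
      frechet_derivative (\<lambda>y. frechet_derivative f (at y) u) (at x) v \<bullet> b" for u v
  proof -
    have "((\<lambda>y. frechet_derivative f (at y) u \<bullet> b) has_derivative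
        (\<lambda>v. frechet_derivative (\<lambda>y. frechet_derivative f (at y) u) (at x) v \<bullet> b)) (at x)"
      by (intro has_derivative_inner_left smooth_on_has_derivative[OF smooth_on_derivative[OF assms(2)]] assms)
    then have "((\<lambda>y. frechet_derivative h (at y) u) has_derivative
        (\<lambda>v. frechet_derivative (\<lambda>y. frechet_derivative f (at y) u) (at x) v \<bullet> b)) (at x)"
      by (rule has_derivative_transform_within_open[OF _ assms(1,3)]) (simp add: hd)
    then show ?thesis using frechet_derivative_at by metis
  qed
  have "Ck_on 2 S h"
    using smooth_on_bounded_linear[OF bounded_linear_inner_left assms(1,2)] unfolding smooth_on_def h_def[abs_def] by blast
  from second_derivative_symmetric_real[OF assms(1) this assms(3), of u v]
  show "frechet_derivative (\<lambda>y. frechet_derivative f (at y) u) (at x) v \<bullet> b =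
      frechet_derivative (\<lambda>y. frechet_derivative f (at y) v) (at x) u \<bullet> b"
    by (simp add: hdd)
qed

text \<open>A subspace is cut out by linear equations \<open>z \<bullet> y = 0\<close> with
  \<open>z\<close> in the orthogonal complement, and these can be differentiated. In this way
  derivatives of connection forms stay in the Lie algebra, and derivatives of the torsion in
  \<open>W\<close> and \<open>Lambda3\<close>.\<close>

lemma has_derivative_in_subspace:
  fixes f :: "'a::real_normed_vector \<Rightarrow> 'b::euclidean_space"
  assumes "subspace S" "open U" "x \<in> U" "\<And>y. y \<in> U \<Longrightarrow> f y \<in> S" "(f has_derivative F) (at x)"
  shows "F v \<in> S"
proof -
  have "z \<bullet> F v = 0" if z: "z \<in> orthogonal_comp S" for z
  proof -
    have "((\<lambda>y. z \<bullet> f y) has_derivative (\<lambda>v. z \<bullet> F v)) (at x)"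
      by (intro has_derivative_inner_right assms)
    then have "((\<lambda>y. 0) has_derivative (\<lambda>v. z \<bullet> F v)) (at x)"
      by (rule has_derivative_transform_within_open[OF _ assms(2,3)])
        (use z assms(4) in \<open>auto simp: orthogonal_comp_def orthogonal_def inner_commute\<close>)
    then have "(\<lambda>v. z \<bullet> F v) = (\<lambda>v. 0)"
      using has_derivative_unique has_derivative_const by blast
    then show ?thesis by metis
  qed
  then have "F v \<in> orthogonal_comp (orthogonal_comp S)"
    by (auto simp: orthogonal_comp_def orthogonal_def)
  then show ?thesis using orthogonal_comp_self[OF assms(1)] by simp
qed

lemma orthogonal_projection_exists:
  fixes S :: "'a::euclidean_space set"
  assumes "subspace S"
  shows "\<exists>P. linear P \<and> (\<forall>x. P x \<in> S) \<and> (\<forall>x. \<forall>y\<in>S. (x - P x) \<bullet> y = 0)"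
proof -
  obtain B where B: "B \<subseteq> S" "pairwise orthogonal B" "\<And>x. x \<in> B \<Longrightarrow> norm x = 1"
    "independent B" "span B = S"
    using orthonormal_basis_subspace[OF assms] by metis
  have fin: "finite B" using B(4) independent_imp_finite by blast
  define P where "P x = (\<Sum>b\<in>B. (x \<bullet> b) *\<^sub>R b)" for x
  have "linear P"
    unfolding P_def by (intro linearI) (simp_all add: inner_add_left algebra_simps sum.distrib scaleR_sum_right)
  moreover have "P x \<in> S" for x
    unfolding P_def using B(1) assms by (auto intro!: subspace_sum subspace_scale)
  moreover have "(x - P x) \<bullet> y = 0" if "y \<in> S" for x y
  proof -
    have "(x - P x) \<bullet> b = 0" if b: "b \<in> B" for b
    proof -
      have "P x \<bullet> b = (\<Sum>c\<in>B. (x \<bullet> c) * (c \<bullet> b))" by (simp add: P_def inner_sum_left)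
      also have "\<dots> = (\<Sum>c\<in>B. if c = b then x \<bullet> b else 0)"
      proof (rule sum.cong)
        fix c assume "c \<in> B"
        then show "(x \<bullet> c) * (c \<bullet> b) = (if c = b then x \<bullet> b else 0)"
          using B(2) b B(3)[OF b] by (auto simp: pairwise_def orthogonal_def norm_eq_1)
      qed simp
      also have "\<dots> = x \<bullet> b" using fin b by simp
      finally show ?thesis by (simp add: inner_diff_left)
    qed
    then show ?thesis
      using orthogonal_to_span[of y B "x - P x"] that B(5) by (auto simp: orthogonal_def inner_commute)
  qed
  ultimately show ?thesis by blast
qed

section \<open>The Lie algebra and the orthogonal projections\<close>

lemma bounded_bilinear_matrix_mult:
  "bounded_bilinear ((**) :: real^'n::finite^'n \<Rightarrow> real^'n^'n \<Rightarrow> real^'n^'n)"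
proof -
  have "bilinear ((**) :: real^'n^'n \<Rightarrow> real^'n^'n \<Rightarrow> real^'n^'n)"
    by (auto simp: bilinear_def intro!: linearI simp: matrix_add_ldistrib matrix_matrix_mult_def vec_eq_iff
        sum.distrib algebra_simps sum_distrib_left)
  then show ?thesis by (rule bilinear_conv_bounded_bilinear[THEN iffD1])
qed

lemma inner_matrix: "X \<bullet> Y = (\<Sum>i\<in>UNIV. \<Sum>j\<in>UNIV. X $ i $ j * Y $ i $ j)"
  for X Y :: "real^'n::finite^'n"
  by (simp add: inner_vec_def)

lemma inner_matrix_mult_left: "(a ** X) \<bullet> Y = X \<bullet> (transpose a ** Y)"
  for X Y :: "real^'n::finite^'n"
proof -
  have "(a ** X) \<bullet> Y = (\<Sum>i\<in>UNIV. \<Sum>j\<in>UNIV. \<Sum>k\<in>UNIV. a $ i $ k * X $ k $ j * Y $ i $ j)"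
    by (simp add: inner_matrix matrix_matrix_mult_def sum_distrib_right)
  also have "\<dots> = (\<Sum>i\<in>UNIV. \<Sum>k\<in>UNIV. \<Sum>j\<in>UNIV. a $ i $ k * X $ k $ j * Y $ i $ j)"
    by (intro sum.cong refl sum.swap)
  also have "\<dots> = (\<Sum>k\<in>UNIV. \<Sum>i\<in>UNIV. \<Sum>j\<in>UNIV. a $ i $ k * X $ k $ j * Y $ i $ j)"
    by (rule sum.swap)
  also have "\<dots> = (\<Sum>k\<in>UNIV. \<Sum>j\<in>UNIV. \<Sum>i\<in>UNIV. a $ i $ k * X $ k $ j * Y $ i $ j)"
    by (intro sum.cong refl sum.swap)
  also have "\<dots> = X \<bullet> (transpose a ** Y)"
    by (simp add: inner_matrix matrix_matrix_mult_def transpose_def sum_distrib_left mult_ac)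
  finally show ?thesis .
qed

lemma inner_transpose: "transpose X \<bullet> transpose Y = X \<bullet> Y" for X Y :: "real^'n::finite^'n"
  unfolding inner_matrix transpose_def by (simp, rule sum.swap)

lemma inner_matrix_mult_right: "(X ** a) \<bullet> Y = X \<bullet> (Y ** transpose a)"
  for X Y :: "real^'n::finite^'n"
proof -
  have "(X ** a) \<bullet> Y = (transpose a ** transpose X) \<bullet> transpose Y"
    by (simp add: inner_transpose flip: matrix_transpose_mul)
  also have "\<dots> = transpose X \<bullet> transpose (Y ** transpose a)"
    by (simp add: inner_matrix_mult_left matrix_transpose_mul)
  finally show ?thesis by (simp only: inner_transpose)
qed

locale orthogonal_subgroup =
  fixes G :: "(real^'n::finite^'n) set"
  assumes orthogonal: "a \<in> G \<Longrightarrow> orthogonal_matrix a"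
    and one: "mat 1 \<in> G"
    and mult: "a \<in> G \<Longrightarrow> b \<in> G \<Longrightarrow> a ** b \<in> G"
    and inv: "a \<in> G \<Longrightarrow> matrix_inv a \<in> G"
begin

lemma matrix_inv_eq: "a \<in> G \<Longrightarrow> matrix_inv a = transpose a"
  unfolding matrix_inv_def
proof (rule some_equality)
  assume "a \<in> G"
  then show *: "a ** transpose a = mat 1 \<and> transpose a ** a = mat 1"
    using orthogonal[of a] by (auto simp: orthogonal_matrix_def)
  fix b assume "a ** b = mat 1 \<and> b ** a = mat 1"
  then show "b = transpose a"
    using * by (metis matrix_mul_assoc matrix_mul_lid matrix_mul_rid)
qed

lemma transpose_in: "a \<in> G \<Longrightarrow> transpose a \<in> G"
  using inv matrix_inv_eq by metis

lemma transpose_mult: "a \<in> G \<Longrightarrow> transpose a ** a = mat 1"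
  and mult_transpose: "a \<in> G \<Longrightarrow> a ** transpose a = mat 1"
  using orthogonal by (auto simp: orthogonal_matrix_def)

lemma inner_conj:
  assumes "a \<in> G"
  shows "(a ** X ** transpose a) \<bullet> (a ** Y ** transpose a) = X \<bullet> Y"
proof -
  have "(a ** X ** transpose a) \<bullet> (a ** Y ** transpose a) = X \<bullet> (transpose a ** (a ** Y ** transpose a ** a))"
    by (simp add: inner_matrix_mult_right[of "a ** X" "transpose a"] inner_matrix_mult_left[of a X])
  also have "transpose a ** (a ** Y ** transpose a ** a) = (transpose a ** a) ** Y ** (transpose a ** a)"
    by (simp add: matrix_mul_assoc)
  finally show ?thesis using transpose_mult[OF assms] by simp
qed

section \<open>Closure properties of the Lie algebra\<close>

lemma lie_algebraI:
  assumes "e > 0" "smooth_on {-e<..<e} \<gamma>" "\<And>t. t \<in> {-e<..<e} \<Longrightarrow> \<gamma> t \<in> G" "\<gamma> 0 = mat 1"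
    "(\<gamma> has_vector_derivative X) (at 0)"
  shows "X \<in> lie_algebra G"
  unfolding lie_algebra_def mem_Collect_eq
  by (rule exI[of _ \<gamma>], rule exI[of _ e]) (simp add: assms)

lemma lie_algebraE:
  assumes "X \<in> lie_algebra G"
  obtains e \<gamma> where "e > 0" "smooth_on {-e<..<e} \<gamma>" "\<And>t. t \<in> {-e<..<e} \<Longrightarrow> \<gamma> t \<in> G" "\<gamma> 0 = mat 1"
    "(\<gamma> has_vector_derivative X) (at 0)"
proof -
  from assms obtain \<gamma> e where "e > 0 \<and> smooth_on {-e<..<e} \<gamma> \<and> (\<forall>t\<in>{-e<..<e}. \<gamma> t \<in> G) \<and>
      \<gamma> 0 = mat 1 \<and> (\<gamma> has_vector_derivative X) (at 0)"
    unfolding lie_algebra_def mem_Collect_eq by (elim exE)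
  then show thesis by (intro that[of e \<gamma>]) simp_all
qed

text \<open>A sum of velocities is the velocity of the product of the curves, a multiple that of a
  reparametrised curve.\<close>

lemma subspace_lie_algebra: "subspace (lie_algebra G)"
proof (rule subspaceI)
  show "0 \<in> lie_algebra G"
    by (rule lie_algebraI[of 1 "\<lambda>_. mat 1"]) (auto simp: one)
next
  fix X Y assume X: "X \<in> lie_algebra G" and Y: "Y \<in> lie_algebra G"
  obtain e \<gamma> where e: "e > 0" "smooth_on {-e<..<e} \<gamma>" "\<And>t. t \<in> {-e<..<e} \<Longrightarrow> \<gamma> t \<in> G" "\<gamma> 0 = mat 1"
    "(\<gamma> has_vector_derivative X) (at 0)"
    by (rule lie_algebraE[OF X]) blast
  obtain d \<delta> where d: "d > 0" "smooth_on {-d<..<d} \<delta>" "\<And>t. t \<in> {-d<..<d} \<Longrightarrow> \<delta> t \<in> G" "\<delta> 0 = mat 1"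
    "(\<delta> has_vector_derivative Y) (at 0)"
    by (rule lie_algebraE[OF Y]) blast
  show "X + Y \<in> lie_algebra G"
  proof (rule lie_algebraI[of "min e d" "\<lambda>t. \<gamma> t ** \<delta> t"])
    show "smooth_on {- min e d<..<min e d} (\<lambda>t. \<gamma> t ** \<delta> t)"
      by (intro smooth_on_bounded_bilinear[OF bounded_bilinear_matrix_mult] smooth_on_subset[OF e(2)]
          smooth_on_subset[OF d(2)]) auto
    show "((\<lambda>t. \<gamma> t ** \<delta> t) has_vector_derivative X + Y) (at 0)"
      using bounded_bilinear.has_vector_derivative[OF bounded_bilinear_matrix_mult e(5) d(5)] e(4) d(4)
      by (simp add: add.commute)
  qed (use e d in \<open>auto intro: mult\<close>)
next
  fix r :: real and X assume X: "X \<in> lie_algebra G"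
  obtain e \<gamma> where e: "e > 0" "smooth_on {-e<..<e} \<gamma>" "\<And>t. t \<in> {-e<..<e} \<Longrightarrow> \<gamma> t \<in> G" "\<gamma> 0 = mat 1"
    "(\<gamma> has_vector_derivative X) (at 0)"
    by (rule lie_algebraE[OF X]) blast
  \<comment> \<open>Keeps \<open>r * t\<close> in the domain of \<open>\<gamma>\<close>; the
    denominator is positive also for \<open>r = 0\<close>.\<close>
  define d where "d = e / (\<bar>r\<bar> + 1)"
  have d: "d > 0" using e by (simp add: d_def)
  have rt: "r * t \<in> {-e<..<e}" if "t \<in> {-d<..<d}" for t
  proof -
    have "\<bar>t\<bar> < d" using that by auto
    then have "\<bar>t\<bar> * (\<bar>r\<bar> + 1) < e" by (simp add: d_def pos_less_divide_eq)
    then have "\<bar>r * t\<bar> + \<bar>t\<bar> < e" by (simp add: abs_mult algebra_simps)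
    then show ?thesis by auto
  qed
  show "r *\<^sub>R X \<in> lie_algebra G"
  proof (rule lie_algebraI[of d "\<lambda>t. \<gamma> (r * t)"])
    show "smooth_on {-d<..<d} (\<lambda>t. \<gamma> (r * t))"
    proof (rule smooth_on_compose[OF _ _ e(2)])
      show "(*) r ` {-d<..<d} \<subseteq> {-e<..<e}" using rt by blast
      show "smooth_on {-d<..<d} (\<lambda>t. r * t)"
        by (rule smooth_on_bounded_linear[OF bounded_linear_mult_right _ smooth_on_id]) auto
    qed auto
    have "((\<lambda>t. r * t) has_vector_derivative r) (at 0)"
      by (auto intro!: derivative_eq_intros simp: has_vector_derivative_def)
    from vector_diff_chain_at[OF this, of \<gamma> X] e(5)
    show "((\<lambda>t. \<gamma> (r * t)) has_vector_derivative r *\<^sub>R X) (at 0)" by (simp add: o_def)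
  qed (use d e rt in auto)
qed

lemma lie_algebra_conj:
  assumes "a \<in> G" "X \<in> lie_algebra G"
  shows "a ** X ** transpose a \<in> lie_algebra G"
proof -
  obtain e \<gamma> where e: "e > 0" "smooth_on {-e<..<e} \<gamma>" "\<And>t. t \<in> {-e<..<e} \<Longrightarrow> \<gamma> t \<in> G" "\<gamma> 0 = mat 1"
    "(\<gamma> has_vector_derivative X) (at 0)"
    by (rule lie_algebraE[OF assms(2)]) blast
  have l: "bounded_linear (\<lambda>X. a ** X ** transpose a)"
    by (intro bounded_linear_compose[OF bounded_bilinear.bounded_linear_left[OF bounded_bilinear_matrix_mult]]
        bounded_bilinear.bounded_linear_right[OF bounded_bilinear_matrix_mult])
  show ?thesis
  proof (rule lie_algebraI[OF e(1), of "\<lambda>t. a ** \<gamma> t ** transpose a"])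
    show "smooth_on {-e<..<e} (\<lambda>t. a ** \<gamma> t ** transpose a)"
      by (rule smooth_on_bounded_linear[OF l _ e(2)]) simp
    show "((\<lambda>t. a ** \<gamma> t ** transpose a) has_vector_derivative a ** X ** transpose a) (at 0)"
      by (rule bounded_linear.has_vector_derivative[OF l e(5)])
    show "a ** \<gamma> t ** transpose a \<in> G" if "t \<in> {-e<..<e}" for t
      by (intro mult transpose_in assms e(3) that)
  qed (simp add: e(4) mult_transpose assms)
qed

lemma curve_transpose:
  assumes "((\<gamma> :: real \<Rightarrow> real^'n^'n) has_vector_derivative X) (at 0)"
  shows "((\<lambda>t. transpose (\<gamma> t)) has_vector_derivative transpose X) (at 0)"
proof -
  have "linear (transpose :: real^'n^'n \<Rightarrow> real^'n^'n)"
    by (intro linearI) (simp_all add: transpose_def vec_eq_iff)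
  then show ?thesis
    using assms bounded_linear.has_vector_derivative linear_conv_bounded_linear by blast
qed

lemma curve_conj:
  assumes "((\<gamma> :: real \<Rightarrow> real^'n^'n) has_vector_derivative X) (at 0)" "\<gamma> 0 = mat 1"
  shows "((\<lambda>t. \<gamma> t ** Y ** transpose (\<gamma> t)) has_vector_derivative X ** Y + Y ** transpose X) (at 0)"
proof -
  have "((\<lambda>t. \<gamma> t ** Y) has_vector_derivative X ** Y) (at 0)"
    by (rule bounded_linear.has_vector_derivative[OF bounded_bilinear.bounded_linear_left[OF bounded_bilinear_matrix_mult] assms(1)])
  from bounded_bilinear.has_vector_derivative[OF bounded_bilinear_matrix_mult this curve_transpose[OF assms(1)]]
  show ?thesis using assms(2) by (simp add: transpose_mat add.commute)
qed

text \<open>Differentiate \<open>\<gamma> t ** transpose (\<gamma> t) = mat 1\<close> at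
  \<open>t = 0\<close>.\<close>

lemma lie_algebra_subset_so: "lie_algebra G \<subseteq> so"
proof
  fix X assume X: "X \<in> lie_algebra G"
  obtain e \<gamma> where e: "e > 0" "smooth_on {-e<..<e} \<gamma>" "\<And>t. t \<in> {-e<..<e} \<Longrightarrow> \<gamma> t \<in> G" "\<gamma> 0 = mat 1"
    "(\<gamma> has_vector_derivative X) (at 0)"
    by (rule lie_algebraE[OF X]) blast
  have "((\<lambda>t. \<gamma> t ** mat 1 ** transpose (\<gamma> t)) has_vector_derivative X + transpose X) (at 0)"
    using curve_conj[OF e(5,4), of "mat 1"] by simp
  then have "((\<lambda>t. mat 1) has_vector_derivative X + transpose X) (at 0)"
    by (rule has_vector_derivative_transform_within_open[where S = "{-e<..<e}"])
      (use e in \<open>auto simp: mult_transpose\<close>)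
  then have "X + transpose X = 0"
    using vector_derivative_unique_at has_vector_derivative_const by blast
  then show "X \<in> so" by (simp add: so_def add_eq_0_iff)
qed

text \<open>The curve \<open>\<gamma> t ** Y ** transpose (\<gamma> t)\<close> stays in the subspace
  \<open>lie_algebra G\<close>, hence so does its velocity at 0. As
  \<open>transpose X = - X\<close>, this velocity is the commutator.\<close>

lemma lie_algebra_bracket:
  assumes "X \<in> lie_algebra G" "Y \<in> lie_algebra G"
  shows "X ** Y - Y ** X \<in> lie_algebra G"
proof -
  obtain e \<gamma> where e: "e > 0" "smooth_on {-e<..<e} \<gamma>" "\<And>t. t \<in> {-e<..<e} \<Longrightarrow> \<gamma> t \<in> G" "\<gamma> 0 = mat 1"
    "(\<gamma> has_vector_derivative X) (at 0)"
    by (rule lie_algebraE[OF assms(1)]) blast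
  have "((\<lambda>t. \<gamma> t ** Y ** transpose (\<gamma> t)) has_derivative (\<lambda>r. r *\<^sub>R (X ** Y + Y ** transpose X))) (at 0)"
    using curve_conj[OF e(5,4)] by (simp add: has_vector_derivative_def)
  from has_derivative_in_subspace[OF subspace_lie_algebra open_greaterThanLessThan[of "-e" e] _ _ this, of 1]
  have "X ** Y + Y ** transpose X \<in> lie_algebra G"
    using e(1) lie_algebra_conj[OF e(3) assms(2)] by simp
  moreover have "transpose X = - X" using assms(1) lie_algebra_subset_so by (auto simp: so_def)
  moreover have "Y ** (- X) = - (Y ** X)" by (simp add: matrix_matrix_mult_def vec_eq_iff sum_negf)
  ultimately show ?thesis by simp
qed

lemma subspace_so: "subspace (so :: (real^'n^'n) set)"
proof -
  have "transpose 0 = (0 :: real^'n^'n)" "transpose (X + Y) = transpose X + transpose Y"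
    "transpose (c *\<^sub>R X) = c *\<^sub>R transpose X" for X Y :: "real^'n^'n" and c
    by (simp_all add: transpose_def vec_eq_iff)
  then show ?thesis unfolding so_def by (intro subspaceI) simp_all
qed

lemma so_conj: "X \<in> so \<Longrightarrow> a ** X ** transpose a \<in> so"
  by (simp add: so_def matrix_transpose_mul matrix_mul_assoc)
    (simp add: matrix_matrix_mult_def vec_eq_iff sum_negf)

lemma subspace_perp: "subspace (lie_algebra_perp G)"
proof -
  have "lie_algebra_perp G = so \<inter> orthogonal_comp (lie_algebra G)"
    by (auto simp: lie_algebra_perp_def orthogonal_comp_def orthogonal_def inner_commute)
  then show ?thesis using subspace_so subspace_orthogonal_comp subspace_inter by metis
qed

text \<open>Conjugation by \<open>a\<close> is an isometry of the matrices that preserves the Lie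
  algebra, hence also its orthogonal complement.\<close>

lemma perp_conj:
  assumes "a \<in> G" "X \<in> lie_algebra_perp G"
  shows "a ** X ** transpose a \<in> lie_algebra_perp G"
proof -
  have "(a ** X ** transpose a) \<bullet> Y = 0" if Y: "Y \<in> lie_algebra G" for Y
  proof -
    have "transpose a ** Y ** a \<in> lie_algebra G"
      using lie_algebra_conj[OF transpose_in[OF assms(1)] Y] by simp
    moreover have "(a ** X ** transpose a) \<bullet> Y = X \<bullet> (transpose a ** Y ** a)"
      by (simp add: inner_matrix_mult_right[of "a ** X" "transpose a"] inner_matrix_mult_left[of a X] matrix_mul_assoc)
    ultimately show ?thesis using assms(2) by (auto simp: lie_algebra_perp_def)
  qed
  then show ?thesis using assms(2) so_conj by (auto simp: lie_algebra_perp_def)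
qed

section \<open>The decomposition of so(n) into the Lie algebra and its complement\<close>

lemma perp_component_eqI:
  assumes "Z \<in> lie_algebra_perp G" "X - Z \<in> lie_algebra G"
  shows "perp_component G X = Z"
  unfolding perp_component_def
proof (rule the_equality)
  show "Z \<in> lie_algebra_perp G \<and> X - Z \<in> lie_algebra G" using assms by simp
next
  fix Z' assume Z': "Z' \<in> lie_algebra_perp G \<and> X - Z' \<in> lie_algebra G"
  have "Z' - Z \<in> lie_algebra_perp G" using Z' assms subspace_perp subspace_diff by blast
  moreover have "(X - Z) - (X - Z') \<in> lie_algebra G"
    using Z' assms subspace_lie_algebra subspace_diff by blast
  then have "Z' - Z \<in> lie_algebra G" by simp
  ultimately have "(Z' - Z) \<bullet> (Z' - Z) = 0" by (auto simp: lie_algebra_perp_def)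
  then show "Z' = Z" by simp
qed

text \<open>\<open>perp_component\<close> is a definite description without visible regularity. The
  linear map \<open>lie_proj\<close> gives it the form \<open>X - lie_proj X\<close> on
  \<open>so\<close>, from which the smoothness of the torsion follows.\<close>

definition lie_proj :: "real^'n^'n \<Rightarrow> real^'n^'n" where
  "lie_proj = (SOME P. linear P \<and> (\<forall>x. P x \<in> lie_algebra G) \<and> (\<forall>x. \<forall>y\<in>lie_algebra G. (x - P x) \<bullet> y = 0))"

lemma linear_lie_proj: "linear lie_proj"
  and lie_proj_in: "lie_proj X \<in> lie_algebra G"
  and lie_proj_orthogonal: "Y \<in> lie_algebra G \<Longrightarrow> (X - lie_proj X) \<bullet> Y = 0"
  using someI_ex[OF orthogonal_projection_exists[OF subspace_lie_algebra]] unfolding lie_proj_def by blast+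

lemma perp_component_eq:
  assumes "X \<in> so"
  shows "perp_component G X = X - lie_proj X"
proof (rule perp_component_eqI)
  show "X - lie_proj X \<in> lie_algebra_perp G"
    using assms lie_proj_in lie_algebra_subset_so subspace_diff[OF subspace_so] lie_proj_orthogonal
    unfolding lie_algebra_perp_def by blast
qed (simp add: lie_proj_in)

lemma perp_component_in: "X \<in> so \<Longrightarrow> perp_component G X \<in> lie_algebra_perp G"
  and diff_perp_component_in: "X \<in> so \<Longrightarrow> X - perp_component G X \<in> lie_algebra G"
proof -
  assume X: "X \<in> so"
  then show "X - perp_component G X \<in> lie_algebra G" by (simp add: perp_component_eq lie_proj_in)
  show "perp_component G X \<in> lie_algebra_perp G"
    using X lie_proj_in lie_algebra_subset_so subspace_diff[OF subspace_so] lie_proj_orthogonal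
    unfolding lie_algebra_perp_def perp_component_eq[OF X] by blast
qed

text \<open>With \<open>X\<close> a value of the Levi-Civita form and \<open>Y\<close> one of the
  form of a \<open>G\<close>-connection, this is the reason why the intrinsic torsion does not
  depend on the \<open>G\<close>-connection.\<close>

lemma perp_component_diff:
  assumes "X \<in> so" "Y \<in> lie_algebra G"
  shows "perp_component G (X - Y) = perp_component G X"
proof (rule perp_component_eqI)
  have "(X - perp_component G X) - Y \<in> lie_algebra G"
    using assms diff_perp_component_in subspace_diff subspace_lie_algebra by blast
  then show "X - Y - perp_component G X \<in> lie_algebra G" by (simp add: algebra_simps)
qed (use assms perp_component_in in auto)

text \<open>Conjugation preserves both summands of the decomposition and therefore commutes with the
  projection. The weights \<open>c l\<close> stand for the action of \<open>tensor_act\<close> on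
  the factor V.\<close>

lemma perp_component_conj_sum:
  assumes "a \<in> G" "\<And>l. X l \<in> so"
  shows "perp_component G (\<Sum>l\<in>I. c l *\<^sub>R (a ** X l ** transpose a)) =
    (\<Sum>l\<in>I. c l *\<^sub>R (a ** perp_component G (X l) ** transpose a))"
proof (rule perp_component_eqI)
  show "(\<Sum>l\<in>I. c l *\<^sub>R (a ** perp_component G (X l) ** transpose a)) \<in> lie_algebra_perp G"
    by (intro subspace_sum subspace_scale subspace_perp perp_conj assms(1) perp_component_in assms(2))
  have "(\<Sum>l\<in>I. c l *\<^sub>R (a ** (X l - perp_component G (X l)) ** transpose a)) \<in> lie_algebra G"
    by (intro subspace_sum subspace_scale subspace_lie_algebra lie_algebra_conj assms(1) diff_perp_component_in assms(2))
  also have "(\<Sum>l\<in>I. c l *\<^sub>R (a ** (X l - perp_component G (X l)) ** transpose a)) =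
      (\<Sum>l\<in>I. c l *\<^sub>R (a ** X l ** transpose a)) - (\<Sum>l\<in>I. c l *\<^sub>R (a ** perp_component G (X l) ** transpose a))"
    by (simp add: bounded_bilinear.diff_right[OF bounded_bilinear_matrix_mult]
        bounded_bilinear.diff_left[OF bounded_bilinear_matrix_mult] scaleR_diff_right sum_subtractf)
  finally show "(\<Sum>l\<in>I. c l *\<^sub>R (a ** X l ** transpose a)) -
      (\<Sum>l\<in>I. c l *\<^sub>R (a ** perp_component G (X l) ** transpose a)) \<in> lie_algebra G" .
qed

text \<open>Differentiate \<open>tensor_act (\<gamma> t) T = T\<close> at \<open>t = 0\<close>, for
  a curve with velocity \<open>X\<close>. The sum over \<open>l\<close> comes from the factor V, the
  commutator from the matrix factor.\<close>

lemma infinitesimal_invariance: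
  assumes "\<And>a. a \<in> G \<Longrightarrow> tensor_act a T = T" "X \<in> lie_algebra G"
  shows "(\<Sum>l\<in>UNIV. X $ k $ l *\<^sub>R T $ l) + (X ** T $ k - T $ k ** X) = 0"
proof -
  obtain e \<gamma> where e: "e > 0" "smooth_on {-e<..<e} \<gamma>" "\<And>t. t \<in> {-e<..<e} \<Longrightarrow> \<gamma> t \<in> G" "\<gamma> 0 = mat 1"
    "(\<gamma> has_vector_derivative X) (at 0)"
    by (rule lie_algebraE[OF assms(2)]) blast
  have tX: "transpose X = - X" using assms(2) lie_algebra_subset_so by (auto simp: so_def)
  have neg: "Y ** (- X) = - (Y ** X)" for Y by (simp add: matrix_matrix_mult_def vec_eq_iff sum_negf)
  have d: "((\<lambda>t. \<gamma> t $ k $ l) has_real_derivative X $ k $ l) (at 0)" for l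
  proof -
    have "bounded_linear (\<lambda>Y :: real^'n^'n. Y $ k $ l)"
      by (intro bounded_linear_compose[OF bounded_linear_vec_nth] bounded_linear_vec_nth)
    from bounded_linear.has_vector_derivative[OF this e(5)] show ?thesis
      by (simp add: has_real_derivative_iff_has_vector_derivative)
  qed
  have "((\<lambda>t. \<Sum>l\<in>UNIV. \<gamma> t $ k $ l *\<^sub>R (\<gamma> t ** T $ l ** transpose (\<gamma> t))) has_vector_derivative
      (\<Sum>l\<in>UNIV. \<gamma> 0 $ k $ l *\<^sub>R (X ** T $ l + T $ l ** transpose X) + X $ k $ l *\<^sub>R (\<gamma> 0 ** T $ l ** transpose (\<gamma> 0)))) (at 0)"
    by (intro has_vector_derivative_sum has_vector_derivative_scaleR curve_conj d e)
  then have "((\<lambda>t. T $ k) has_vector_derivative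
      (\<Sum>l\<in>UNIV. \<gamma> 0 $ k $ l *\<^sub>R (X ** T $ l + T $ l ** transpose X) + X $ k $ l *\<^sub>R (\<gamma> 0 ** T $ l ** transpose (\<gamma> 0)))) (at 0)"
  proof (rule has_vector_derivative_transform_within_open[where S = "{-e<..<e}"])
    fix t assume t: "t \<in> {-e<..<e}"
    have "T $ k = tensor_act (\<gamma> t) T $ k" using assms(1) e(3)[OF t] by simp
    then show "(\<Sum>l\<in>UNIV. \<gamma> t $ k $ l *\<^sub>R (\<gamma> t ** T $ l ** transpose (\<gamma> t))) = T $ k"
      using matrix_inv_eq[OF e(3)[OF t]] by (simp add: tensor_act_def)
  qed (use e in auto)
  then have "(\<Sum>l\<in>UNIV. \<gamma> 0 $ k $ l *\<^sub>R (X ** T $ l + T $ l ** transpose X) + X $ k $ l *\<^sub>R (\<gamma> 0 ** T $ l ** transpose (\<gamma> 0))) = 0"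
    using vector_derivative_unique_at has_vector_derivative_const by blast
  moreover have "(\<Sum>l\<in>UNIV. \<gamma> 0 $ k $ l *\<^sub>R (X ** T $ l + T $ l ** transpose X)) = X ** T $ k - T $ k ** X"
  proof -
    have "(\<Sum>l\<in>UNIV. \<gamma> 0 $ k $ l *\<^sub>R (X ** T $ l + T $ l ** transpose X)) =
      (\<Sum>l\<in>UNIV. if l = k then X ** T $ k - T $ k ** X else 0)"
      by (rule sum.cong) (auto simp: e(4) mat_def tX neg)
    then show ?thesis by simp
  qed
  ultimately show ?thesis by (simp add: sum.distrib e(4) transpose_mat add.commute)
qed

end

section \<open>Contraction of the first Bianchi identity\<close>

text \<open>As a sum over tuples, an iterated sum allows any permutation of its indices to be
  carried out by a single bijection.\<close>

lemma sum_UNIV_prod: "(\<Sum>(x, y)\<in>UNIV. f x y) = (\<Sum>x\<in>UNIV. \<Sum>y\<in>UNIV. f x y)"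
  for f :: "'a::finite \<Rightarrow> 'b::finite \<Rightarrow> real"
  by (simp add: sum.cartesian_product)

lemma sum_UNIV_quadruple: "(\<Sum>(x, y, z, t)\<in>UNIV. f x y z t) = (\<Sum>x\<in>UNIV. \<Sum>y\<in>UNIV. \<Sum>z\<in>UNIV. \<Sum>t\<in>UNIV. f x y z t)"
  for f :: "'n::finite \<Rightarrow> 'n \<Rightarrow> 'n \<Rightarrow> 'n \<Rightarrow> real"
  unfolding sum_UNIV_prod by simp

text \<open>Here \<open>\<theta>\<close> is the derivative of the torsion \<open>\<xi>\<close>, \<open>r x y\<close> the curvature of the minimal
  connection, and the identity \<open>jac\<close> is the first Bianchi identity.
  Contracting it with \<open>\<theta> x y z t + \<theta> t x y z / 3\<close> eliminates \<open>r\<close> and gives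
  $\langle\theta, \theta\rangle = \langle\theta, \theta'\rangle$, where \<open>\<theta>'\<close> is \<open>\<theta>\<close> with the first
  two arguments swapped.\<close>

lemma bianchi_contraction:
  fixes \<theta> r :: "'n::finite \<Rightarrow> 'n \<Rightarrow> 'n \<Rightarrow> 'n \<Rightarrow> real" and \<xi> :: "'n \<Rightarrow> 'n \<Rightarrow> 'n \<Rightarrow> real"
  assumes skew\<theta>: "\<And>x y z t. \<theta> x y z t = - \<theta> x z y t" "\<And>x y z t. \<theta> x y z t = - \<theta> x y t z"
    and skew\<xi>: "\<And>x y z. \<xi> x y z = - \<xi> y x z" "\<And>x y z. \<xi> x y z = - \<xi> x z y"
    and orth: "\<And>x y v w. (\<Sum>z\<in>UNIV. \<Sum>t\<in>UNIV. r x y z t * \<theta> v w z t) = 0"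
    and skewr: "\<And>x y z t. r x y z t = - r y x z t" "\<And>x y z t. r x y z t = - r x y t z"
    and inv: "\<And>v x. (\<Sum>p\<in>UNIV. \<Sum>t\<in>UNIV. \<xi> x p t * (\<Sum>y\<in>UNIV. \<Sum>z\<in>UNIV. \<xi> p y z * \<theta> v t y z)) = 0"
    and jac: "\<And>x y z t. r x y t z + r y z t x + r z x t y
      - 2 * (\<theta> x y z t + \<theta> y z x t + \<theta> z x y t)
      + 4 * (\<Sum>p\<in>UNIV. \<xi> y z p * \<xi> x p t + \<xi> z x p * \<xi> y p t + \<xi> x y p * \<xi> z p t) = 0"
  shows "\<theta> x y z t = 0"
proof -
  let ?U = "UNIV :: ('n \<times> 'n \<times> 'n \<times> 'n) set"
  let ?U5 = "UNIV :: ('n \<times> 'n \<times> 'n \<times> 'n \<times> 'n) set"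
  \<comment> \<open>\<open>N\<close> and \<open>S\<close> are the inner products of
    \<open>\<theta>\<close> with itself and with \<open>\<theta>'\<close>. \<open>Q\<close> is the
    curvature term out of reach of \<open>orth\<close>, and every cubic term will turn out to be
    \<open>V\<close> or \<open>- V\<close>.\<close>
  define N where "N = (\<Sum>(x, y, z, t)\<in>?U. \<theta> x y z t * \<theta> x y z t)"
  define S where "S = (\<Sum>(x, y, z, t)\<in>?U. \<theta> x y z t * \<theta> y x z t)"
  define Q where "Q = (\<Sum>(x, y, z, t)\<in>?U. r y z t x * \<theta> x y z t)"
  define V where "V = (\<Sum>(x, y, z, t, p)\<in>?U5. \<xi> x p t * \<xi> p y z * \<theta> x t y z)"
  \<comment> \<open>This is \<open>inv\<close> with the direction of differentiation equal to the
    free index, both being \<open>x\<close>, summed over \<open>x\<close>.\<close>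
  have V0: "V = 0"
  proof -
    have "V = (\<Sum>(x, p, t, y, z)\<in>?U5. \<xi> x p t * \<xi> p y z * \<theta> x t y z)"
      unfolding V_def
      by (rule sum.reindex_bij_witness[of _ "\<lambda>(x, p, t, y, z). (x, y, z, t, p)" "\<lambda>(x, y, z, t, p). (x, p, t, y, z)"]) auto
    also have "\<dots> = (\<Sum>x\<in>UNIV. \<Sum>p\<in>UNIV. \<Sum>t\<in>UNIV. \<xi> x p t * (\<Sum>y\<in>UNIV. \<Sum>z\<in>UNIV. \<xi> p y z * \<theta> x t y z))"
      unfolding sum_UNIV_prod by (simp add: sum_distrib_left mult.assoc)
    also have "\<dots> = 0" by (simp add: inv)
    finally show ?thesis .
  qed
  have cub: "(\<Sum>(x, y, z, t)\<in>?U. (\<Sum>p\<in>UNIV. f x y z t p) * h x y z t) = (\<Sum>(x, y, z, t, p)\<in>?U5. f x y z t p * h x y z t)"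
    for f :: "'n \<Rightarrow> 'n \<Rightarrow> 'n \<Rightarrow> 'n \<Rightarrow> 'n \<Rightarrow> real" and h
    unfolding sum_UNIV_prod by (simp add: sum_distrib_right)
  have orth': "(\<Sum>(x, y, z, t)\<in>?U. r x y z t * \<theta> x y z t) = 0" 
    unfolding sum_UNIV_quadruple by (simp add: orth)
  have I1: "(\<Sum>(x, y, z, t)\<in>?U. (\<Sum>p\<in>UNIV. \<xi> y z p * \<xi> x p t) * \<theta> x y z t) = V"
    unfolding cub V_def
  proof (rule sum.cong, safe)
    fix x y z t p
    have "\<xi> y z p = \<xi> p y z" using skew\<xi>(2)[of y z p] skew\<xi>(1)[of y p z] by simp
    moreover have "\<theta> x y z t = \<theta> x t y z" using skew\<theta>(2)[of x y z t] skew\<theta>(1)[of x y t z] by simp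
    ultimately show "\<xi> y z p * \<xi> x p t * \<theta> x y z t = \<xi> x p t * \<xi> p y z * \<theta> x t y z" by simp
  qed
  have I2: "(\<Sum>(x, y, z, t)\<in>?U. (\<Sum>p\<in>UNIV. \<xi> z x p * \<xi> y p t) * \<theta> x y z t) = V"
    unfolding cub V_def
  proof (rule sum.reindex_bij_witness[of _ "\<lambda>(x, y, z, t, p). (x, y, t, z, p)" "\<lambda>(x, y, z, t, p). (x, y, t, z, p)"]; safe)
    fix x y z t p
    have "\<xi> z x p = \<xi> x p z" using skew\<xi>(1)[of z x p] skew\<xi>(2)[of x z p] by simp
    moreover have "\<xi> y p t = - \<xi> p y t" by (rule skew\<xi>)
    moreover have "\<theta> x y z t = - \<theta> x z y t" by (rule skew\<theta>)
    ultimately show "\<xi> x p z * \<xi> p y t * \<theta> x z y t = \<xi> z x p * \<xi> y p t * \<theta> x y z t" by simp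
  qed auto
  have I3: "(\<Sum>(x, y, z, t)\<in>?U. (\<Sum>p\<in>UNIV. \<xi> x y p * \<xi> z p t) * \<theta> x y z t) = V"
    unfolding cub V_def
  proof (rule sum.reindex_bij_witness[of _ "\<lambda>(x, z, t, y, p). (x, y, z, t, p)" "\<lambda>(x, y, z, t, p). (x, z, t, y, p)"]; safe)
    fix x y z t p
    have "\<xi> x y p = - \<xi> x p y" by (rule skew\<xi>)
    moreover have "\<xi> z p t = - \<xi> p z t" by (rule skew\<xi>)
    ultimately show "\<xi> x p y * \<xi> p z t * \<theta> x y z t = \<xi> x y p * \<xi> z p t * \<theta> x y z t" by simp
  qed auto
  have J1: "(\<Sum>(x, y, z, t)\<in>?U. (\<Sum>p\<in>UNIV. \<xi> y z p * \<xi> x p t) * \<theta> t x y z) = - V"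
    unfolding cub V_def sum_negf[symmetric]
  proof (rule sum.reindex_bij_witness[of _ "\<lambda>(t, y, z, x, p). (x, y, z, t, p)" "\<lambda>(x, y, z, t, p). (t, y, z, x, p)"]; safe)
    fix x y z t p
    have "\<xi> y z p = \<xi> p y z" using skew\<xi>(2)[of y z p] skew\<xi>(1)[of y p z] by simp
    moreover have "\<xi> x p t = - \<xi> t p x" using skew\<xi>(1)[of x p t] skew\<xi>(2)[of p x t] skew\<xi>(1)[of p t x] by simp
    ultimately show "- (\<xi> t p x * \<xi> p y z * \<theta> t x y z) = \<xi> y z p * \<xi> x p t * \<theta> t x y z" by simp
  qed auto
  \<comment> \<open>The factor \<open>\<theta> t x y z\<close> is unchanged by cyclic permutations
    of x, y, z, so each cyclic sum contracted with it consists of three equal terms.\<close>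
  have cyc\<theta>: "\<theta> t x y z = \<theta> t y z x" for x y z t
    using skew\<theta>(1)[of t x y z] skew\<theta>(2)[of t y x z] by simp
  have J2: "(\<Sum>(x, y, z, t)\<in>?U. (\<Sum>p\<in>UNIV. \<xi> z x p * \<xi> y p t) * \<theta> t x y z) = - V"
    unfolding J1[symmetric]
    by (rule sum.reindex_bij_witness[of _ "\<lambda>(y, z, x, t). (x, y, z, t)" "\<lambda>(x, y, z, t). (y, z, x, t)"])
      (auto simp flip: cyc\<theta>)
  have J3: "(\<Sum>(x, y, z, t)\<in>?U. (\<Sum>p\<in>UNIV. \<xi> x y p * \<xi> z p t) * \<theta> t x y z) = - V"
    unfolding J2[symmetric]
    by (rule sum.reindex_bij_witness[of _ "\<lambda>(y, z, x, t). (x, y, z, t)" "\<lambda>(x, y, z, t). (y, z, x, t)"])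
      (auto simp flip: cyc\<theta>)
  \<comment> \<open>Here the matrix of \<open>r x y\<close> meets the matrix of
    \<open>\<theta> x y\<close>, so \<open>orth\<close> applies. \<open>A3\<close> is the same sum
    with y and z exchanged.\<close>
  have A1: "(\<Sum>(x, y, z, t)\<in>?U. r x y t z * \<theta> x y z t) = 0"
  proof -
    have "(\<Sum>(x, y, z, t)\<in>?U. r x y t z * \<theta> x y z t) = - (\<Sum>(x, y, z, t)\<in>?U. r x y z t * \<theta> x y z t)"
      unfolding sum_negf[symmetric]
    proof (rule sum.cong, safe)
      fix x y z t
      show "r x y t z * \<theta> x y z t = - (r x y z t * \<theta> x y z t)" using skewr(2)[of x y t z] by simp
    qed
    then show ?thesis by (simp add: orth')
  qed
  have A3: "(\<Sum>(x, y, z, t)\<in>?U. r z x t y * \<theta> x y z t) = 0"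
    unfolding A1[symmetric]
  proof (rule sum.reindex_bij_witness[of _ "\<lambda>(x, y, z, t). (x, z, y, t)" "\<lambda>(x, y, z, t). (x, z, y, t)"]; safe)
    fix x y z t
    show "r x z t y * \<theta> x z y t = r z x t y * \<theta> x y z t" using skewr(1)[of z x t y] skew\<theta>(1)[of x y z t] by simp
  qed auto
  have B2: "(\<Sum>(x, y, z, t)\<in>?U. \<theta> y z x t * \<theta> x y z t) = - S"
    unfolding S_def sum_negf[symmetric]
  proof (rule sum.cong, safe)
    fix x y z t
    show "\<theta> y z x t * \<theta> x y z t = - (\<theta> x y z t * \<theta> y x z t)" using skew\<theta>(1)[of y z x t] by simp
  qed
  have B3: "(\<Sum>(x, y, z, t)\<in>?U. \<theta> z x y t * \<theta> x y z t) = - S"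
    unfolding S_def sum_negf[symmetric]
  proof (rule sum.reindex_bij_witness[of _ "\<lambda>(x, y, z, t). (x, z, y, t)" "\<lambda>(x, y, z, t). (x, z, y, t)"]; safe)
    fix x y z t
    show "- (\<theta> x z y t * \<theta> z x y t) = \<theta> z x y t * \<theta> x y z t" using skew\<theta>(1)[of x y z t] by simp
  qed auto
  \<comment> \<open>The surviving curvature term \<open>r y z t x\<close> has \<open>x\<close>, the
    direction of differentiation in \<open>\<theta>\<close>, among its matrix indices, where
    \<open>orth\<close> says nothing; it stays as \<open>Q\<close>.\<close>
  have 1: "Q - 2 * (N - 2 * S) = 0"
  proof -
    have "0 = (\<Sum>(x, y, z, t)\<in>?U. (r x y t z + r y z t x + r z x t y
      - 2 * (\<theta> x y z t + \<theta> y z x t + \<theta> z x y t)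
      + 4 * (\<Sum>p\<in>UNIV. \<xi> y z p * \<xi> x p t + \<xi> z x p * \<xi> y p t + \<xi> x y p * \<xi> z p t)) * \<theta> x y z t)"
      by (simp only: jac) simp
    also have "\<dots> = (\<Sum>(x, y, z, t)\<in>?U. r x y t z * \<theta> x y z t) + Q + (\<Sum>(x, y, z, t)\<in>?U. r z x t y * \<theta> x y z t)
      - 2 * (N + (\<Sum>(x, y, z, t)\<in>?U. \<theta> y z x t * \<theta> x y z t) + (\<Sum>(x, y, z, t)\<in>?U. \<theta> z x y t * \<theta> x y z t))
      + 4 * ((\<Sum>(x, y, z, t)\<in>?U. (\<Sum>p\<in>UNIV. \<xi> y z p * \<xi> x p t) * \<theta> x y z t)
        + (\<Sum>(x, y, z, t)\<in>?U. (\<Sum>p\<in>UNIV. \<xi> z x p * \<xi> y p t) * \<theta> x y z t)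
        + (\<Sum>(x, y, z, t)\<in>?U. (\<Sum>p\<in>UNIV. \<xi> x y p * \<xi> z p t) * \<theta> x y z t))"
      unfolding Q_def N_def sum_distrib_left sum.distrib[symmetric] sum_subtractf[symmetric]
      by (intro sum.cong refl) (auto simp: sum.distrib sum_distrib_left algebra_simps)
    finally show ?thesis unfolding I1 I2 I3 A1 A3 B2 B3 V0 by simp
  qed
  have C1: "(\<Sum>(x, y, z, t)\<in>?U. r x y t z * \<theta> t x y z) = - Q"
    unfolding Q_def sum_negf[symmetric]
  proof (rule sum.reindex_bij_witness[of _ "\<lambda>(t, x, y, z). (x, y, z, t)" "\<lambda>(x, y, z, t). (t, x, y, z)"]; safe)
    fix x y z t
    show "- (r x y z t * \<theta> t x y z) = r x y t z * \<theta> t x y z" using skewr(2)[of x y t z] by simp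
  qed auto
  have C2: "(\<Sum>(x, y, z, t)\<in>?U. r y z t x * \<theta> t x y z) = - Q"
    unfolding C1[symmetric]
    by (rule sum.reindex_bij_witness[of _ "\<lambda>(y, z, x, t). (x, y, z, t)" "\<lambda>(x, y, z, t). (y, z, x, t)"])
      (auto simp flip: cyc\<theta>)
  have C3: "(\<Sum>(x, y, z, t)\<in>?U. r z x t y * \<theta> t x y z) = - Q"
    unfolding C2[symmetric]
    by (rule sum.reindex_bij_witness[of _ "\<lambda>(y, z, x, t). (x, y, z, t)" "\<lambda>(x, y, z, t). (y, z, x, t)"])
      (auto simp flip: cyc\<theta>)
  have D1: "(\<Sum>(x, y, z, t)\<in>?U. \<theta> x y z t * \<theta> t x y z) = S"
    unfolding S_def
  proof (rule sum.reindex_bij_witness[of _ "\<lambda>(x, t, y, z). (x, y, z, t)" "\<lambda>(x, y, z, t). (x, t, y, z)"]; safe)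
    fix x y z t
    show "\<theta> x t y z * \<theta> t x y z = \<theta> x y z t * \<theta> t x y z" using cyc\<theta>[of x t y z] by simp
  qed auto
  have D2: "(\<Sum>(x, y, z, t)\<in>?U. \<theta> y z x t * \<theta> t x y z) = S"
    unfolding D1[symmetric]
    by (rule sum.reindex_bij_witness[of _ "\<lambda>(y, z, x, t). (x, y, z, t)" "\<lambda>(x, y, z, t). (y, z, x, t)"])
      (auto simp flip: cyc\<theta>)
  have D3: "(\<Sum>(x, y, z, t)\<in>?U. \<theta> z x y t * \<theta> t x y z) = S"
    unfolding D2[symmetric]
    by (rule sum.reindex_bij_witness[of _ "\<lambda>(y, z, x, t). (x, y, z, t)" "\<lambda>(x, y, z, t). (y, z, x, t)"])
      (auto simp flip: cyc\<theta>)
  \<comment> \<open>All three curvature terms now give \<open>- Q\<close>. A third of this equation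
    added to the first one cancels \<open>Q\<close> and leaves \<open>N = S\<close>.\<close>
  have 2: "- 3 * Q - 6 * S = 0"
  proof -
    have "0 = (\<Sum>(x, y, z, t)\<in>?U. (r x y t z + r y z t x + r z x t y
      - 2 * (\<theta> x y z t + \<theta> y z x t + \<theta> z x y t)
      + 4 * (\<Sum>p\<in>UNIV. \<xi> y z p * \<xi> x p t + \<xi> z x p * \<xi> y p t + \<xi> x y p * \<xi> z p t)) * \<theta> t x y z)"
      by (simp only: jac) simp
    also have "\<dots> = (\<Sum>(x, y, z, t)\<in>?U. r x y t z * \<theta> t x y z) + (\<Sum>(x, y, z, t)\<in>?U. r y z t x * \<theta> t x y z)
        + (\<Sum>(x, y, z, t)\<in>?U. r z x t y * \<theta> t x y z)
      - 2 * ((\<Sum>(x, y, z, t)\<in>?U. \<theta> x y z t * \<theta> t x y z) + (\<Sum>(x, y, z, t)\<in>?U. \<theta> y z x t * \<theta> t x y z)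
        + (\<Sum>(x, y, z, t)\<in>?U. \<theta> z x y t * \<theta> t x y z))
      + 4 * ((\<Sum>(x, y, z, t)\<in>?U. (\<Sum>p\<in>UNIV. \<xi> y z p * \<xi> x p t) * \<theta> t x y z)
        + (\<Sum>(x, y, z, t)\<in>?U. (\<Sum>p\<in>UNIV. \<xi> z x p * \<xi> y p t) * \<theta> t x y z)
        + (\<Sum>(x, y, z, t)\<in>?U. (\<Sum>p\<in>UNIV. \<xi> x y p * \<xi> z p t) * \<theta> t x y z))"
      unfolding sum_distrib_left sum.distrib[symmetric] sum_subtractf[symmetric]
      by (intro sum.cong refl) (auto simp: sum.distrib sum_distrib_left algebra_simps)
    finally show ?thesis unfolding J1 J2 J3 C1 C2 C3 D1 D2 D3 V0 by simp
  qed
  have N': "(\<Sum>(x, y, z, t)\<in>?U. \<theta> y x z t * \<theta> y x z t) = N"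
    unfolding N_def
    by (rule sum.reindex_bij_witness[of _ "\<lambda>(x, y, z, t). (y, x, z, t)" "\<lambda>(x, y, z, t). (y, x, z, t)"]) auto
  have "(\<Sum>(x, y, z, t)\<in>?U. (\<theta> x y z t - \<theta> y x z t)\<^sup>2) =
      N - 2 * S + (\<Sum>(x, y, z, t)\<in>?U. \<theta> y x z t * \<theta> y x z t)"
    unfolding N_def S_def sum_distrib_left sum.distrib[symmetric] sum_subtractf[symmetric]
    by (intro sum.cong refl) (auto simp: power2_eq_square algebra_simps)
  also have "\<dots> = 0" using 1 2 N' by simp
  finally have "\<forall>q\<in>?U. (case q of (x, y, z, t) \<Rightarrow> (\<theta> x y z t - \<theta> y x z t)\<^sup>2) = 0"
    by (subst (asm) sum_nonneg_eq_0_iff) auto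
  then have sym: "\<theta> x y z t = \<theta> y x z t" for x y z t by auto
  \<comment> \<open>Six exchanges, alternately of the first two indices and of the second and third,
    restore the order of x, y, z. Three of them change the sign, so the entry equals its own
    negative.\<close>
  show ?thesis
    using sym[of x y z t] skew\<theta>(1)[of y x z t] sym[of y z x t] skew\<theta>(1)[of z y x t] sym[of z x y t]
      skew\<theta>(1)[of x z y t] by simp
qed

section \<open>Invariant tensors, and the theorem at a single point\<close>

context orthogonal_subgroup
begin

lemma invariant_component:
  assumes "\<And>b. b \<in> G \<Longrightarrow> tensor_act b T = T" "a \<in> G"
  shows "T $ k = (\<Sum>l\<in>UNIV. a $ k $ l *\<^sub>R (a ** T $ l ** transpose a))"
proof -
  have "T $ k = tensor_act a T $ k" using assms by simp
  then show ?thesis by (simp add: tensor_act_def matrix_inv_eq[OF assms(2)])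
qed

text \<open>Contractions of invariant tensors are invariant: \<open>M\<close> is an invariant
  element of V \<otimes> V, and its contraction with \<open>T\<close> has one free index, hence lies
  in \<open>invariant_vectors G\<close>. This is how V^G = 0 enters the proof.\<close>

lemma invariant_contraction:
  assumes T: "\<And>a. a \<in> G \<Longrightarrow> tensor_act a T = T" and W: "\<And>a. a \<in> G \<Longrightarrow> tensor_act a W = W"
    and no_inv: "invariant_vectors G = {0}"
  shows "(\<Sum>p\<in>UNIV. \<Sum>t\<in>UNIV. T $ x $ p $ t * (\<Sum>y\<in>UNIV. \<Sum>z\<in>UNIV. T $ p $ y $ z * W $ t $ y $ z)) = 0"
proof -
  define M :: "real^'n^'n" where "M = (\<chi> p t. T $ p \<bullet> W $ t)"
  define v :: "real^'n" where "v = (\<chi> x. T $ x \<bullet> M)"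
  have M: "M = a ** M ** transpose a" if a: "a \<in> G" for a
  proof -
    have "M $ p $ t = (a ** M ** transpose a) $ p $ t" for p t
    proof -
      have "M $ p $ t = (\<Sum>l\<in>UNIV. a $ p $ l *\<^sub>R (a ** T $ l ** transpose a)) \<bullet>
          (\<Sum>m\<in>UNIV. a $ t $ m *\<^sub>R (a ** W $ m ** transpose a))"
        using invariant_component[OF T a, of p] invariant_component[OF W a, of t] by (simp add: M_def)
      also have "\<dots> = (\<Sum>m\<in>UNIV. \<Sum>l\<in>UNIV. a $ p $ l * a $ t $ m * (T $ l \<bullet> W $ m))"
        unfolding inner_sum_right inner_sum_left
        by (simp add: inner_conj[OF a] sum_distrib_left mult_ac)
      also have "\<dots> = (a ** M ** transpose a) $ p $ t"
        by (simp add: M_def matrix_matrix_mult_def transpose_def sum_distrib_left sum_distrib_right mult_ac)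
      finally show ?thesis .
    qed
    then show ?thesis by (simp add: vec_eq_iff)
  qed
  have "a *v v = v" if a: "a \<in> G" for a
  proof -
    have "v $ x = (a *v v) $ x" for x
    proof -
      have "v $ x = (\<Sum>l\<in>UNIV. a $ x $ l *\<^sub>R (a ** T $ l ** transpose a)) \<bullet> (a ** M ** transpose a)"
        unfolding v_def vec_lambda_beta
        by (rule arg_cong2[OF invariant_component[OF T a, of x] M[OF a], of inner])
      also have "\<dots> = (\<Sum>l\<in>UNIV. a $ x $ l * (T $ l \<bullet> M))"
        by (simp add: inner_sum_left inner_conj[OF a])
      finally show ?thesis by (simp add: v_def matrix_vector_mult_def)
    qed
    then show ?thesis by (simp add: vec_eq_iff)
  qed
  then have "v \<in> invariant_vectors G" by (simp add: invariant_vectors_def)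
  then have "v $ x = 0" using no_inv by simp
  then show ?thesis by (simp add: v_def M_def inner_matrix)
qed

lemma so_skew: "X \<in> so \<Longrightarrow> X $ i $ j = - X $ j $ i" for X :: "real^'n^'n"
proof -
  assume "X \<in> so"
  then have "transpose X $ j $ i = (- X) $ j $ i" by (simp add: so_def)
  then show ?thesis by (simp add: transpose_def)
qed

text \<open>As \<open>X\<close> is skew, right multiplication by \<open>- X\<close> is the action of
  \<open>X\<close> on the last index, so that all three indices are treated alike.\<close>

lemma infinitesimal_invariance_component:
  assumes "\<And>a. a \<in> G \<Longrightarrow> tensor_act a T = T" "X \<in> lie_algebra G"
  shows "(\<Sum>p\<in>UNIV. X $ k $ p * T $ p $ i $ j + X $ i $ p * T $ k $ p $ j + X $ j $ p * T $ k $ i $ p) = 0"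
proof -
  have "X $ p $ j = - X $ j $ p" for p using so_skew lie_algebra_subset_so assms(2) by blast
  then have "((\<Sum>l\<in>UNIV. X $ k $ l *\<^sub>R T $ l) + (X ** T $ k - T $ k ** X)) $ i $ j =
    (\<Sum>p\<in>UNIV. X $ k $ p * T $ p $ i $ j + X $ i $ p * T $ k $ p $ j + X $ j $ p * T $ k $ i $ p)"
    by (simp add: matrix_matrix_mult_def sum.distrib sum_negf mult_ac)
  then show ?thesis using infinitesimal_invariance[OF assms, of k] by simp
qed

text \<open>The components with respect to a frame of the brackets of its members, where \<open>\<Omega>\<close> is the minimal
  connection form and \<open>T\<close> the torsion. In the lemma below, \<open>d\<Omega> x\<close> and \<open>dT x\<close> are the derivatives in
  the direction of the frame vector with index \<open>x\<close>, so that \<open>jacobi\<close> is the Jacobi identity for the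
  frame.\<close>

definition structure_fun :: "('n \<Rightarrow> real^'n^'n) \<Rightarrow> real^'n^'n^'n \<Rightarrow> 'n \<Rightarrow> 'n \<Rightarrow> 'n \<Rightarrow> real" where
  "structure_fun \<Omega> T y z t = \<Omega> y $ t $ z - \<Omega> z $ t $ y - 2 * T $ y $ z $ t"

lemma torsion_derivative_eq_0:
  fixes \<Omega> :: "'n \<Rightarrow> real^'n^'n" and d\<Omega> :: "'n \<Rightarrow> 'n \<Rightarrow> real^'n^'n" and T :: "real^'n^'n^'n" and dT :: "'n \<Rightarrow> real^'n^'n^'n"
  assumes no_inv: "invariant_vectors G = {0}"
    and \<Omega>: "\<And>x. \<Omega> x \<in> lie_algebra G" and d\<Omega>: "\<And>x y. d\<Omega> x y \<in> lie_algebra G"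
    and T: "\<And>a. a \<in> G \<Longrightarrow> tensor_act a T = T" "T \<in> Lambda3"
    and dT: "\<And>a x. a \<in> G \<Longrightarrow> tensor_act a (dT x) = dT x" "\<And>x. dT x \<in> Lambda3" "\<And>x. dT x \<in> V_tensor_perp G"
    and jacobi: "\<And>x y z t.
      structure_fun (d\<Omega> x) (dT x) y z t + structure_fun (d\<Omega> y) (dT y) z x t + structure_fun (d\<Omega> z) (dT z) x y t +
      (\<Sum>p\<in>UNIV. structure_fun \<Omega> T y z p * structure_fun \<Omega> T x p t
        + structure_fun \<Omega> T z x p * structure_fun \<Omega> T y p t
        + structure_fun \<Omega> T x y p * structure_fun \<Omega> T z p t) = 0"
  shows "dT x = 0"
proof -
  \<comment> \<open>The curvature of the minimal connection on the frame vectors with indices x and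
    y. The last sum is the connection form on their bracket. Every summand lies in the Lie
    algebra.\<close>
  define R where "R x y = d\<Omega> x y - d\<Omega> y x + (\<Omega> x ** \<Omega> y - \<Omega> y ** \<Omega> x) - (\<Sum>p\<in>UNIV. structure_fun \<Omega> T x y p *\<^sub>R \<Omega> p)" for x y
  have R: "R x y \<in> lie_algebra G" for x y
    unfolding R_def
    by (intro subspace_diff subspace_add subspace_lie_algebra lie_algebra_bracket subspace_sum subspace_scale \<Omega> d\<Omega>)
  have T2: "T $ x $ y $ z = - T $ x $ z $ y" "T $ x $ y $ z = - T $ y $ x $ z" for x y z
    using T(2) unfolding Lambda3_def mem_Collect_eq by blast+
  have dT2: "dT v $ x $ y $ z = - dT v $ x $ z $ y" "dT v $ x $ y $ z = - dT v $ y $ x $ z" for v x y z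
    using dT(2)[of v] unfolding Lambda3_def mem_Collect_eq by blast+
  have \<Omega>skew: "\<Omega> x $ i $ j = - \<Omega> x $ j $ i" for x i j using \<Omega> lie_algebra_subset_so so_skew by blast
  have "dT x $ y $ z $ t = 0" for x y z t
  proof (rule bianchi_contraction[where \<theta> = "\<lambda>x y z t. dT x $ y $ z $ t" and \<xi> = "\<lambda>x y z. T $ x $ y $ z"
        and r = "\<lambda>x y z t. R x y $ z $ t"])
    show "(\<Sum>z\<in>UNIV. \<Sum>t\<in>UNIV. R x y $ z $ t * dT v $ w $ z $ t) = 0" for x y v w
    proof -
      have "dT v $ w \<bullet> R x y = 0"
        using dT(3)[of v] R[of x y] by (auto simp: V_tensor_perp_def lie_algebra_perp_def)
      then show ?thesis by (simp add: inner_matrix mult.commute)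
    qed
    show "R x y $ z $ t = - R y x $ z $ t" for x y z t
    proof -
      have "structure_fun \<Omega> T x y p = - structure_fun \<Omega> T y x p" for p
        using T2(2)[of x y p] by (simp add: structure_fun_def)
      then show ?thesis by (simp add: R_def sum_negf)
    qed
    show "R x y $ z $ t = - R x y $ t $ z" for x y z t
      using R lie_algebra_subset_so so_skew by blast
    show "(\<Sum>p\<in>UNIV. \<Sum>t\<in>UNIV. T $ x $ p $ t * (\<Sum>y\<in>UNIV. \<Sum>z\<in>UNIV. T $ p $ y $ z * dT v $ t $ y $ z)) = 0" for v x
      by (rule invariant_contraction[OF T(1) dT(1) no_inv])
    show "R x y $ t $ z + R y z $ t $ x + R z x $ t $ y
      - 2 * (dT x $ y $ z $ t + dT y $ z $ x $ t + dT z $ x $ y $ t)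
      + 4 * (\<Sum>p\<in>UNIV. T $ y $ z $ p * T $ x $ p $ t + T $ z $ x $ p * T $ y $ p $ t + T $ x $ y $ p * T $ z $ p $ t) = 0"
      for x y z t
    proof -
      \<comment> \<open>Apart from those absorbed by the curvature, the products of
        \<open>\<Omega>\<close> and \<open>T\<close> in the Jacobi identity form the infinitesimal
        action of \<open>\<Omega>\<close> on \<open>T\<close>, which is zero. For this reason no
        correction to the plain derivative \<open>dT\<close> remains.\<close>
      define I where "I x y z p = \<Omega> x $ y $ p * T $ p $ z $ t + \<Omega> x $ z $ p * T $ y $ p $ t + \<Omega> x $ t $ p * T $ y $ z $ p" for x y z p
      have I: "(\<Sum>p\<in>UNIV. I x y z p) = 0" for x y z
        unfolding I_def by (rule infinitesimal_invariance_component[OF T(1) \<Omega>])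
      define F where "F x y z p = \<Omega> x $ t $ p * \<Omega> y $ p $ z - \<Omega> y $ t $ p * \<Omega> x $ p $ z
          - structure_fun \<Omega> T x y p * \<Omega> p $ t $ z" for x y z p
      have R_eq: "R x y $ t $ z = d\<Omega> x y $ t $ z - d\<Omega> y x $ t $ z + (\<Sum>p\<in>UNIV. F x y z p)" for x y z
        by (simp add: R_def F_def matrix_matrix_mult_def sum.distrib sum_subtractf)
      have pointwise: "structure_fun \<Omega> T y z p * structure_fun \<Omega> T x p t
        + structure_fun \<Omega> T z x p * structure_fun \<Omega> T y p t
        + structure_fun \<Omega> T x y p * structure_fun \<Omega> T z p t =
        F x y z p + F y z x p + F z x y p
        + 4 * (T $ y $ z $ p * T $ x $ p $ t + T $ z $ x $ p * T $ y $ p $ t + T $ x $ y $ p * T $ z $ p $ t)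
        - 2 * (I x y z p + I y z x p + I z x y p)" for p
        using \<Omega>skew[of x y p] \<Omega>skew[of x z p] \<Omega>skew[of y x p] \<Omega>skew[of y z p] \<Omega>skew[of z x p] \<Omega>skew[of z y p]
          T2(2)[of p x t] T2(2)[of p y t] T2(2)[of p z t]
        unfolding F_def I_def structure_fun_def by algebra
      show ?thesis
        using jacobi[of x y z t] I[of x y z] I[of y z x] I[of z x y]
        unfolding pointwise R_eq
        by (simp add: structure_fun_def sum.distrib sum_subtractf flip: sum_distrib_left)
    qed
  qed (rule T2 dT2)+
  then show ?thesis by (simp add: vec_eq_iff)
qed

end

section \<open>Manifolds\<close>

lemma sum_fun_apply: "(\<Sum>i\<in>I. f i) c = (\<Sum>i\<in>I. f i c)"
  for f :: "'i \<Rightarrow> 'a \<Rightarrow> 'b::comm_monoid_add"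
proof (cases "finite I")
  case True
  then show ?thesis
  proof (induction rule: finite_induct)
    case (insert i F)
    show ?case
      unfolding sum.insert[OF insert.hyps] plus_fun_apply insert.IH ..
  qed (simp only: sum.empty zero_fun_apply)
next
  case False
  show ?thesis unfolding sum.infinite[OF False] zero_fun_apply ..
qed

lemma scaleR_fun_apply: "(r *\<^sub>R f) x = r *\<^sub>R f x" for f :: "'a \<Rightarrow> 'b::real_vector"
  by (simp add: scaleR_fun_def)

lemma smooth_on_vec:
  fixes f :: "'a::real_normed_vector \<Rightarrow> 'b::euclidean_space^'n::finite"
  assumes "open S" "\<And>i. smooth_on S (\<lambda>x. f x $ i)"
  shows "smooth_on S f"
proof -
  have "linear (\<lambda>y :: 'b. axis i y :: 'b^'n)" for i
    by (intro linearI) (simp_all add: axis_def vec_eq_iff)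
  then have "bounded_linear (\<lambda>y :: 'b. axis i y :: 'b^'n)" for i
    by (simp add: linear_conv_bounded_linear)
  then have "smooth_on S (\<lambda>x. \<Sum>i\<in>UNIV. axis i (f x $ i) :: 'b^'n)"
    by (intro smooth_on_sum smooth_on_bounded_linear[of "axis _"] assms)
  moreover have "(\<Sum>i\<in>UNIV. axis i (f x $ i)) = f x" for x
    by (simp add: vec_eq_iff axis_def if_distrib[of "\<lambda>h. h $ _"] cong: if_cong)
  ultimately show ?thesis by simp
qed

lemma smooth_on_vec_nth: "open S \<Longrightarrow> smooth_on S f \<Longrightarrow> smooth_on S (\<lambda>x. f x $ i)"
  by (rule smooth_on_bounded_linear[OF bounded_linear_vec_nth])

lemma smooth_on_mult: "open S \<Longrightarrow> smooth_on S f \<Longrightarrow> smooth_on S g \<Longrightarrow> smooth_on S (\<lambda>x. f x * g x :: real)"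
  by (rule smooth_on_bounded_bilinear[OF bounded_bilinear_mult])

locale smooth_manifold =
  fixes A :: "('m::topological_space, 'n::finite) atlas"
  assumes atlas: "smooth_atlas A"
begin

lemma chart_homeomorphism: "c \<in> A \<Longrightarrow> homeomorphism (fst c) (snd c ` fst c) (snd c) (chart_inv c)"
  using atlas by (auto simp: smooth_atlas_def)

lemma open_chart_domain: "c \<in> A \<Longrightarrow> open (fst c)"
  using atlas by (auto simp: smooth_atlas_def)

lemma chart_inv_chart [simp]: "c \<in> A \<Longrightarrow> p \<in> fst c \<Longrightarrow> chart_inv c (snd c p) = p"
  using chart_homeomorphism by (auto simp: homeomorphism_def)

lemma open_chart_image: "c \<in> A \<Longrightarrow> open U \<Longrightarrow> open (snd c ` (U \<inter> fst c))"
proof -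
  assume c: "c \<in> A" "open U"
  have "openin (top_of_set (fst c)) (U \<inter> fst c)"
    using openin_open_Int[OF c(2), of "fst c"] by (simp add: Int_commute)
  then have "openin (top_of_set (snd c ` fst c)) (snd c ` (U \<inter> fst c))"
    using homeomorphism_imp_open_map chart_homeomorphism[OF c(1)] by blast
  moreover have "open (snd c ` fst c)" using atlas c(1) by (auto simp: smooth_atlas_def)
  ultimately show ?thesis by (rule openin_open_trans)
qed

lemma chart_inv_in: "c \<in> A \<Longrightarrow> x \<in> snd c ` (U \<inter> fst c) \<Longrightarrow> chart_inv c x \<in> U \<inter> fst c"
  by auto

lemma chart_chart_inv [simp]: "c \<in> A \<Longrightarrow> x \<in> snd c ` fst c \<Longrightarrow> snd c (chart_inv c x) = x"
  by auto

lemma continuous_on_chart_inv: "c \<in> A \<Longrightarrow> continuous_on (snd c ` fst c) (chart_inv c)"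
  using chart_homeomorphism by (auto simp: homeomorphism_def)

lemma transition_chart: "c \<in> A \<Longrightarrow> p \<in> fst c \<Longrightarrow> transition c d (snd c p) = snd d p"
  by (simp add: transition_def)

lemma smooth_transition: "c \<in> A \<Longrightarrow> d \<in> A \<Longrightarrow> smooth_on (snd c ` (fst c \<inter> fst d)) (transition c d)"
  using atlas by (auto simp: smooth_atlas_def)

lemma transition_has_derivative:
  "c \<in> A \<Longrightarrow> d \<in> A \<Longrightarrow> p \<in> fst c \<Longrightarrow> p \<in> fst d \<Longrightarrow>
    (transition c d has_derivative frechet_derivative (transition c d) (at (snd c p))) (at (snd c p))"
  by (rule smooth_on_has_derivative[OF smooth_transition]) auto

lemma transition_derivative_linear:
  "c \<in> A \<Longrightarrow> d \<in> A \<Longrightarrow> p \<in> fst c \<Longrightarrow> p \<in> fst d \<Longrightarrow> linear (frechet_derivative (transition c d) (at (snd c p)))"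
  using transition_has_derivative has_derivative_linear by blast

lemma transition_derivative_chain:
  assumes "c \<in> A" "d \<in> A" "e \<in> A" "p \<in> fst c" "p \<in> fst d" "p \<in> fst e"
  shows "frechet_derivative (transition c e) (at (snd c p)) v =
    frechet_derivative (transition d e) (at (snd d p)) (frechet_derivative (transition c d) (at (snd c p)) v)"
proof -
  have "(transition d e \<circ> transition c d has_derivative
      frechet_derivative (transition d e) (at (snd d p)) \<circ> frechet_derivative (transition c d) (at (snd c p))) (at (snd c p))"
    by (rule diff_chain_at) (use assms transition_has_derivative transition_chart in auto)
  then have "(transition c e has_derivative
      frechet_derivative (transition d e) (at (snd d p)) \<circ> frechet_derivative (transition c d) (at (snd c p))) (at (snd c p))"
  proof (rule has_derivative_transform_within_open)
    show "open (snd c ` ((fst d \<inter> fst e) \<inter> fst c))"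
      by (intro open_chart_image open_Int open_chart_domain assms)
    show "snd c p \<in> snd c ` ((fst d \<inter> fst e) \<inter> fst c)" using assms by blast
    show "(transition d e \<circ> transition c d) x = transition c e x" if "x \<in> snd c ` ((fst d \<inter> fst e) \<inter> fst c)" for x
      using that assms by (auto simp: transition_chart simp del: split_paired_All)
  qed
  from frechet_derivative_at[OF this] show ?thesis by (metis o_apply)
qed

lemma transition_self_derivative:
  assumes "c \<in> A" "p \<in> fst c"
  shows "frechet_derivative (transition c c) (at (snd c p)) v = v"
proof -
  have "((\<lambda>x. x) has_derivative (\<lambda>v. v)) (at (snd c p))" by simp
  then have "(transition c c has_derivative (\<lambda>v. v)) (at (snd c p))"
  proof (rule has_derivative_transform_within_open)
    show "open (snd c ` (UNIV \<inter> fst c))" by (intro open_chart_image open_UNIV assms)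
  qed (use assms in \<open>auto simp: transition_chart\<close>)
  then show ?thesis using frechet_derivative_at by metis
qed

lemma some_chart: "some_chart A p \<in> A" "p \<in> fst (some_chart A p)"
proof -
  have "p \<in> (\<Union>c\<in>A. fst c)" using atlas by (simp add: smooth_atlas_def)
  then have "\<exists>c. c \<in> A \<and> p \<in> fst c" by blast
  from someI_ex[OF this] show "some_chart A p \<in> A" "p \<in> fst (some_chart A p)"
    by (auto simp: some_chart_def)
qed

subsection \<open>Tangent vectors\<close>

lemma tangent_0: "v \<in> tangent_space A p \<Longrightarrow> \<not> (c \<in> A \<and> p \<in> fst c) \<Longrightarrow> v c = 0"
  unfolding tangent_space_def by blast

lemma tangent_transition:
  "v \<in> tangent_space A p \<Longrightarrow> c \<in> A \<Longrightarrow> d \<in> A \<Longrightarrow> p \<in> fst c \<Longrightarrow> p \<in> fst d \<Longrightarrow>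
    v d = frechet_derivative (transition c d) (at (snd c p)) (v c)"
  unfolding tangent_space_def by blast

lemma tangent_eqI:
  assumes "v \<in> tangent_space A p" "w \<in> tangent_space A p" "c \<in> A" "p \<in> fst c" "v c = w c"
  shows "v = w"
proof
  fix d show "v d = w d"
  proof (cases "d \<in> A \<and> p \<in> fst d")
    case True
    then show ?thesis
      using tangent_transition[OF assms(1,3) _ assms(4)] tangent_transition[OF assms(2,3) _ assms(4)] assms(5)
      by simp
  next
    case False
    then show ?thesis using tangent_0[OF assms(1)] tangent_0[OF assms(2)] by simp
  qed
qed

lemma tangent_spaceI:
  assumes "\<And>c. \<not> (c \<in> A \<and> p \<in> fst c) \<Longrightarrow> v c = 0"
    "\<And>c d. c \<in> A \<Longrightarrow> d \<in> A \<Longrightarrow> p \<in> fst c \<Longrightarrow> p \<in> fst d \<Longrightarrow>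
      v d = frechet_derivative (transition c d) (at (snd c p)) (v c)"
  shows "v \<in> tangent_space A p"
  unfolding tangent_space_def using assms by blast

lemma subspace_tangent: "subspace (tangent_space A p)"
proof (rule subspaceI)
  note lin = transition_derivative_linear
  show "0 \<in> tangent_space A p"
    by (rule tangent_spaceI) (simp_all add: linear_0[OF lin])
  fix v assume v: "v \<in> tangent_space A p"
  show "v + w \<in> tangent_space A p" if w: "w \<in> tangent_space A p" for w
  proof (rule tangent_spaceI)
    fix c d assume "c \<in> A" "d \<in> A" "p \<in> fst c" "p \<in> fst d"
    note cd = this
    show "(v + w) d = frechet_derivative (transition c d) (at (snd c p)) ((v + w) c)"
      unfolding plus_fun_apply linear_add[OF lin[OF cd]] tangent_transition[OF v cd] tangent_transition[OF w cd] ..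
  qed (simp add: tangent_0[OF v] tangent_0[OF w])
  show "r *\<^sub>R v \<in> tangent_space A p" for r
  proof (rule tangent_spaceI)
    fix c d assume "c \<in> A" "d \<in> A" "p \<in> fst c" "p \<in> fst d"
    note cd = this
    show "(r *\<^sub>R v) d = frechet_derivative (transition c d) (at (snd c p)) ((r *\<^sub>R v) c)"
      unfolding scaleR_fun_apply linear_scale[OF lin[OF cd]] tangent_transition[OF v cd] ..
  qed (simp add: scaleR_fun_apply tangent_0[OF v])
qed

lemmas tangent_intros = subspace_add[OF subspace_tangent] subspace_diff[OF subspace_tangent]
  subspace_scale[OF subspace_tangent] subspace_sum[OF subspace_tangent] subspace_0[OF subspace_tangent]

text \<open>For \<open>p\<close> in the domain of \<open>c\<close>, this is the inverse of the
  coordinate isomorphism that sends a tangent vector \<open>v\<close> at \<open>p\<close> to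
  \<open>v c\<close>.\<close>

definition tangent_vec :: "('m, 'n) chart \<Rightarrow> 'm \<Rightarrow> real^'n \<Rightarrow> ('m, 'n) tvec" where
  "tangent_vec c p x = (\<lambda>d. if d \<in> A \<and> p \<in> fst c \<inter> fst d
     then frechet_derivative (transition c d) (at (snd c p)) x else 0)"

lemma tangent_vec_in: "c \<in> A \<Longrightarrow> p \<in> fst c \<Longrightarrow> tangent_vec c p x \<in> tangent_space A p"
  by (rule tangent_spaceI) (auto simp: tangent_vec_def intro: transition_derivative_chain)

lemma tangent_vec_chart: "c \<in> A \<Longrightarrow> p \<in> fst c \<Longrightarrow> tangent_vec c p x c = x"
  by (simp add: tangent_vec_def transition_self_derivative)

lemma coord_field_eq: "coord_field A c i p = tangent_vec c p (axis i 1)"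
  by (simp add: coord_field_def tangent_vec_def)

lemma coord_field_expansion:
  assumes "c \<in> A" "p \<in> fst c" "v \<in> tangent_space A p"
  shows "v = (\<Sum>i\<in>UNIV. (v c $ i) *\<^sub>R coord_field A c i p)"
proof (rule tangent_eqI[OF assms(3) _ assms(1,2)])
  show "(\<Sum>i\<in>UNIV. (v c $ i) *\<^sub>R coord_field A c i p) \<in> tangent_space A p"
    unfolding coord_field_eq by (intro tangent_intros tangent_vec_in assms)
  show "v c = (\<Sum>i\<in>UNIV. (v c $ i) *\<^sub>R coord_field A c i p) c"
    unfolding coord_field_eq sum_fun_apply scaleR_fun_apply tangent_vec_chart[OF assms(1,2)]
    by (simp only: basis_expansion flip: scalar_mult_eq_scaleR)
qed

subsection \<open>Smooth functions and fields\<close>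

lemma smooth_funI:
  "(\<And>c. c \<in> A \<Longrightarrow> smooth_on (snd c ` (U \<inter> fst c)) (\<lambda>x. f (chart_inv c x))) \<Longrightarrow> smooth_fun A U f"
  by (simp add: smooth_fun_def o_def)

lemma smooth_funD:
  "smooth_fun A U f \<Longrightarrow> c \<in> A \<Longrightarrow> smooth_on (snd c ` (U \<inter> fst c)) (\<lambda>x. f (chart_inv c x))"
  by (simp add: smooth_fun_def o_def)

lemma smooth_fun_subset: "smooth_fun A U f \<Longrightarrow> V \<subseteq> U \<Longrightarrow> smooth_fun A V f"
  by (rule smooth_funI, rule smooth_on_subset[OF smooth_funD]) auto

lemma smooth_fun_const: "open U \<Longrightarrow> smooth_fun A U (\<lambda>p. k)"
  by (intro smooth_funI) (simp add: open_chart_image)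

lemma smooth_fun_mult:
  "open U \<Longrightarrow> smooth_fun A U f \<Longrightarrow> smooth_fun A U h \<Longrightarrow> smooth_fun A U (\<lambda>p. f p * h p :: real)"
  by (rule smooth_funI, rule smooth_on_mult[OF open_chart_image]) (simp_all add: smooth_funD)

lemma smooth_fun_sum:
  "open U \<Longrightarrow> (\<And>i. i \<in> I \<Longrightarrow> smooth_fun A U (f i)) \<Longrightarrow> smooth_fun A U (\<lambda>p. \<Sum>i\<in>I. f i p)"
  by (rule smooth_funI, rule smooth_on_sum[OF open_chart_image]) (simp_all add: smooth_funD)

lemma smooth_fun_cong:
  assumes "open U" "\<And>p. p \<in> U \<Longrightarrow> f p = h p" "smooth_fun A U f"
  shows "smooth_fun A U h"
proof (rule smooth_funI)
  fix c assume c: "c \<in> A"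
  show "smooth_on (snd c ` (U \<inter> fst c)) (\<lambda>x. h (chart_inv c x))"
  proof (rule smooth_on_cong[THEN iffD1])
    show "smooth_on (snd c ` (U \<inter> fst c)) (\<lambda>x. f (chart_inv c x))" by (rule smooth_funD[OF assms(3) c])
    show "f (chart_inv c x) = h (chart_inv c x)" if "x \<in> snd c ` (U \<inter> fst c)" for x
      using assms(2) chart_inv_in[OF c that] by simp
  qed (rule open_chart_image[OF c assms(1)])
qed

lemma smooth_fieldI:
  "(\<And>p. p \<in> U \<Longrightarrow> X p \<in> tangent_space A p) \<Longrightarrow>
    (\<And>c. c \<in> A \<Longrightarrow> smooth_on (snd c ` (U \<inter> fst c)) (\<lambda>x. X (chart_inv c x) c)) \<Longrightarrow> smooth_field A U X"
  by (simp add: smooth_field_def)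

lemma smooth_fieldD:
  "smooth_field A U X \<Longrightarrow> p \<in> U \<Longrightarrow> X p \<in> tangent_space A p"
  "smooth_field A U X \<Longrightarrow> c \<in> A \<Longrightarrow> smooth_on (snd c ` (U \<inter> fst c)) (\<lambda>x. X (chart_inv c x) c)"
  by (simp_all add: smooth_field_def)

lemma smooth_field_subset: "smooth_field A U X \<Longrightarrow> V \<subseteq> U \<Longrightarrow> smooth_field A V X"
  by (rule smooth_fieldI, use smooth_fieldD(1) in blast, rule smooth_on_subset[OF smooth_fieldD(2)]) auto

lemma smooth_field_cong:
  assumes "open U" "\<And>p. p \<in> U \<Longrightarrow> X p = Y p" "smooth_field A U X"
  shows "smooth_field A U Y"
proof (rule smooth_fieldI)
  fix c assume c: "c \<in> A"
  show "smooth_on (snd c ` (U \<inter> fst c)) (\<lambda>x. Y (chart_inv c x) c)"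
  proof (rule smooth_on_cong[THEN iffD1])
    show "smooth_on (snd c ` (U \<inter> fst c)) (\<lambda>x. X (chart_inv c x) c)" by (rule smooth_fieldD(2)[OF assms(3) c])
    show "X (chart_inv c x) c = Y (chart_inv c x) c" if "x \<in> snd c ` (U \<inter> fst c)" for x
      using assms(2) chart_inv_in[OF c that] by simp
  qed (rule open_chart_image[OF c assms(1)])
next
  show "Y p \<in> tangent_space A p" if "p \<in> U" for p
    using smooth_fieldD(1)[OF assms(3) that] assms(2)[OF that] by simp
qed

lemma smooth_field_sum:
  assumes "open U" "\<And>i. i \<in> I \<Longrightarrow> smooth_fun A U (f i :: _ \<Rightarrow> real)" "\<And>i. i \<in> I \<Longrightarrow> smooth_field A U (X i)"
  shows "smooth_field A U (\<lambda>p. \<Sum>i\<in>I. f i p *\<^sub>R X i p)"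
proof (rule smooth_fieldI)
  show "(\<Sum>i\<in>I. f i p *\<^sub>R X i p) \<in> tangent_space A p" if "p \<in> U" for p
    by (intro tangent_intros smooth_fieldD(1)[OF assms(3) that])
  show "smooth_on (snd c ` (U \<inter> fst c)) (\<lambda>x. (\<Sum>i\<in>I. f i (chart_inv c x) *\<^sub>R X i (chart_inv c x)) c)"
    if c: "c \<in> A" for c
    unfolding sum_fun_apply scaleR_fun_apply
    by (rule smooth_on_sum[OF open_chart_image[OF c assms(1)]], rule smooth_on_scaleR[OF open_chart_image[OF c assms(1)]])
      (simp_all add: smooth_funD[OF assms(2) c] smooth_fieldD(2)[OF assms(3) c])
qed

lemma smooth_near_fun: "open U \<Longrightarrow> p \<in> U \<Longrightarrow> smooth_fun A U f \<Longrightarrow> smooth_fun_near A p f"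
  unfolding smooth_fun_near_def by blast

lemma smooth_near_field: "open U \<Longrightarrow> p \<in> U \<Longrightarrow> smooth_field A U X \<Longrightarrow> smooth_field_near A p X"
  unfolding smooth_field_near_def by blast

lemma smooth_coord_field:
  assumes "c \<in> A"
  shows "smooth_field A (fst c) (coord_field A c i)"
proof (rule smooth_fieldI)
  show "coord_field A c i p \<in> tangent_space A p" if "p \<in> fst c" for p
    unfolding coord_field_eq by (rule tangent_vec_in[OF assms that])
  fix d assume d: "d \<in> A"
  let ?S = "snd d ` (fst c \<inter> fst d)"
  have S: "open ?S" by (rule open_chart_image[OF d open_chart_domain[OF assms]])
  have "smooth_on ?S (\<lambda>x. frechet_derivative (transition c d) (at (transition d c x)) (axis i 1))"
  proof (rule smooth_on_compose[OF S _ smooth_on_derivative[OF smooth_transition[OF assms d]]])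
    show "transition d c ` ?S \<subseteq> snd c ` (fst c \<inter> fst d)" using d by (auto simp: transition_chart)
    show "smooth_on ?S (transition d c)"
      using smooth_transition[OF d assms] by (simp add: Int_commute)
  qed
  then show "smooth_on ?S (\<lambda>x. coord_field A c i (chart_inv d x) d)"
    by (rule smooth_on_cong[OF S, THEN iffD1, rotated]) (use d in \<open>auto simp: coord_field_def transition_chart\<close>)
qed

lemma dir_deriv_eq:
  assumes "((\<lambda>x. f (chart_inv (some_chart A p) x)) has_derivative F) (at (snd (some_chart A p) p))"
  shows "dir_deriv A p v f = F (v (some_chart A p))"
  unfolding dir_deriv_def Let_def o_def using frechet_derivative_at[OF assms] by simp

lemma dir_deriv_has_derivative:
  assumes "open U" "p \<in> U" "smooth_fun A U f"
  shows "((\<lambda>x. f (chart_inv (some_chart A p) x)) has_derivative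
      frechet_derivative (\<lambda>x. f (chart_inv (some_chart A p) x)) (at (snd (some_chart A p) p))) (at (snd (some_chart A p) p))"
    "dir_deriv A p v f = frechet_derivative (\<lambda>x. f (chart_inv (some_chart A p) x)) (at (snd (some_chart A p) p)) (v (some_chart A p))"
proof -
  show 1: "((\<lambda>x. f (chart_inv (some_chart A p) x)) has_derivative
      frechet_derivative (\<lambda>x. f (chart_inv (some_chart A p) x)) (at (snd (some_chart A p) p))) (at (snd (some_chart A p) p))"
    by (rule smooth_on_has_derivative[OF smooth_funD[OF assms(3) some_chart(1)]]) (use assms some_chart in auto)
  show "dir_deriv A p v f = frechet_derivative (\<lambda>x. f (chart_inv (some_chart A p) x)) (at (snd (some_chart A p) p)) (v (some_chart A p))"
    by (rule dir_deriv_eq[OF 1])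
qed

lemma dir_deriv_cong:
  assumes "open U" "p \<in> U" "\<And>q. q \<in> U \<Longrightarrow> f q = h q" "smooth_fun A U f"
  shows "dir_deriv A p v f = dir_deriv A p v h"
proof -
  let ?c = "some_chart A p"
  have "((\<lambda>x. h (chart_inv ?c x)) has_derivative
      frechet_derivative (\<lambda>x. f (chart_inv ?c x)) (at (snd ?c p))) (at (snd ?c p))"
    by (rule has_derivative_transform_within_open[OF dir_deriv_has_derivative(1)[OF assms(1,2,4)]
          open_chart_image[OF some_chart(1) assms(1)]])
      (use assms some_chart in auto)
  from dir_deriv_eq[OF this] show ?thesis using dir_deriv_has_derivative(2)[OF assms(1,2,4)] by metis
qed

lemma dir_deriv_const: "dir_deriv A p v (\<lambda>q. k) = 0"
  by (subst dir_deriv_eq[where F = "\<lambda>_. 0"]) auto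

lemma dir_deriv_mult:
  assumes "open U" "p \<in> U" "smooth_fun A U f" "smooth_fun A U h"
  shows "dir_deriv A p v (\<lambda>q. f q * h q :: real) = dir_deriv A p v f * h p + f p * dir_deriv A p v h"
  using dir_deriv_eq[OF has_derivative_mult[OF dir_deriv_has_derivative(1)[OF assms(1,2,3)] dir_deriv_has_derivative(1)[OF assms(1,2,4)]], of v]
    dir_deriv_has_derivative(2)[OF assms(1,2,3), of v] dir_deriv_has_derivative(2)[OF assms(1,2,4), of v] some_chart
  by simp

lemma dir_deriv_sum:
  assumes "open U" "p \<in> U" "\<And>i. i \<in> I \<Longrightarrow> smooth_fun A U (f i)"
  shows "dir_deriv A p v (\<lambda>q. \<Sum>i\<in>I. f i q) = (\<Sum>i\<in>I. dir_deriv A p v (f i))"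
proof -
  have "dir_deriv A p v (\<lambda>q. \<Sum>i\<in>I. f i q) =
      (\<Sum>i\<in>I. frechet_derivative (\<lambda>x. f i (chart_inv (some_chart A p) x)) (at (snd (some_chart A p) p)) (v (some_chart A p)))"
    by (rule dir_deriv_eq[OF has_derivative_sum]) (rule dir_deriv_has_derivative(1)[OF assms])
  also have "\<dots> = (\<Sum>i\<in>I. dir_deriv A p v (f i))"
    by (intro sum.cong refl dir_deriv_has_derivative(2)[OF assms, symmetric])
  finally show ?thesis .
qed

end

section \<open>Connections and orthonormal frames\<close>

text \<open>Tangent vectors are functions, whose sums should not be evaluated pointwise.\<close>

declare plus_fun_apply [simp del] zero_fun_apply [simp del] minus_apply [simp del]

context smooth_manifold
begin

lemma
  assumes "linear_connection A D" "smooth_field_near A p Y" "v \<in> tangent_space A p"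
  shows conn_in: "D p v Y \<in> tangent_space A p"
    and conn_add_dir: "w \<in> tangent_space A p \<Longrightarrow> D p (a *\<^sub>R v + b *\<^sub>R w) Y = a *\<^sub>R D p v Y + b *\<^sub>R D p w Y"
    and conn_add: "smooth_field_near A p Z \<Longrightarrow> D p v (\<lambda>q. Y q + Z q) = D p v Y + D p v Z"
    and conn_scale: "smooth_fun_near A p (f :: 'm \<Rightarrow> real) \<Longrightarrow>
      D p v (\<lambda>q. f q *\<^sub>R Y q) = dir_deriv A p v f *\<^sub>R Y p + f p *\<^sub>R D p v Y"
    and conn_local: "open U \<Longrightarrow> p \<in> U \<Longrightarrow> (\<And>q. q \<in> U \<Longrightarrow> Z q = Y q) \<Longrightarrow> D p v Z = D p v Y"
proof -
  note D = conjunct1[OF assms(1)[unfolded linear_connection_def], THEN spec, THEN spec, THEN mp, OF assms(2)]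
  show "D p v Y \<in> tangent_space A p" by (rule D[THEN conjunct1, THEN bspec, OF assms(3)])
  show "w \<in> tangent_space A p \<Longrightarrow> D p (a *\<^sub>R v + b *\<^sub>R w) Y = a *\<^sub>R D p v Y + b *\<^sub>R D p w Y"
    by (rule D[THEN conjunct2, THEN conjunct1, THEN bspec, OF assms(3), THEN bspec, THEN spec, THEN spec])
  show "smooth_field_near A p Z \<Longrightarrow> D p v (\<lambda>q. Y q + Z q) = D p v Y + D p v Z"
    by (rule D[THEN conjunct2, THEN conjunct2, THEN conjunct1, THEN bspec, OF assms(3), THEN spec, THEN mp])
  show "smooth_fun_near A p f \<Longrightarrow> D p v (\<lambda>q. f q *\<^sub>R Y q) = dir_deriv A p v f *\<^sub>R Y p + f p *\<^sub>R D p v Y"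
    by (rule D[THEN conjunct2, THEN conjunct2, THEN conjunct2, THEN conjunct1, THEN bspec, OF assms(3), THEN spec, THEN mp])
  show "open U \<Longrightarrow> p \<in> U \<Longrightarrow> (\<And>q. q \<in> U \<Longrightarrow> Z q = Y q) \<Longrightarrow> D p v Z = D p v Y"
    by (rule D[THEN conjunct2, THEN conjunct2, THEN conjunct2, THEN conjunct2, THEN bspec, OF assms(3), THEN spec, THEN spec, THEN mp])
      blast
qed

lemma conn_smooth:
  "linear_connection A D \<Longrightarrow> open U \<Longrightarrow> smooth_field A U X \<Longrightarrow> smooth_field A U Y \<Longrightarrow>
    smooth_field A U (\<lambda>p. D p (X p) Y)"
  unfolding linear_connection_def by (drule conjunct2) simp

lemma conn_sum_dir:
  assumes "linear_connection A D" "smooth_field_near A p Y" "\<And>i. i \<in> I \<Longrightarrow> v i \<in> tangent_space A p"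
  shows "D p (\<Sum>i\<in>I. a i *\<^sub>R v i) Y = (\<Sum>i\<in>I. a i *\<^sub>R D p (v i) Y)"
proof -
  have zero: "D p 0 Y = 0"
    using conn_add_dir[OF assms(1,2) tangent_intros(5) tangent_intros(5), of 0 0] by simp
  show ?thesis using assms(3)
  proof (induction I rule: infinite_finite_induct)
    case (insert i I)
    have "D p (a i *\<^sub>R v i + 1 *\<^sub>R (\<Sum>i\<in>I. a i *\<^sub>R v i)) Y = a i *\<^sub>R D p (v i) Y + 1 *\<^sub>R D p (\<Sum>i\<in>I. a i *\<^sub>R v i) Y"
      by (rule conn_add_dir[OF assms(1,2)]) (use insert.prems in \<open>auto intro: tangent_intros\<close>)
    then show ?case using insert by simp
  qed (simp_all only: sum.empty sum.infinite zero not_False_eq_True)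
qed

lemma conn_sum:
  assumes D: "linear_connection A D" and U: "open U" "p \<in> U" and v: "v \<in> tangent_space A p"
    and "\<And>i. i \<in> I \<Longrightarrow> smooth_fun A U (f i :: 'm \<Rightarrow> real)" "\<And>i. i \<in> I \<Longrightarrow> smooth_field A U (X i)"
  shows "D p v (\<lambda>q. \<Sum>i\<in>I. f i q *\<^sub>R X i q) = (\<Sum>i\<in>I. dir_deriv A p v (f i) *\<^sub>R X i p + f i p *\<^sub>R D p v (X i))"
proof -
  have near: "smooth_field_near A p (\<lambda>q. \<Sum>i\<in>J. f i q *\<^sub>R X i q)" if "J \<subseteq> I" for J
    by (rule smooth_near_field[OF U smooth_field_sum[OF U(1)]]) (use assms that in auto)
  have zero: "D p v (\<lambda>q. 0) = 0"
    using conn_add[OF D near[of "{}"] v near[of "{}"]] by simp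
  show ?thesis
    using assms(5,6) near
  proof (induction I rule: infinite_finite_induct)
    case (insert i I)
    have Xi: "smooth_field_near A p (X i)" and fi: "smooth_fun_near A p (f i)"
      using smooth_near_field[OF U] smooth_near_fun[OF U] insert.prems(1,2) by blast+
    have 1: "smooth_field_near A p (\<lambda>q. f i q *\<^sub>R X i q)" using insert.prems(3)[of "{i}"] by simp
    have 2: "smooth_field_near A p (\<lambda>q. \<Sum>i\<in>I. f i q *\<^sub>R X i q)" using insert.prems(3)[of I] by blast
    have "D p v (\<lambda>q. f i q *\<^sub>R X i q + (\<Sum>i\<in>I. f i q *\<^sub>R X i q)) =
        (dir_deriv A p v (f i) *\<^sub>R X i p + f i p *\<^sub>R D p v (X i)) + D p v (\<lambda>q. \<Sum>i\<in>I. f i q *\<^sub>R X i q)"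
      by (simp only: conn_add[OF D 1 v 2] conn_scale[OF D Xi v fi])
    moreover have "D p v (\<lambda>q. \<Sum>i\<in>I. f i q *\<^sub>R X i q) = (\<Sum>i\<in>I. dir_deriv A p v (f i) *\<^sub>R X i p + f i p *\<^sub>R D p v (X i))"
      using insert.IH insert.prems by blast
    ultimately show ?case using insert.hyps by simp
  qed (simp_all only: sum.empty sum.infinite zero not_False_eq_True)
qed

end

section \<open>Riemannian metrics, orthonormal frames and reductions\<close>

locale riemannian_manifold = smooth_manifold A
  for A :: "('m::topological_space, 'n::finite) atlas" +
  fixes g :: "'m \<Rightarrow> ('m, 'n) tvec \<Rightarrow> ('m, 'n) tvec \<Rightarrow> real"
  assumes metric: "riemannian_metric A g"
begin

lemma g_linear:
  "u \<in> tangent_space A p \<Longrightarrow> v \<in> tangent_space A p \<Longrightarrow> w \<in> tangent_space A p \<Longrightarrow>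
    g p (a *\<^sub>R u + b *\<^sub>R v) w = a * g p u w + b * g p v w"
  by (rule metric[unfolded riemannian_metric_def, THEN conjunct1, THEN spec, THEN bspec, THEN bspec,
        THEN bspec, THEN spec, THEN spec])

lemma g_sym: "v \<in> tangent_space A p \<Longrightarrow> w \<in> tangent_space A p \<Longrightarrow> g p v w = g p w v"
  by (rule metric[unfolded riemannian_metric_def, THEN conjunct2, THEN conjunct1, THEN spec, THEN bspec, THEN bspec])

lemma g_smooth: "open U \<Longrightarrow> smooth_field A U X \<Longrightarrow> smooth_field A U Y \<Longrightarrow> smooth_fun A U (\<lambda>p. g p (X p) (Y p))"
  by (rule metric[unfolded riemannian_metric_def, THEN conjunct2, THEN conjunct2, THEN conjunct2, THEN spec,
        THEN spec, THEN spec, THEN mp]) (intro conjI)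

lemma g_add: "u \<in> tangent_space A p \<Longrightarrow> v \<in> tangent_space A p \<Longrightarrow> w \<in> tangent_space A p \<Longrightarrow>
    g p (u + v) w = g p u w + g p v w"
  using g_linear[of u p v w 1 1] by simp

lemma g_diff: "u \<in> tangent_space A p \<Longrightarrow> v \<in> tangent_space A p \<Longrightarrow> w \<in> tangent_space A p \<Longrightarrow>
    g p (u - v) w = g p u w - g p v w"
  using g_linear[of u p v w 1 "- 1"] by simp

lemma g_zero: "w \<in> tangent_space A p \<Longrightarrow> g p 0 w = 0"
  using g_linear[of 0 p 0 w 0 0] tangent_intros(5) by simp

lemma g_sum:
  assumes "\<And>i. i \<in> I \<Longrightarrow> v i \<in> tangent_space A p" "w \<in> tangent_space A p"
  shows "g p (\<Sum>i\<in>I. a i *\<^sub>R v i) w = (\<Sum>i\<in>I. a i * g p (v i) w)"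
  using assms(1)
proof (induction I rule: infinite_finite_induct)
  case (insert i I)
  have "g p (a i *\<^sub>R v i + 1 *\<^sub>R (\<Sum>i\<in>I. a i *\<^sub>R v i)) w = a i * g p (v i) w + 1 * g p (\<Sum>i\<in>I. a i *\<^sub>R v i) w"
    by (intro g_linear tangent_intros insert.prems insertI1 insertI2 assms(2))
  then show ?case using insert by simp
qed (simp_all only: sum.empty sum.infinite g_zero[OF assms(2)] not_False_eq_True)

lemma g_sum_right:
  assumes "\<And>i. i \<in> I \<Longrightarrow> v i \<in> tangent_space A p" "w \<in> tangent_space A p"
  shows "g p w (\<Sum>i\<in>I. a i *\<^sub>R v i) = (\<Sum>i\<in>I. a i * g p w (v i))"
proof -
  have "g p w (\<Sum>i\<in>I. a i *\<^sub>R v i) = g p (\<Sum>i\<in>I. a i *\<^sub>R v i) w"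
    by (intro g_sym assms tangent_intros)
  also have "\<dots> = (\<Sum>i\<in>I. a i * g p (v i) w)" by (rule g_sum[OF assms])
  also have "\<dots> = (\<Sum>i\<in>I. a i * g p w (v i))"
    by (rule sum.cong) (simp_all add: g_sym assms)
  finally show ?thesis .
qed

lemma frame_in: "orthonormal_frame A g p u \<Longrightarrow> u i \<in> tangent_space A p"
  and frame_orthonormal: "orthonormal_frame A g p u \<Longrightarrow> g p (u i) (u j) = (if i = j then 1 else 0)"
  by (simp_all add: orthonormal_frame_def)

lemma frame_coeff:
  assumes "orthonormal_frame A g p u"
  shows "g p (\<Sum>i\<in>UNIV. x i *\<^sub>R u i) (u j) = x j"
  using frame_in[OF assms] frame_orthonormal[OF assms] by (simp add: g_sum if_distrib[of "(*) _"] cong: if_cong)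

text \<open>In a chart, the frame defines a linear map from \<open>real^'n\<close> to itself.
  Orthonormality makes it injective, hence surjective, so the frame spans the tangent space.\<close>

lemma frame_expansion:
  assumes u: "orthonormal_frame A g p u" and v: "v \<in> tangent_space A p"
  shows "v = (\<Sum>i\<in>UNIV. g p v (u i) *\<^sub>R u i)"
proof -
  obtain c where c: "c \<in> A" "p \<in> fst c" using some_chart by blast
  have in_T: "(\<Sum>i\<in>UNIV. x i *\<^sub>R u i) \<in> tangent_space A p" for x
    by (intro tangent_intros frame_in u)
  define L :: "real^'n \<Rightarrow> real^'n" where "L x = (\<Sum>i\<in>UNIV. x $ i *\<^sub>R u i c)" for x
  have L: "(\<Sum>i\<in>UNIV. x $ i *\<^sub>R u i) c = L x" for x
    unfolding L_def sum_fun_apply scaleR_fun_apply ..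
  have lin: "linear L"
    unfolding L_def by (intro linearI) (simp_all add: scaleR_left_distrib sum.distrib scaleR_sum_right)
  have "inj L"
    unfolding linear_injective_0[OF lin]
  proof (intro allI impI)
    fix x assume "L x = 0"
    then have "(\<Sum>i\<in>UNIV. x $ i *\<^sub>R u i) = 0"
      by (intro tangent_eqI[OF in_T tangent_intros(5) c]) (simp only: L zero_fun_apply)
    then have "x $ j = 0" for j
      using frame_coeff[OF u, of "\<lambda>i. x $ i" j] g_zero[OF frame_in[OF u]] by simp
    then show "x = 0" by (simp add: vec_eq_iff)
  qed
  then have "surj L" using linear_injective_imp_surjective[OF lin] by blast
  then obtain x where "v c = L x" by (metis surjD)
  then have "v = (\<Sum>i\<in>UNIV. x $ i *\<^sub>R u i)"
    by (intro tangent_eqI[OF v in_T c]) (simp only: L)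
  moreover from this have "g p v (u j) = x $ j" for j using frame_coeff[OF u] by simp
  ultimately show ?thesis by simp
qed

lemma frame_eqI:
  assumes u: "orthonormal_frame A g p u" and "v \<in> tangent_space A p" "w \<in> tangent_space A p"
    and "\<And>i. g p v (u i) = g p w (u i)"
  shows "v = w"
proof -
  have "v = (\<Sum>i\<in>UNIV. g p v (u i) *\<^sub>R u i)" by (rule frame_expansion[OF u assms(2)])
  also have "\<dots> = (\<Sum>i\<in>UNIV. g p w (u i) *\<^sub>R u i)" by (simp only: assms(4))
  also have "\<dots> = w" by (rule frame_expansion[OF u assms(3), symmetric])
  finally show ?thesis .
qed

end

locale G_structure = riemannian_manifold A g
  for A :: "('m::topological_space, 'n::finite) atlas" and g +
  fixes G :: "(real^'n^'n) set" and P :: "'m \<Rightarrow> ('m, 'n) frame set"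
  assumes lie_subgroup: "lie_subgroup_On G" and reduction: "reduction A g G P"
begin

sublocale orthogonal_subgroup G
proof -
  have "(\<forall>a\<in>G. orthogonal_matrix a) \<and> mat 1 \<in> G \<and> (\<forall>a\<in>G. \<forall>b\<in>G. a ** b \<in> G) \<and> (\<forall>a\<in>G. matrix_inv a \<in> G)"
    using lie_subgroup unfolding lie_subgroup_On_def by (elim conjE) (intro conjI)
  then show "orthogonal_subgroup G" by unfold_locales blast+
qed

lemma P_orthonormal: "u \<in> P p \<Longrightarrow> orthonormal_frame A g p u"
  and P_orbit: "u \<in> P p \<Longrightarrow> P p = frame_act u ` G"
  and P_section: "\<exists>U s. open U \<and> p \<in> U \<and> (\<forall>q\<in>U. s q \<in> P q) \<and> (\<forall>i. smooth_field A U (\<lambda>q. s q i))"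
proof -
  note red = reduction[unfolded reduction_def]
  show "u \<in> P p \<Longrightarrow> orthonormal_frame A g p u" and "u \<in> P p \<Longrightarrow> P p = frame_act u ` G"
    using conjunct1[OF red, THEN spec, of p] by (simp_all only: Ball_def)
  show "\<exists>U s. open U \<and> p \<in> U \<and> (\<forall>q\<in>U. s q \<in> P q) \<and> (\<forall>i. smooth_field A U (\<lambda>q. s q i))"
    using conjunct2[OF red] by (rule spec)
qed

end

section \<open>Connection forms in a local section of the reduction\<close>

locale local_frame = G_structure A g G P
  for A :: "('m::topological_space, 'n::finite) atlas" and g G P +
  fixes U :: "'m set" and s :: "'m \<Rightarrow> ('m, 'n) frame"
  assumes open_U: "open U" and s_in: "q \<in> U \<Longrightarrow> s q \<in> P q"
    and s_smooth: "smooth_field A U (\<lambda>q. s q i)"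
begin

lemma s_orthonormal: "q \<in> U \<Longrightarrow> orthonormal_frame A g q (s q)"
  by (rule P_orthonormal[OF s_in])

lemma s_tangent: "q \<in> U \<Longrightarrow> s q i \<in> tangent_space A q"
  by (rule frame_in[OF s_orthonormal])

lemma s_near: "q \<in> U \<Longrightarrow> smooth_field_near A q (\<lambda>q. s q i)"
  by (rule smooth_near_field[OF open_U _ s_smooth])

text \<open>The matrix-valued connection form, pulled back along the section
  \<open>s\<close>.\<close>

definition conn_form :: "('m, 'n) conn \<Rightarrow> 'm \<Rightarrow> ('m, 'n) tvec \<Rightarrow> real^'n^'n" where
  "conn_form D q v = (\<chi> i j. g q (D q v (\<lambda>q. s q j)) (s q i))"

lemma conn_form_expansion:
  assumes "linear_connection A D" "q \<in> U" "v \<in> tangent_space A q"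
  shows "D q v (\<lambda>q. s q j) = (\<Sum>i\<in>UNIV. conn_form D q v $ i $ j *\<^sub>R s q i)"
  unfolding conn_form_def vec_lambda_beta
  by (rule frame_expansion[OF s_orthonormal[OF assms(2)] conn_in[OF assms(1) s_near[OF assms(2)] assms(3)]])

lemma conn_form_smooth:
  assumes "linear_connection A D"
  shows "smooth_fun A U (\<lambda>q. conn_form D q (s q k))"
proof (rule smooth_funI)
  fix c assume c: "c \<in> A"
  have "smooth_fun A U (\<lambda>q. g q (D q (s q k) (\<lambda>q. s q j)) (s q i))" for i j
    by (rule g_smooth[OF open_U conn_smooth[OF assms open_U s_smooth s_smooth] s_smooth])
  then have "smooth_on (snd c ` (U \<inter> fst c)) (\<lambda>x. conn_form D (chart_inv c x) (s (chart_inv c x) k) $ i $ j)" for i j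
    unfolding conn_form_def vec_lambda_beta by (rule smooth_funD[OF _ c])
  then show "smooth_on (snd c ` (U \<inter> fst c)) (\<lambda>x. conn_form D (chart_inv c x) (s (chart_inv c x) k))"
    by (rule smooth_on_vec[OF open_chart_image[OF c open_U] smooth_on_vec[OF open_chart_image[OF c open_U]]])
qed

lemma conn_form_linear:
  assumes "linear_connection A D" "q \<in> U" "v \<in> tangent_space A q"
  shows "conn_form D q v = (\<Sum>k\<in>UNIV. g q v (s q k) *\<^sub>R conn_form D q (s q k))"
proof -
  have "D q v (\<lambda>q. s q j) = (\<Sum>k\<in>UNIV. g q v (s q k) *\<^sub>R D q (s q k) (\<lambda>q. s q j))" for j
    using conn_sum_dir[OF assms(1) s_near[OF assms(2)], of UNIV "s q" "\<lambda>k. g q v (s q k)"] s_tangent[OF assms(2)]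
      frame_expansion[OF s_orthonormal[OF assms(2)] assms(3)] by simp
  then have "conn_form D q v $ i $ j = (\<Sum>k\<in>UNIV. g q v (s q k) * conn_form D q (s q k) $ i $ j)" for i j
    unfolding conn_form_def vec_lambda_beta
    by (simp add: g_sum conn_in[OF assms(1) s_near[OF assms(2)]] s_tangent[OF assms(2)])
  then show ?thesis by (simp add: vec_eq_iff)
qed

text \<open>Differentiate the constant functions \<open>g q (s q i) (s q j)\<close>.\<close>

lemma conn_form_so:
  assumes "metric_connection A g D" "linear_connection A D" "q \<in> U" "v \<in> tangent_space A q"
  shows "conn_form D q v \<in> so"
proof -
  have "conn_form D q v $ i $ j + conn_form D q v $ j $ i = 0" for i j
  proof -
    have "dir_deriv A q v (\<lambda>q. g q (s q i) (s q j)) =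
        g q (D q v (\<lambda>q. s q i)) (s q j) + g q (s q i) (D q v (\<lambda>q. s q j))"
      by (rule assms(1)[unfolded metric_connection_def, THEN spec, THEN spec, THEN spec, THEN mp,
            OF conjI[OF s_near s_near], THEN bspec, OF assms(3,3,4)])
    moreover have "dir_deriv A q v (\<lambda>q. g q (s q i) (s q j)) = dir_deriv A q v (\<lambda>q. if i = j then 1 else 0)"
      by (rule dir_deriv_cong[OF open_U assms(3) _ g_smooth[OF open_U s_smooth s_smooth]])
        (rule frame_orthonormal[OF s_orthonormal])
    moreover have "g q (s q i) (D q v (\<lambda>q. s q j)) = g q (D q v (\<lambda>q. s q j)) (s q i)"
      by (rule g_sym[OF s_tangent[OF assms(3)] conn_in[OF assms(2) s_near[OF assms(3)] assms(4)]])
    ultimately show ?thesis unfolding conn_form_def by (simp add: dir_deriv_const)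
  qed
  then show ?thesis by (simp add: so_def transpose_def vec_eq_iff eq_neg_iff_add_eq_0)
qed

lemma smooth_coeff: "open V \<Longrightarrow> V \<subseteq> U \<Longrightarrow> smooth_field A V Y \<Longrightarrow> smooth_fun A V (\<lambda>q. g q (Y q) (s q i))"
  by (rule g_smooth[OF _ _ smooth_field_subset[OF s_smooth]])

text \<open>Both connections obey the same Leibniz rule, so the derivatives of the coefficients of
  \<open>Y\<close> cancel and only the value of \<open>Y\<close> at \<open>q\<close> is
  left.\<close>

lemma conn_diff_near:
  assumes "linear_connection A D" "linear_connection A D'" "q \<in> U" "v \<in> tangent_space A q" "smooth_field_near A q Y"
  shows "D q v Y - D' q v Y = (\<Sum>j\<in>UNIV. g q (Y q) (s q j) *\<^sub>R (D q v (\<lambda>q. s q j) - D' q v (\<lambda>q. s q j)))"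
proof -
  obtain V where V: "open V" "q \<in> V" "smooth_field A V Y"
    using assms(5) unfolding smooth_field_near_def by blast
  let ?V = "U \<inter> V"
  have V': "open ?V" "q \<in> ?V" "smooth_field A ?V Y" 
    using V open_U assms(3) smooth_field_subset[OF V(3)] by auto
  have sm: "smooth_fun A ?V (\<lambda>q. g q (Y q) (s q j))" "smooth_field A ?V (\<lambda>q. s q j)" for j
    using smooth_coeff[OF V'(1) _ V'(3)] smooth_field_subset[OF s_smooth, of ?V] by auto
  have *: "D q v Y = (\<Sum>j\<in>UNIV. dir_deriv A q v (\<lambda>q. g q (Y q) (s q j)) *\<^sub>R s q j + g q (Y q) (s q j) *\<^sub>R D q v (\<lambda>q. s q j))"
    if D: "linear_connection A D" for D
  proof -
    have "D q v (\<lambda>q. \<Sum>j\<in>UNIV. g q (Y q) (s q j) *\<^sub>R s q j) = D q v Y"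
    proof (rule conn_local[OF D assms(5,4) V'(1,2)])
      fix r assume "r \<in> ?V"
      then show "(\<Sum>j\<in>UNIV. g r (Y r) (s r j) *\<^sub>R s r j) = Y r"
        using frame_expansion[OF s_orthonormal smooth_fieldD(1)[OF V'(3)], of r] by simp
    qed
    then show ?thesis using conn_sum[OF D V'(1,2) assms(4), of UNIV "\<lambda>j q. g q (Y q) (s q j)" "\<lambda>j q. s q j", OF sm] by simp
  qed
  show ?thesis unfolding *[OF assms(1)] *[OF assms(2)]
    by (simp add: sum.distrib scaleR_diff_right sum_subtractf)
qed

text \<open>\<open>conn_diff\<close> picks an extension of \<open>w\<close> by \<open>SOME\<close>.
  The combination \<open>Z\<close> of frame fields with constant coefficients shows that an
  extension exists, and by \<open>conn_diff_near\<close> the result is the same for all of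
  them.\<close>

lemma conn_diff_eq:
  assumes "linear_connection A D" "linear_connection A D'" "q \<in> U" "v \<in> tangent_space A q" "w \<in> tangent_space A q"
  shows "conn_diff A D D' q v w = (\<Sum>j\<in>UNIV. g q w (s q j) *\<^sub>R (D q v (\<lambda>q. s q j) - D' q v (\<lambda>q. s q j)))"
proof -
  define Z where "Z r = (\<Sum>j\<in>UNIV. g q w (s q j) *\<^sub>R s r j)" for r
  have "smooth_field_near A q Z"
    unfolding Z_def
    by (rule smooth_near_field[OF open_U assms(3) smooth_field_sum[OF open_U smooth_fun_const[OF open_U] s_smooth]])
  moreover have "Z q = w"
    unfolding Z_def by (rule frame_expansion[OF s_orthonormal[OF assms(3)] assms(5), symmetric])
  ultimately have "\<exists>Y. smooth_field_near A q Y \<and> Y q = w" by blast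
  note Y = someI_ex[OF this]
  show ?thesis
    unfolding conn_diff_def Let_def conn_diff_near[OF assms(1-4) conjunct1[OF Y]] conjunct2[OF Y] ..
qed

end

section \<open>Connection forms of \<open>G\<close>-connections\<close>

lemma smooth_on_line:
  fixes x v :: "'a::real_normed_vector"
  assumes "open I"
  shows "smooth_on I (\<lambda>t::real. x + t *\<^sub>R v)"
  by (rule smooth_on_add[OF assms smooth_on_const[OF assms]
        smooth_on_bounded_linear[OF bounded_linear_scaleR_left assms smooth_on_id[OF assms]]])

context local_frame
begin

lemma coordinate_line:
  assumes "c \<in> A" "q \<in> U" "q \<in> fst c"
  obtains e where "e > 0" "\<And>t. t \<in> {-e<..<e} \<Longrightarrow> snd c q + t *\<^sub>R w \<in> snd c ` (U \<inter> fst c)"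
proof -
  obtain r where r: "r > 0" "ball (snd c q) r \<subseteq> snd c ` (U \<inter> fst c)"
    using open_chart_image[OF assms(1) open_U] assms(2,3) unfolding open_contains_ball by blast
  define e where "e = r / (norm w + 1)"
  have np: "norm w + 1 > 0" using norm_ge_zero[of w] by linarith
  show thesis
  proof (rule that[of e])
    show "e > 0" using r np by (simp add: e_def)
    show "snd c q + t *\<^sub>R w \<in> snd c ` (U \<inter> fst c)" if t: "t \<in> {-e<..<e}" for t
    proof -
      have "\<bar>t\<bar> < e" using t by auto
      then have "\<bar>t\<bar> * (norm w + 1) < r" using np by (simp add: e_def pos_less_divide_eq)
      then have "\<bar>t\<bar> * norm w + \<bar>t\<bar> < r" by (simp add: algebra_simps)
      then have "\<bar>t\<bar> * norm w < r" using abs_ge_zero[of t] by linarith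
      then have "snd c q + t *\<^sub>R w \<in> ball (snd c q) r" by (simp add: dist_norm)
      then show ?thesis using r(2) by blast
    qed
  qed
qed

text \<open>A frame that is parallel along a curve and lies in \<open>P\<close> is \<open>s\<close> times a curve in \<open>G\<close>, whose
  velocity is minus the connection form.\<close>

lemma G_connection_conn_form:
  assumes "G_connection A P D" "q \<in> U" "v \<in> tangent_space A q"
  shows "conn_form D q v \<in> lie_algebra G"
proof -
  have D: "linear_connection A D" using assms(1) unfolding G_connection_def by (rule conjunct1)
  define c where "c = some_chart A q"
  have c: "c \<in> A" "q \<in> fst c" using some_chart[of q] by (simp_all add: c_def)
  \<comment> \<open>In coordinates, the straight line through \<open>q\<close> with velocity
    \<open>v\<close>; the frame \<open>s q\<close> will be transported along it.\<close>
  define x where "x t = snd c q + t *\<^sub>R v c" for t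
  obtain e where e: "e > 0" "\<And>t. t \<in> {-e<..<e} \<Longrightarrow> x t \<in> snd c ` (U \<inter> fst c)"
    unfolding x_def by (rule coordinate_line[OF c(1) assms(2) c(2)]) blast
  define I where "I = {-e<..<e}"
  have I: "open I" "0 \<in> I" using e(1) by (simp_all add: I_def)
  have xI: "x t \<in> snd c ` (U \<inter> fst c)" if "t \<in> I" for t using e(2) that by (simp add: I_def)
  have x_smooth: "smooth_on I x" unfolding x_def[abs_def] by (rule smooth_on_line[OF I(1)])
  define \<gamma> where "\<gamma> t = chart_inv c (x t)" for t
  have \<gamma>I: "\<gamma> t \<in> U" "\<gamma> t \<in> fst c" if "t \<in> I" for t
    using chart_inv_in[OF c(1) xI[OF that]] by (simp_all add: \<gamma>_def)
  have x\<gamma>: "snd c (\<gamma> t) = x t" if "t \<in> I" for t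
    unfolding \<gamma>_def by (rule chart_chart_inv[OF c(1)]) (use xI[OF that] in blast)
  have \<gamma>0: "\<gamma> 0 = q" using c by (simp add: \<gamma>_def x_def)
  have cont: "continuous_on I \<gamma>"
    unfolding \<gamma>_def
  proof (rule continuous_on_compose2[OF continuous_on_chart_inv[OF c(1)]])
    show "continuous_on I x" unfolding x_def by (intro continuous_intros)
    show "x ` I \<subseteq> snd c ` fst c" using xI by blast
  qed
  have curve: "smooth_curve A I \<gamma>"
    unfolding smooth_curve_def
  proof (intro conjI ballI)
    fix d assume d: "d \<in> A"
    let ?J = "{t \<in> I. \<gamma> t \<in> fst d}"
    have J: "open ?J"
      using continuous_on_open_vimage[OF I(1), THEN iffD1, OF cont, THEN spec, THEN mp, OF open_chart_domain[OF d]]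
      by (simp add: Int_def vimage_def conj_commute)
    have "smooth_on ?J (\<lambda>t. transition c d (x t))"
    proof (rule smooth_on_compose[OF J _ smooth_transition[OF c(1) d] smooth_on_subset[OF x_smooth]])
      show "x ` ?J \<subseteq> snd c ` (fst c \<inter> fst d)"
      proof (safe)
        fix t assume "t \<in> I" "\<gamma> t \<in> fst d"
        then show "x t \<in> snd c ` (fst c \<inter> fst d)" using x\<gamma>[of t] \<gamma>I(2)[of t] by (metis IntI imageI)
      qed
    qed blast
    then show "smooth_on ?J (snd d \<circ> \<gamma>)" by (simp add: transition_def o_def \<gamma>_def)
  qed (rule cont)
  have "s q \<in> P (\<gamma> 0)" using s_in[OF assms(2)] by (simp add: \<gamma>0)
  then have "\<exists>u. u 0 = s q \<and> (\<forall>i. parallel_along A D I \<gamma> (\<lambda>t. u t i)) \<and> (\<forall>t\<in>I. u t \<in> P (\<gamma> t))"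
    using conjunct2[OF assms(1)[unfolded G_connection_def], THEN spec, THEN spec, THEN spec, THEN mp,
        OF curve[unfolded I_def], THEN bspec, OF I(2)[unfolded I_def], THEN bspec]
    unfolding I_def by blast
  then obtain u where u: "u 0 = s q" "\<And>i. parallel_along A D I \<gamma> (\<lambda>t. u t i)" "\<And>t. t \<in> I \<Longrightarrow> u t \<in> P (\<gamma> t)"
    by blast
  have "\<forall>t\<in>I. \<exists>b\<in>G. u t = frame_act (s (\<gamma> t)) b"
    using u(3) P_orbit[OF s_in[OF \<gamma>I(1)]] by blast
  then obtain a where a: "\<And>t. t \<in> I \<Longrightarrow> a t \<in> G" "\<And>t. t \<in> I \<Longrightarrow> u t = frame_act (s (\<gamma> t)) (a t)"
    using bchoice by metis
  have a_eq: "a t $ i $ j = g (\<gamma> t) (u t j) (s (\<gamma> t) i)" if t: "t \<in> I" for t i j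
    using frame_coeff[OF s_orthonormal[OF \<gamma>I(1)[OF t]], of "\<lambda>i. a t $ i $ j" i]
    by (simp add: a(2)[OF t] frame_act_def)
  have a0: "a 0 = mat 1"
    using frame_orthonormal[OF s_orthonormal[OF assms(2)]]
    by (auto simp: vec_eq_iff mat_def a_eq[OF I(2)] u(1) \<gamma>0)
  have along: "smooth_field_along A I \<gamma> (\<lambda>t. u t j)" for j using u(2) unfolding parallel_along_def by blast
  have u_tangent: "u t j \<in> tangent_space A (\<gamma> t)" if "t \<in> I" for t j
    using along that unfolding smooth_field_along_def by blast
  have "{t \<in> I. \<gamma> t \<in> fst c} = I" using \<gamma>I(2) by blast
  then have u_smooth: "smooth_on I (\<lambda>t. u t j c)" for j
    using along[of j] c(1) unfolding smooth_field_along_def by metis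
  define V where "V = U \<inter> fst c"
  have V: "open V" "V \<subseteq> U" "V \<subseteq> fst c" "q \<in> V" "\<And>t. t \<in> I \<Longrightarrow> \<gamma> t \<in> V"
    using open_U open_chart_domain[OF c(1)] assms(2) c(2) \<gamma>I by (auto simp: V_def)
  have V_image: "V \<inter> fst c = U \<inter> fst c" by (auto simp: V_def)
  have coord_smooth: "smooth_field A V (coord_field A c m)" for m
    by (rule smooth_field_subset[OF smooth_coord_field[OF c(1)] V(3)])
  have sV: "smooth_field A V (\<lambda>q. s q j)" for j by (rule smooth_field_subset[OF s_smooth V(2)])
  have h_smooth: "smooth_on I (\<lambda>t. g (\<gamma> t) (coord_field A c m (\<gamma> t)) (s (\<gamma> t) i))" for m i
    unfolding \<gamma>_def
  proof (rule smooth_on_compose[OF I(1) _ _ x_smooth])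
    show "smooth_on (snd c ` (V \<inter> fst c))
        (\<lambda>x. g (chart_inv c x) (coord_field A c m (chart_inv c x)) (s (chart_inv c x) i))"
      by (rule smooth_funD[OF g_smooth[OF V(1) coord_smooth sV] c(1)])
    show "x ` I \<subseteq> snd c ` (V \<inter> fst c)" unfolding V_image using xI by blast
  qed
  have coord_in: "coord_field A c m (\<gamma> t) \<in> tangent_space A (\<gamma> t)" if "t \<in> I" for m t
    by (rule smooth_fieldD(1)[OF coord_smooth V(5)[OF that]])
  \<comment> \<open>Smoothness of \<open>a\<close> must come from that of the coordinates
    \<open>u t j c\<close>, which is what \<open>parallel_along\<close> provides; therefore the
    frame is expanded in coordinate fields.\<close>
  have a_sum: "a t $ i $ j = (\<Sum>m\<in>UNIV. u t j c $ m * g (\<gamma> t) (coord_field A c m (\<gamma> t)) (s (\<gamma> t) i))"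
    if t: "t \<in> I" for t i j
  proof -
    have "a t $ i $ j = g (\<gamma> t) (\<Sum>m\<in>UNIV. u t j c $ m *\<^sub>R coord_field A c m (\<gamma> t)) (s (\<gamma> t) i)"
      using coord_field_expansion[OF c(1) \<gamma>I(2)[OF t] u_tangent[OF t, of j]] by (simp add: a_eq[OF t])
    also have "\<dots> = (\<Sum>m\<in>UNIV. u t j c $ m * g (\<gamma> t) (coord_field A c m (\<gamma> t)) (s (\<gamma> t) i))"
      by (rule g_sum[OF coord_in[OF t] s_tangent[OF \<gamma>I(1)[OF t]]])
    finally show ?thesis .
  qed
  have a_entry: "smooth_on I (\<lambda>t. a t $ i $ j)" for i j
  proof -
    have "smooth_on I (\<lambda>t. \<Sum>m\<in>UNIV. u t j c $ m * g (\<gamma> t) (coord_field A c m (\<gamma> t)) (s (\<gamma> t) i))"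
      by (rule smooth_on_sum[OF I(1) smooth_on_mult[OF I(1) smooth_on_vec_nth[OF I(1) u_smooth] h_smooth]])
    with smooth_on_cong[of I "\<lambda>t. a t $ i $ j", OF I(1) a_sum] show ?thesis by simp
  qed
  have a_smooth: "smooth_on I a"
    by (rule smooth_on_vec[OF I(1) smooth_on_vec[OF I(1) a_entry]])
  define a' where "a' = frechet_derivative a (at 0) 1"
  have a_deriv: "(a has_vector_derivative a') (at 0)"
  proof -
    have d: "(a has_derivative frechet_derivative a (at 0)) (at 0)"
      by (rule smooth_on_has_derivative[OF a_smooth I(2)])
    have "frechet_derivative a (at 0) = (\<lambda>r. r *\<^sub>R a')"
    proof
      show "frechet_derivative a (at 0) r = r *\<^sub>R a'" for r
        using linear_scale[OF has_derivative_linear[OF d], of r 1] by (simp add: a'_def)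
    qed
    with d show ?thesis unfolding has_vector_derivative_def by simp
  qed
  have a'_in: "a' \<in> lie_algebra G"
    by (rule lie_algebraI[OF e(1) a_smooth[unfolded I_def] a(1)[unfolded I_def] a0 a_deriv])
  have velocity: "velocity A \<gamma> 0 = v"
  proof
    fix d show "velocity A \<gamma> 0 d = v d"
    proof (cases "d \<in> A \<and> q \<in> fst d")
      case True
      then have d: "d \<in> A" "q \<in> fst d" by auto
      have "(x has_derivative (\<lambda>t. t *\<^sub>R v c)) (at 0)"
        unfolding x_def[abs_def] by (auto intro!: derivative_eq_intros)
      moreover have "(transition c d has_derivative frechet_derivative (transition c d) (at (snd c q))) (at (x 0))"
        using transition_has_derivative[OF c(1) d(1) c(2) d(2)] by (simp add: x_def)
      ultimately have "(transition c d \<circ> x has_derivative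
          frechet_derivative (transition c d) (at (snd c q)) \<circ> (\<lambda>t. t *\<^sub>R v c)) (at 0)"
        by (rule diff_chain_at)
      then have "(snd d \<circ> \<gamma> has_derivative frechet_derivative (transition c d) (at (snd c q)) \<circ> (\<lambda>t. t *\<^sub>R v c)) (at 0)"
        by (simp add: transition_def \<gamma>_def[abs_def] o_def)
      then have "(snd d \<circ> \<gamma> has_vector_derivative frechet_derivative (transition c d) (at (snd c q)) (v c)) (at 0)"
        by (simp add: has_vector_derivative_def o_def linear_scale[OF transition_derivative_linear[OF c(1) d(1) c(2) d(2)]])
      then show ?thesis
        using tangent_transition[OF assms(3) c(1) d(1) c(2) d(2)] True
        by (simp add: velocity_def \<gamma>0 vector_derivative_at)
    next
      case False
      then show ?thesis using tangent_0[OF assms(3) False] by (auto simp: velocity_def \<gamma>0)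
    qed
  qed
  define E where "E j y = s (chart_inv c y) j c" for j y
  have E_deriv: "(E j has_derivative frechet_derivative (E j) (at (snd c q))) (at (snd c q))" for j
    unfolding E_def[abs_def]
    by (rule smooth_on_has_derivative[OF smooth_fieldD(2)[OF s_smooth c(1)]]) (use assms(2) c in blast)
  have uE: "u t j c = (\<Sum>i\<in>UNIV. a t $ i $ j *\<^sub>R E i (x t))" if "t \<in> I" for t j
    unfolding a(2)[OF that] frame_act_def sum_fun_apply scaleR_fun_apply E_def \<gamma>_def ..
  \<comment> \<open>The product rule for \<open>u t = frame_act (s (\<gamma> t)) (a t)\<close> at
    \<open>t = 0\<close>, where \<open>a 0 = mat 1\<close>.\<close>
  define u' where "u' j = (\<Sum>i\<in>UNIV. a' $ i $ j *\<^sub>R E i (snd c q)) + frechet_derivative (E j) (at (snd c q)) (v c)" for j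
  have u_deriv: "((\<lambda>t. u t j c) has_vector_derivative u' j) (at 0)" for j
  proof -
    have "(x has_vector_derivative v c) (at 0)"
      unfolding x_def[abs_def] has_vector_derivative_def by (auto intro!: derivative_eq_intros)
    moreover have "x 0 = snd c q" by (simp add: x_def)
    ultimately have Ex: "((\<lambda>t. E i (x t)) has_vector_derivative frechet_derivative (E i) (at (snd c q)) (v c)) (at 0)" for i
      using vector_derivative_diff_chain_within[of x "v c" 0 UNIV "E i" "frechet_derivative (E i) (at (snd c q))"] 
        has_derivative_at_withinI[OF E_deriv] by (simp add: o_def)
    have ae: "((\<lambda>t. a t $ i $ j) has_real_derivative a' $ i $ j) (at 0)" for i
    proof -
      have "bounded_linear (\<lambda>Y :: real^'n^'n. Y $ i $ j)"
        by (intro bounded_linear_compose[OF bounded_linear_vec_nth] bounded_linear_vec_nth)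
      from bounded_linear.has_vector_derivative[OF this a_deriv] show ?thesis
        by (simp add: has_real_derivative_iff_has_vector_derivative)
    qed
    have "((\<lambda>t. \<Sum>i\<in>UNIV. a t $ i $ j *\<^sub>R E i (x t)) has_vector_derivative
        (\<Sum>i\<in>UNIV. a 0 $ i $ j *\<^sub>R frechet_derivative (E i) (at (snd c q)) (v c) + a' $ i $ j *\<^sub>R E i (x 0))) (at 0)"
      by (intro has_vector_derivative_sum has_vector_derivative_scaleR ae Ex)
    moreover have "(\<Sum>i\<in>UNIV. a 0 $ i $ j *\<^sub>R frechet_derivative (E i) (at (snd c q)) (v c) + a' $ i $ j *\<^sub>R E i (x 0)) = u' j"
    proof -
      have "(\<Sum>i\<in>UNIV. a 0 $ i $ j *\<^sub>R frechet_derivative (E i) (at (snd c q)) (v c)) =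
          (\<Sum>i\<in>UNIV. if i = j then frechet_derivative (E j) (at (snd c q)) (v c) else 0)"
        by (rule sum.cong) (auto simp: a0 mat_def)
      then show ?thesis by (simp add: u'_def sum.distrib x_def add.commute)
    qed
    ultimately have "((\<lambda>t. \<Sum>i\<in>UNIV. a t $ i $ j *\<^sub>R E i (x t)) has_vector_derivative u' j) (at 0)" by simp
    then show ?thesis
      by (rule has_vector_derivative_transform_within_open[OF _ I]) (simp add: uE)
  qed
  have u0c: "u 0 j c = s q j c" for j by (simp add: u(1))
  have par: "(\<Sum>m\<in>UNIV. u' j $ m *\<^sub>R coord_field A c m q + (s q j c $ m) *\<^sub>R D q v (coord_field A c m)) = 0" for j
  proof -
    have "vector_derivative (\<lambda>t. u t j c $ m) (at 0) = u' j $ m" for m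
      by (rule vector_derivative_at[OF bounded_linear.has_vector_derivative[OF bounded_linear_vec_nth u_deriv]])
    moreover have "cov_deriv_along A D \<gamma> (\<lambda>t. u t j) 0 = 0" using u(2) I(2) unfolding parallel_along_def by blast
    ultimately show ?thesis
      unfolding cov_deriv_along_def \<gamma>0 c_def[symmetric] Let_def velocity u0c by simp
  qed
  \<comment> \<open>\<open>smooth_fun\<close> asks for smoothness in every chart \<open>d\<close>,
    but the components belong to the fixed chart \<open>c\<close>; the derivative of the transition
    map relates the two.\<close>
  have E_comp: "smooth_fun A V (\<lambda>q. s q j c $ m)" for j m
  proof (rule smooth_funI)
    fix d assume d: "d \<in> A"
    let ?S = "snd d ` (V \<inter> fst d)"
    have S: "open ?S" by (rule open_chart_image[OF d V(1)])
    have "smooth_on ?S (\<lambda>y. frechet_derivative (transition d c) (at y) (s (chart_inv d y) j d))"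
    proof -
      have "smooth_on ?S (\<lambda>y. \<Sum>b\<in>Basis. (s (chart_inv d y) j d \<bullet> b) *\<^sub>R frechet_derivative (transition d c) (at y) b)"
        by (rule smooth_on_sum[OF S smooth_on_scaleR[OF S smooth_on_bounded_linear[OF bounded_linear_inner_left S
                  smooth_fieldD(2)[OF sV d]] smooth_on_subset[OF smooth_on_derivative[OF smooth_transition[OF d c(1)]]]]])
          (use V(3) in blast)
      then show ?thesis
      proof (rule smooth_on_cong[OF S, THEN iffD2, rotated])
        fix y assume "y \<in> ?S"
        then have "chart_inv d y \<in> fst d" "chart_inv d y \<in> fst c" "snd d (chart_inv d y) = y"
          using chart_inv_in[OF d] chart_chart_inv[OF d] V(3) by blast+
        then have l: "linear (frechet_derivative (transition d c) (at y))"
          using transition_derivative_linear[OF d c(1)] by metis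
        have "frechet_derivative (transition d c) (at y) w = (\<Sum>b\<in>Basis. (w \<bullet> b) *\<^sub>R frechet_derivative (transition d c) (at y) b)" for w
          by (subst (1) euclidean_representation[of w, symmetric]) (simp only: linear_sum[OF l] linear_scale[OF l])
        then show "frechet_derivative (transition d c) (at y) (s (chart_inv d y) j d) =
          (\<Sum>b\<in>Basis. (s (chart_inv d y) j d \<bullet> b) *\<^sub>R frechet_derivative (transition d c) (at y) b)" .
      qed
    qed
    then have "smooth_on ?S (\<lambda>y. s (chart_inv d y) j c)"
    proof (rule smooth_on_cong[OF S, THEN iffD1, rotated])
      fix y assume y: "y \<in> ?S"
      then have *: "chart_inv d y \<in> fst d" "chart_inv d y \<in> fst c" "snd d (chart_inv d y) = y" "chart_inv d y \<in> V"
        using chart_inv_in[OF d] chart_chart_inv[OF d] V(3) by blast+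
      show "frechet_derivative (transition d c) (at y) (s (chart_inv d y) j d) = s (chart_inv d y) j c"
        using tangent_transition[OF smooth_fieldD(1)[OF sV *(4)] d c(1) *(1,2)] *(3) by simp
    qed
    then show "smooth_on ?S (\<lambda>y. s (chart_inv d y) j c $ m)" by (rule smooth_on_vec_nth[OF S])
  qed
  have dE: "dir_deriv A q v (\<lambda>q. s q j c $ m) = frechet_derivative (E j) (at (snd c q)) (v c) $ m" for j m
  proof -
    have "((\<lambda>y. s (chart_inv c y) j c $ m) has_derivative (\<lambda>w. frechet_derivative (E j) (at (snd c q)) w $ m)) (at (snd c q))"
      using bounded_linear.has_derivative[OF bounded_linear_vec_nth E_deriv[of j], of m] by (simp add: E_def)
    from dir_deriv_eq[OF this[unfolded c_def]] show ?thesis by (simp add: c_def)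
  qed
  have Ds: "D q v (\<lambda>q. s q j) = (\<Sum>m\<in>UNIV. frechet_derivative (E j) (at (snd c q)) (v c) $ m *\<^sub>R coord_field A c m q
      + (s q j c $ m) *\<^sub>R D q v (coord_field A c m))" for j
  proof -
    have "D q v (\<lambda>q. \<Sum>m\<in>UNIV. (s q j c $ m) *\<^sub>R coord_field A c m q) = D q v (\<lambda>q. s q j)"
    proof (rule conn_local[OF D s_near[OF assms(2)] assms(3) V(1,4)])
      fix r assume r: "r \<in> V"
      then have rc: "r \<in> fst c" using V(3) by blast
      show "(\<Sum>m\<in>UNIV. (s r j c $ m) *\<^sub>R coord_field A c m r) = s r j"
        by (rule coord_field_expansion[OF c(1) rc smooth_fieldD(1)[OF sV r], symmetric])
    qed
    then show ?thesis
      using conn_sum[OF D V(1,4) assms(3), of UNIV "\<lambda>m q. s q j c $ m" "\<lambda>m. coord_field A c m", OF E_comp coord_smooth]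
      by (simp only: dE)
  qed
  \<comment> \<open>At \<open>t = 0\<close>, parallelism of the product of \<open>s\<close> and
    \<open>a\<close> says that \<open>s\<close> times \<open>a'\<close> plus the covariant
    derivative of \<open>s\<close> is zero. \<open>par\<close> and \<open>Ds\<close> express this in
    the same coordinate fields.\<close>
  have "conn_form D q v = - a'"
  proof -
    have "D q v (\<lambda>q. s q j) = (\<Sum>i\<in>UNIV. (- a' $ i $ j) *\<^sub>R s q i)" for j
    proof -
      have "(\<Sum>i\<in>UNIV. a' $ i $ j *\<^sub>R s q i) = (\<Sum>m\<in>UNIV. (\<Sum>i\<in>UNIV. a' $ i $ j *\<^sub>R s q i) c $ m *\<^sub>R coord_field A c m q)"
        by (rule coord_field_expansion[OF c]) (intro tangent_intros s_tangent assms(2))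
      also have "(\<Sum>i\<in>UNIV. a' $ i $ j *\<^sub>R s q i) c = (\<Sum>i\<in>UNIV. a' $ i $ j *\<^sub>R E i (snd c q))"
        unfolding sum_fun_apply scaleR_fun_apply E_def chart_inv_chart[OF c] ..
      finally have sum: "(\<Sum>i\<in>UNIV. a' $ i $ j *\<^sub>R s q i) =
          (\<Sum>m\<in>UNIV. (\<Sum>i\<in>UNIV. a' $ i $ j *\<^sub>R E i (snd c q)) $ m *\<^sub>R coord_field A c m q)" .
      have "0 = (\<Sum>m\<in>UNIV. u' j $ m *\<^sub>R coord_field A c m q + (s q j c $ m) *\<^sub>R D q v (coord_field A c m))"
        by (rule par[symmetric])
      also have "\<dots> = (\<Sum>i\<in>UNIV. a' $ i $ j *\<^sub>R s q i) + D q v (\<lambda>q. s q j)"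
        unfolding sum Ds u'_def by (simp add: scaleR_left_distrib sum.distrib add.assoc)
      finally have "D q v (\<lambda>q. s q j) = - (\<Sum>i\<in>UNIV. a' $ i $ j *\<^sub>R s q i)"
        by (simp only: eq_neg_iff_add_eq_0 add.commute)
      then show ?thesis by (simp only: scaleR_minus_left sum_negf)
    qed
    then have "g q (D q v (\<lambda>q. s q j)) (s q i) = - a' $ i $ j" for i j
      using frame_coeff[OF s_orthonormal[OF assms(2)], of "\<lambda>i. - a' $ i $ j" i] by simp
    then show ?thesis by (simp add: conn_form_def vec_eq_iff)
  qed
  then show ?thesis using subspace_neg[OF subspace_lie_algebra a'_in] by simp
qed

end

section \<open>The Jacobi identity for a frame\<close>

text \<open>Differentiating the bracket relations expresses double brackets by first and second
  derivatives of the fields. Their cyclic sum cancels because second derivatives are symmetric, and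
  linear independence allows coefficients to be compared.\<close>

lemma jacobi_structure:
  fixes E :: "'n::finite \<Rightarrow> 'a::euclidean_space \<Rightarrow> 'a" and C :: "'n \<Rightarrow> 'n \<Rightarrow> 'n \<Rightarrow> 'a \<Rightarrow> real"
  assumes S: "open S" "x \<in> S" and E: "\<And>i. smooth_on S (E i)"
    and bracket: "\<And>k l y. y \<in> S \<Longrightarrow>
      frechet_derivative (E l) (at y) (E k y) - frechet_derivative (E k) (at y) (E l y) = (\<Sum>i\<in>UNIV. C k l i y *\<^sub>R E i y)"
    and C: "\<And>k l i. (C k l i has_derivative C' k l i) (at x)"
    and indep: "\<And>b i. (\<Sum>i\<in>UNIV. b i *\<^sub>R E i x) = 0 \<Longrightarrow> b i = 0"
  shows "C' l m i (E k x) + C' m k i (E l x) + C' k l i (E m x) +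
    (\<Sum>p\<in>UNIV. C l m p x * C k p i x + C m k p x * C l p i x + C k l p x * C m p i x) = 0"
proof -
  define dE where "dE i = frechet_derivative (E i) (at x)" for i
  define H where "H m h w = frechet_derivative (\<lambda>y. frechet_derivative (E m) (at y) w) (at x) h" for m h w
  have dE: "(E i has_derivative dE i) (at x)" for i
    unfolding dE_def by (rule smooth_on_has_derivative[OF E S(2)])
  note lin = has_derivative_linear[OF dE]
  have H: "((\<lambda>y. frechet_derivative (E m) (at y) w) has_derivative (\<lambda>h. H m h w)) (at x)" for m w
    unfolding H_def by (rule smooth_on_has_derivative[OF smooth_on_derivative[OF E] S(2)])
  have H_sym: "H m h w = H m w h" for m h w
    unfolding H_def by (rule second_derivative_symmetric[OF S(1) E S(2)])
  have H_lin: "(\<Sum>b\<in>Basis. (w \<bullet> b) *\<^sub>R H m h b) = H m h w" for m h w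
  proof -
    have l: "linear (\<lambda>h'. H m h' h)" by (rule has_derivative_linear[OF H])
    have "H m h w = H m (\<Sum>b\<in>Basis. (w \<bullet> b) *\<^sub>R b) h" by (simp add: euclidean_representation H_sym[of m h w])
    also have "\<dots> = (\<Sum>b\<in>Basis. (w \<bullet> b) *\<^sub>R H m b h)"
      by (simp add: linear_sum[OF l, simplified] linear_scale[OF l, simplified])
    also have "\<dots> = (\<Sum>b\<in>Basis. (w \<bullet> b) *\<^sub>R H m h b)" by (simp only: H_sym[of m _ h])
    finally show ?thesis ..
  qed
  have basis: "(\<Sum>b\<in>Basis. (w \<bullet> b) *\<^sub>R f b) = f w" if "linear f" for f :: "'a \<Rightarrow> 'a" and w
  proof -
    have "f w = f (\<Sum>b\<in>Basis. (w \<bullet> b) *\<^sub>R b)" by (simp add: euclidean_representation)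
    also have "\<dots> = (\<Sum>b\<in>Basis. (w \<bullet> b) *\<^sub>R f b)"
      by (simp add: linear_sum[OF that] linear_scale[OF that])
    finally show ?thesis ..
  qed
  \<comment> \<open>Second derivatives are available along fixed vectors only, so the moving vector
    \<open>E l y\<close> is expanded in a basis before differentiating.\<close>
  have dEE: "((\<lambda>y. frechet_derivative (E m) (at y) (E l y)) has_derivative (\<lambda>h. H m h (E l x) + dE m (dE l h))) (at x)" for l m
  proof -
    have "((\<lambda>y. \<Sum>b\<in>Basis. (E l y \<bullet> b) *\<^sub>R frechet_derivative (E m) (at y) b) has_derivative
        (\<lambda>h. \<Sum>b\<in>Basis. (E l x \<bullet> b) *\<^sub>R H m h b + (dE l h \<bullet> b) *\<^sub>R frechet_derivative (E m) (at x) b)) (at x)"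
      by (intro has_derivative_sum has_derivative_scaleR has_derivative_inner_left dE H)
    moreover have "(\<Sum>b\<in>Basis. (E l x \<bullet> b) *\<^sub>R H m h b + (dE l h \<bullet> b) *\<^sub>R frechet_derivative (E m) (at x) b) =
        H m h (E l x) + dE m (dE l h)" for h
      unfolding sum.distrib H_lin dE_def[of m, symmetric] by (simp only: basis[OF lin])
    ultimately have "((\<lambda>y. \<Sum>b\<in>Basis. (E l y \<bullet> b) *\<^sub>R frechet_derivative (E m) (at y) b) has_derivative
        (\<lambda>h. H m h (E l x) + dE m (dE l h))) (at x)" by simp
    then show ?thesis
    proof (rule has_derivative_transform_within_open[OF _ S])
      fix y assume "y \<in> S"
      then show "(\<Sum>b\<in>Basis. (E l y \<bullet> b) *\<^sub>R frechet_derivative (E m) (at y) b) = frechet_derivative (E m) (at y) (E l y)"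
        by (rule basis[OF has_derivative_linear[OF smooth_on_has_derivative[OF E]]])
    qed
  qed
  have B: "(\<Sum>i\<in>UNIV. C' l m i h *\<^sub>R E i x + C l m i x *\<^sub>R dE i h) =
      H m h (E l x) + dE m (dE l h) - (H l h (E m x) + dE l (dE m h))" for l m h
  proof -
    have "((\<lambda>y. \<Sum>i\<in>UNIV. C l m i y *\<^sub>R E i y) has_derivative
        (\<lambda>h. \<Sum>i\<in>UNIV. C l m i x *\<^sub>R dE i h + C' l m i h *\<^sub>R E i x)) (at x)"
      by (intro has_derivative_sum has_derivative_scaleR C dE)
    moreover have "((\<lambda>y. \<Sum>i\<in>UNIV. C l m i y *\<^sub>R E i y) has_derivative
        (\<lambda>h. H m h (E l x) + dE m (dE l h) - (H l h (E m x) + dE l (dE m h)))) (at x)"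
      by (rule has_derivative_transform_within_open[OF has_derivative_diff[OF dEE dEE] S]) (rule bracket)
    ultimately have "(\<lambda>h. \<Sum>i\<in>UNIV. C l m i x *\<^sub>R dE i h + C' l m i h *\<^sub>R E i x) =
        (\<lambda>h. H m h (E l x) + dE m (dE l h) - (H l h (E m x) + dE l (dE m h)))"
      by (rule has_derivative_unique)
    from fun_cong[OF this, of h] show ?thesis by (simp add: add.commute)
  qed
  \<comment> \<open>The components of the double bracket of \<open>E k\<close> with the bracket of
    \<open>E l\<close> and \<open>E m\<close>.\<close>
  define K where "K k l m r = C' l m r (E k x) + (\<Sum>p\<in>UNIV. C l m p x * C k p r x)" for k l m r
  have K: "(\<Sum>r\<in>UNIV. K k l m r *\<^sub>R E r x) =
      H m (E k x) (E l x) + dE m (dE l (E k x)) - (H l (E k x) (E m x) + dE l (dE m (E k x)))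
      - (dE k (dE m (E l x)) - dE k (dE l (E m x)))" for k l m
  proof -
    have 1: "dE p (E k x) = dE k (E p x) + (\<Sum>r\<in>UNIV. C k p r x *\<^sub>R E r x)" for p
      using bracket[OF S(2), of p k] by (simp add: dE_def algebra_simps)
    have 2: "(\<Sum>p\<in>UNIV. C l m p x *\<^sub>R dE k (E p x)) = dE k (dE m (E l x)) - dE k (dE l (E m x))"
    proof -
      have "dE k (dE m (E l x)) - dE k (dE l (E m x)) = dE k (\<Sum>p\<in>UNIV. C l m p x *\<^sub>R E p x)"
        using bracket[OF S(2), of m l] by (simp add: dE_def linear_diff[OF lin[of k, unfolded dE_def], symmetric])
      also have "\<dots> = (\<Sum>p\<in>UNIV. C l m p x *\<^sub>R dE k (E p x))"
        by (simp add: linear_sum[OF lin] linear_scale[OF lin])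
      finally show ?thesis ..
    qed
    have "(\<Sum>r\<in>UNIV. K k l m r *\<^sub>R E r x) =
        (\<Sum>r\<in>UNIV. C' l m r (E k x) *\<^sub>R E r x) + (\<Sum>r\<in>UNIV. \<Sum>p\<in>UNIV. (C l m p x * C k p r x) *\<^sub>R E r x)"
      by (simp add: K_def scaleR_left_distrib sum.distrib scaleR_sum_left)
    also have "(\<Sum>r\<in>UNIV. \<Sum>p\<in>UNIV. (C l m p x * C k p r x) *\<^sub>R E r x) =
        (\<Sum>p\<in>UNIV. C l m p x *\<^sub>R (\<Sum>r\<in>UNIV. C k p r x *\<^sub>R E r x))"
      by (subst sum.swap) (simp add: scaleR_sum_right)
    also have "\<dots> = (\<Sum>p\<in>UNIV. C l m p x *\<^sub>R dE p (E k x)) - (\<Sum>p\<in>UNIV. C l m p x *\<^sub>R dE k (E p x))"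
      by (simp add: 1 scaleR_right_distrib sum.distrib)
    finally show ?thesis
      unfolding 2 using B[of l m "E k x"] unfolding sum.distrib by (simp only: add_diff_eq)
  qed
  \<comment> \<open>In the cyclic sum the second derivatives cancel by \<open>H_sym\<close>, the
    compositions of first derivatives pairwise.\<close>
  have "(\<Sum>r\<in>UNIV. (K k l m r + K l m k r + K m k l r) *\<^sub>R E r x) = 0"
    unfolding scaleR_left_distrib sum.distrib K
    using H_sym[of m "E k x" "E l x"] H_sym[of l "E k x" "E m x"] H_sym[of k "E l x" "E m x"]
    by (simp add: algebra_simps)
  from indep[OF this] have "K k l m i + K l m k i + K m k l i = 0" .
  then show ?thesis by (simp add: K_def sum.distrib algebra_simps)
qed

section \<open>The intrinsic torsion in a local frame\<close>

lemma nested_sum_scaleR: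
  "(\<Sum>k\<in>I. \<Sum>i\<in>J. \<Sum>j\<in>K. c k i j *\<^sub>R u i) = (\<Sum>i\<in>J. (\<Sum>k\<in>I. \<Sum>j\<in>K. c k i j) *\<^sub>R u i)"
  for u :: "'b \<Rightarrow> 'c::real_vector"
  by (subst sum.swap) (simp add: scaleR_sum_left)

lemma (in orthogonal_subgroup) invariant_entry:
  assumes "\<And>b. b \<in> G \<Longrightarrow> tensor_act b T = T" "a \<in> G"
  shows "T $ l $ r $ p = (\<Sum>k\<in>UNIV. \<Sum>i\<in>UNIV. \<Sum>j\<in>UNIV. a $ l $ k * a $ r $ i * a $ p $ j * T $ k $ i $ j)"
proof -
  have "T $ l $ r $ p = (\<Sum>k\<in>UNIV. a $ l $ k *\<^sub>R (a ** T $ k ** transpose a)) $ r $ p"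
    using invariant_component[OF assms, of l] by simp
  also have "\<dots> = (\<Sum>k\<in>UNIV. \<Sum>j\<in>UNIV. \<Sum>i\<in>UNIV. a $ l $ k * a $ r $ i * a $ p $ j * T $ k $ i $ j)"
    by (simp add: matrix_matrix_mult_def transpose_def sum_distrib_left sum_distrib_right mult_ac)
  also have "\<dots> = (\<Sum>k\<in>UNIV. \<Sum>i\<in>UNIV. \<Sum>j\<in>UNIV. a $ l $ k * a $ r $ i * a $ p $ j * T $ k $ i $ j)"
    by (intro sum.cong refl sum.swap)
  finally show ?thesis .
qed

context local_frame
begin

lemma frame_act_s:
  assumes "q \<in> U" "u \<in> P q"
  obtains a where "a \<in> G" "u = frame_act (s q) a"
  using P_orbit[OF s_in[OF assms(1)]] assms(2) that by blast

lemma frame_act_coeff: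
  assumes "q \<in> U"
  shows "g q (frame_act (s q) a j) (s q i) = a $ i $ j"
  unfolding frame_act_def by (rule frame_coeff[OF s_orthonormal[OF assms]])

lemma frame_act_tangent: "q \<in> U \<Longrightarrow> frame_act (s q) a j \<in> tangent_space A q"
  unfolding frame_act_def by (intro tangent_intros s_tangent)

lemma g_frame_act:
  assumes "q \<in> U" "w \<in> tangent_space A q"
  shows "g q w (frame_act (s q) a j) = (\<Sum>i\<in>UNIV. a $ i $ j * g q w (s q i))"
  unfolding frame_act_def by (rule g_sum_right[OF s_tangent[OF assms(1)] assms(2)])

text \<open>The difference of two connections is a tensor, so its components in any frame of the
  fibre come from the two connection forms in \<open>s\<close> by a linear change of frame.\<close>

lemma frame_components_act:
  assumes D: "linear_connection A D" "linear_connection A D'" and q: "q \<in> U"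
  shows "frame_components g (conn_diff A D D') q (frame_act (s q) a) $ k =
    (\<Sum>l\<in>UNIV. a $ l $ k *\<^sub>R (transpose a ** (conn_form D q (s q l) - conn_form D' q (s q l)) ** a))"
proof -
  let ?u = "frame_act (s q) a"
  define N where "N v = conn_form D q v - conn_form D' q v" for v
  have uT: "?u k \<in> tangent_space A q" by (rule frame_act_tangent[OF q])
  have N: "N (?u k) = (\<Sum>l\<in>UNIV. a $ l $ k *\<^sub>R N (s q l))"
    unfolding N_def conn_form_linear[OF D(1) q uT] conn_form_linear[OF D(2) q uT] frame_act_coeff[OF q]
    by (simp add: scaleR_diff_right sum_subtractf)
  have diff_in: "D q (?u k) (\<lambda>q. s q p) - D' q (?u k) (\<lambda>q. s q p) \<in> tangent_space A q" for p
    by (intro tangent_intros conn_in[OF D(1) s_near[OF q] uT] conn_in[OF D(2) s_near[OF q] uT])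
  have diff_coeff: "g q (D q (?u k) (\<lambda>q. s q p) - D' q (?u k) (\<lambda>q. s q p)) (s q t) = N (?u k) $ t $ p" for p t
    by (simp add: N_def conn_form_def g_diff conn_in[OF D(1) s_near[OF q] uT] conn_in[OF D(2) s_near[OF q] uT] s_tangent[OF q])
  have "frame_components g (conn_diff A D D') q ?u $ k $ i $ j = (transpose a ** N (?u k) ** a) $ i $ j" for i j
  proof -
    have cd: "conn_diff A D D' q (?u k) (?u j) =
        (\<Sum>p\<in>UNIV. a $ p $ j *\<^sub>R (D q (?u k) (\<lambda>q. s q p) - D' q (?u k) (\<lambda>q. s q p)))"
      unfolding conn_diff_eq[OF D q uT frame_act_tangent[OF q]] frame_act_coeff[OF q] ..
    have cd_in: "conn_diff A D D' q (?u k) (?u j) \<in> tangent_space A q"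
      unfolding cd by (intro subspace_sum[OF subspace_tangent] subspace_scale[OF subspace_tangent] diff_in)
    have cd_coeff: "g q (conn_diff A D D' q (?u k) (?u j)) (s q t) = (\<Sum>p\<in>UNIV. a $ p $ j * N (?u k) $ t $ p)" for t
      unfolding cd g_sum[OF diff_in s_tangent[OF q]] diff_coeff ..
    have "frame_components g (conn_diff A D D') q ?u $ k $ i $ j =
        (\<Sum>t\<in>UNIV. a $ t $ i * (\<Sum>p\<in>UNIV. a $ p $ j * N (?u k) $ t $ p))"
      unfolding frame_components_def vec_lambda_beta g_frame_act[OF q cd_in] cd_coeff ..
    also have "\<dots> = (\<Sum>t\<in>UNIV. \<Sum>p\<in>UNIV. a $ t $ i * N (?u k) $ t $ p * a $ p $ j)"
      by (simp add: sum_distrib_left mult_ac)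
    also have "\<dots> = (\<Sum>p\<in>UNIV. \<Sum>t\<in>UNIV. a $ t $ i * N (?u k) $ t $ p * a $ p $ j)"
      by (rule sum.swap)
    also have "\<dots> = (transpose a ** N (?u k) ** a) $ i $ j"
      by (simp add: matrix_matrix_mult_def transpose_def sum_distrib_right)
    finally show ?thesis .
  qed
  then have "frame_components g (conn_diff A D D') q ?u $ k = transpose a ** N (?u k) ** a"
    by (simp add: vec_eq_iff)
  also have "\<dots> = (\<Sum>l\<in>UNIV. a $ l $ k *\<^sub>R (transpose a ** N (s q l) ** a))"
  proof -
    have l: "linear (\<lambda>X. transpose a ** X ** a)"
      by (rule bounded_linear.linear, intro bounded_linear_compose[OF bounded_bilinear.bounded_linear_left[OF bounded_bilinear_matrix_mult]]
        bounded_bilinear.bounded_linear_right[OF bounded_bilinear_matrix_mult])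
    show ?thesis unfolding N linear_sum[OF l] linear_scale[OF l] ..
  qed
  finally show ?thesis by (simp add: N_def)
qed

end

section \<open>The derivative of the intrinsic torsion\<close>

context orthogonal_subgroup
begin

lemma subspace_Lambda3: "subspace (Lambda3 :: (real^'n^'n^'n) set)"
proof (rule subspaceI)
  show "0 \<in> (Lambda3 :: (real^'n^'n^'n) set)" by (simp add: Lambda3_def)
  fix T :: "real^'n^'n^'n" assume T: "T \<in> Lambda3"
  have T': "T $ k $ i $ j = - T $ k $ j $ i" "T $ k $ i $ j = - T $ i $ k $ j" for k i j
    using T unfolding Lambda3_def mem_Collect_eq by blast+
  show "T + W \<in> Lambda3" if W: "W \<in> Lambda3" for W :: "real^'n^'n^'n"
  proof -
    have W': "W $ k $ i $ j = - W $ k $ j $ i" "W $ k $ i $ j = - W $ i $ k $ j" for k i j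
      using W unfolding Lambda3_def mem_Collect_eq by blast+
    have "(T + W) $ k $ i $ j = - (T + W) $ k $ j $ i" "(T + W) $ k $ i $ j = - (T + W) $ i $ k $ j" for k i j
      using T'(1)[of k i j] W'(1)[of k i j] T'(2)[of k i j] W'(2)[of k i j] by simp_all
    then show ?thesis unfolding Lambda3_def by blast
  qed
  have "(r *\<^sub>R T) $ k $ i $ j = - (r *\<^sub>R T) $ k $ j $ i" "(r *\<^sub>R T) $ k $ i $ j = - (r *\<^sub>R T) $ i $ k $ j" for r k i j
    using T'(1)[of k i j] T'(2)[of k i j] by simp_all
  then show "r *\<^sub>R T \<in> Lambda3" for r unfolding Lambda3_def by blast
qed

text \<open>For alternating \<open>T\<close> the torsion terms cancel. With \<open>\<omega>\<close>
  the Levi-Civita form, the right-hand side gives the components of the bracket of two frame fields,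
  since that connection is torsion free.\<close>

lemma structure_fun_eq:
  assumes "T \<in> Lambda3"
  shows "structure_fun (\<lambda>y. \<omega> y - T $ y) T y z t = \<omega> y $ t $ z - \<omega> z $ t $ y"
proof -
  have T: "T $ k $ i $ j = - T $ k $ j $ i" "T $ k $ i $ j = - T $ i $ k $ j" for k i j
    using assms unfolding Lambda3_def mem_Collect_eq by blast+
  show ?thesis
    using T(1)[of y z t] T(2)[of z t y] T(1)[of t z y] T(2)[of t y z] by (simp add: structure_fun_def)
qed

text \<open>Regard \<open>T\<close> as the bilinear product with components
  \<open>\<Sum>k j. y k * z j * T $ k $ i $ j\<close>. Infinitesimal invariance makes
  \<open>X\<close> a derivation of this product: skewness transfers \<open>X\<close> from the outer
  indices of \<open>T\<close> to the arguments \<open>y\<close> and \<open>z\<close>.\<close>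

lemma invariant_derivation:
  assumes T: "\<And>a. a \<in> G \<Longrightarrow> tensor_act a T = T" and X: "X \<in> lie_algebra G"
  shows "(\<Sum>i\<in>UNIV. X $ r $ i * (\<Sum>k\<in>UNIV. \<Sum>j\<in>UNIV. y k * z j * T $ k $ i $ j)) =
    (\<Sum>k\<in>UNIV. \<Sum>j\<in>UNIV. ((\<Sum>i\<in>UNIV. X $ k $ i * y i) * z j + y k * (\<Sum>i\<in>UNIV. X $ j $ i * z i)) * T $ k $ r $ j)"
proof -
  have skew: "X $ i $ j = - X $ j $ i" for i j using X lie_algebra_subset_so so_skew by blast
  have inv: "(\<Sum>p\<in>UNIV. X $ k $ p * T $ p $ r $ j + X $ r $ p * T $ k $ p $ j + X $ j $ p * T $ k $ r $ p) = 0" for k j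
    by (rule infinitesimal_invariance_component[OF T X])
  have "0 = (\<Sum>k\<in>UNIV. \<Sum>j\<in>UNIV. y k * z j * (\<Sum>p\<in>UNIV. X $ k $ p * T $ p $ r $ j + X $ r $ p * T $ k $ p $ j + X $ j $ p * T $ k $ r $ p))"
    by (simp add: inv)
  also have "\<dots> = (\<Sum>k\<in>UNIV. \<Sum>j\<in>UNIV. \<Sum>p\<in>UNIV. y k * z j * X $ k $ p * T $ p $ r $ j)
      + (\<Sum>k\<in>UNIV. \<Sum>j\<in>UNIV. \<Sum>p\<in>UNIV. y k * z j * X $ r $ p * T $ k $ p $ j)
      + (\<Sum>k\<in>UNIV. \<Sum>j\<in>UNIV. \<Sum>p\<in>UNIV. y k * z j * X $ j $ p * T $ k $ r $ p)"
    by (simp add: sum_distrib_left sum.distrib algebra_simps)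
  finally have "(\<Sum>(k, j, p)\<in>UNIV. y k * z j * X $ r $ p * T $ k $ p $ j) =
      - (\<Sum>(k, j, p)\<in>UNIV. y k * z j * X $ k $ p * T $ p $ r $ j)
      - (\<Sum>(k, j, p)\<in>UNIV. y k * z j * X $ j $ p * T $ k $ r $ p)"
    unfolding sum_UNIV_prod by simp
  also have "- (\<Sum>(k, j, p)\<in>UNIV. y k * z j * X $ k $ p * T $ p $ r $ j) =
      (\<Sum>(k, j, p)\<in>UNIV. X $ k $ p * y p * z j * T $ k $ r $ j)"
    unfolding sum_negf[symmetric]
  proof (rule sum.reindex_bij_witness[of _ "\<lambda>(k, j, p). (p, j, k)" "\<lambda>(k, j, p). (p, j, k)"]; safe)
    fix k j p
    show "X $ p $ k * y k * z j * T $ p $ r $ j = - (y k * z j * X $ k $ p * T $ p $ r $ j)"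
      using skew[of p k] by simp
  qed auto
  also have "(\<Sum>(k, j, p)\<in>UNIV. X $ k $ p * y p * z j * T $ k $ r $ j)
      - (\<Sum>(k, j, p)\<in>UNIV. y k * z j * X $ j $ p * T $ k $ r $ p) =
      (\<Sum>(k, j, p)\<in>UNIV. X $ k $ p * y p * z j * T $ k $ r $ j) + (\<Sum>(k, j, p)\<in>UNIV. y k * X $ j $ p * z p * T $ k $ r $ j)"
  proof -
    have "- (\<Sum>(k, j, p)\<in>UNIV. y k * z j * X $ j $ p * T $ k $ r $ p) = (\<Sum>(k, j, p)\<in>UNIV. y k * X $ j $ p * z p * T $ k $ r $ j)"
      unfolding sum_negf[symmetric]
    proof (rule sum.reindex_bij_witness[of _ "\<lambda>(k, j, p). (k, p, j)" "\<lambda>(k, j, p). (k, p, j)"]; safe)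
      fix k j p
      show "y k * X $ p $ j * z j * T $ k $ r $ p = - (y k * z j * X $ j $ p * T $ k $ r $ p)"
        using skew[of p j] by simp
    qed auto
    then show ?thesis by simp
  qed
  finally have *: "(\<Sum>(k, j, p)\<in>UNIV. y k * z j * X $ r $ p * T $ k $ p $ j) =
    (\<Sum>(k, j, p)\<in>UNIV. X $ k $ p * y p * z j * T $ k $ r $ j) + (\<Sum>(k, j, p)\<in>UNIV. y k * X $ j $ p * z p * T $ k $ r $ j)" .
  have "(\<Sum>i\<in>UNIV. X $ r $ i * (\<Sum>k\<in>UNIV. \<Sum>j\<in>UNIV. y k * z j * T $ k $ i $ j)) =
      (\<Sum>(i, k, j)\<in>UNIV. y k * z j * X $ r $ i * T $ k $ i $ j)"
    unfolding sum_UNIV_prod by (simp add: sum_distrib_left mult_ac)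
  also have "\<dots> = (\<Sum>(k, j, p)\<in>UNIV. y k * z j * X $ r $ p * T $ k $ p $ j)"
    by (rule sum.reindex_bij_witness[of _ "\<lambda>(k, j, p). (p, k, j)" "\<lambda>(i, k, j). (k, j, i)"]) auto
  also have "\<dots> = (\<Sum>k\<in>UNIV. \<Sum>j\<in>UNIV. ((\<Sum>i\<in>UNIV. X $ k $ i * y i) * z j + y k * (\<Sum>i\<in>UNIV. X $ j $ i * z i)) * T $ k $ r $ j)"
    unfolding * sum_UNIV_prod by (simp add: sum_distrib_left sum_distrib_right sum.distrib algebra_simps)
  finally show ?thesis .
qed

end

context local_frame
begin

text \<open>\<open>tensor_field_of\<close> uses a frame picked by \<open>SOME\<close>. As
  \<open>\<tau>\<close> has one invariant value on the whole fibre, that frame can be replaced by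
  the smooth section \<open>s\<close>.\<close>

lemma tensor_field_of_frame:
  assumes q: "q \<in> U" and T: "\<And>a. a \<in> G \<Longrightarrow> tensor_act a T = T" "\<And>u. u \<in> P q \<Longrightarrow> \<tau> q u = T"
    and vw: "v \<in> tangent_space A q" "w \<in> tangent_space A q"
  shows "tensor_field_of g P \<tau> q v w =
    (\<Sum>r\<in>UNIV. (\<Sum>k\<in>UNIV. \<Sum>j\<in>UNIV. g q v (s q k) * g q w (s q j) * T $ k $ r $ j) *\<^sub>R s q r)"
proof -
  define u where "u = (SOME u. u \<in> P q)"
  have u: "u \<in> P q" unfolding u_def by (rule someI[of "\<lambda>u. u \<in> P q", OF s_in[OF q]])
  obtain a where a: "a \<in> G" "u = frame_act (s q) a" using frame_act_s[OF q u] .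
  have u_in: "u i \<in> tangent_space A q" for i unfolding a(2) by (rule frame_act_tangent[OF q])
  define c where "c i = (\<Sum>k\<in>UNIV. \<Sum>j\<in>UNIV. g q v (u k) * g q w (u j) * T $ k $ i $ j)" for i
  have L: "tensor_field_of g P \<tau> q v w = (\<Sum>i\<in>UNIV. c i *\<^sub>R u i)"
    unfolding tensor_field_of_def Let_def u_def[symmetric] T(2)[OF u] nested_sum_scaleR c_def ..
  show ?thesis
  proof (rule frame_eqI[OF s_orthonormal[OF q]])
    show "tensor_field_of g P \<tau> q v w \<in> tangent_space A q"
      unfolding L by (intro subspace_sum[OF subspace_tangent] subspace_scale[OF subspace_tangent] u_in)
    show "(\<Sum>r\<in>UNIV. (\<Sum>k\<in>UNIV. \<Sum>j\<in>UNIV. g q v (s q k) * g q w (s q j) * T $ k $ r $ j) *\<^sub>R s q r) \<in> tangent_space A q"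
      by (intro subspace_sum[OF subspace_tangent] subspace_scale[OF subspace_tangent] s_tangent q)
    fix r
    define vs where "vs k = g q v (s q k)" for k
    define ws where "ws k = g q w (s q k)" for k
    have "g q (tensor_field_of g P \<tau> q v w) (s q r) = (\<Sum>i\<in>UNIV. c i * a $ r $ i)"
      unfolding L a(2) g_sum[OF frame_act_tangent[OF q] s_tangent[OF q]] frame_act_coeff[OF q] ..
    also have "\<dots> = (\<Sum>i\<in>UNIV. \<Sum>k\<in>UNIV. \<Sum>j\<in>UNIV. \<Sum>p\<in>UNIV. \<Sum>l\<in>UNIV.
        vs l * ws p * (a $ l $ k * a $ r $ i * a $ p $ j * T $ k $ i $ j))"
      unfolding c_def a(2) g_frame_act[OF q vw(1)] g_frame_act[OF q vw(2)] vs_def[symmetric] ws_def[symmetric]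
      by (simp add: sum_distrib_left sum_distrib_right mult_ac)
    also have "\<dots> = (\<Sum>(i, k, j, p, l)\<in>UNIV. vs l * ws p * (a $ l $ k * a $ r $ i * a $ p $ j * T $ k $ i $ j))"
      unfolding sum_UNIV_prod ..
    also have "\<dots> = (\<Sum>(l, p, k, i, j)\<in>UNIV. vs l * ws p * (a $ l $ k * a $ r $ i * a $ p $ j * T $ k $ i $ j))"
      by (rule sum.reindex_bij_witness[of _ "\<lambda>(l, p, k, i, j). (i, k, j, p, l)" "\<lambda>(i, k, j, p, l). (l, p, k, i, j)"]) auto
    also have "\<dots> = (\<Sum>l\<in>UNIV. \<Sum>p\<in>UNIV. vs l * ws p * T $ l $ r $ p)"
      unfolding sum_UNIV_prod sum_distrib_left[symmetric]
      by (intro sum.cong refl) (simp only: invariant_entry[OF T(1) a(1), symmetric])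
    also have "\<dots> = g q (\<Sum>r\<in>UNIV. (\<Sum>k\<in>UNIV. \<Sum>j\<in>UNIV. vs k * ws j * T $ k $ r $ j) *\<^sub>R s q r) (s q r)"
      by (rule frame_coeff[OF s_orthonormal[OF q], symmetric])
    finally show "g q (tensor_field_of g P \<tau> q v w) (s q r) =
      g q (\<Sum>r\<in>UNIV. (\<Sum>k\<in>UNIV. \<Sum>j\<in>UNIV. g q v (s q k) * g q w (s q j) * T $ k $ r $ j) *\<^sub>R s q r) (s q r)"
      unfolding vs_def ws_def .
  qed
qed

end

section \<open>Invariant skew-symmetric torsion along a section\<close>

locale invariant_torsion = local_frame A g G P U s
  for A :: "('m::topological_space, 'n::finite) atlas" and g G P U s +
  fixes D D' :: "('m, 'n) conn" and W :: "(real^'n^'n^'n) set"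
  assumes lc: "levi_civita A g D" and gc: "G_connection A P D'"
    and W: "trivial_submodule G W" "takes_values_in P (intrinsic_torsion A g G D D') W"
    and no_inv: "invariant_vectors G = {0}"
    and skew: "takes_values_in P (intrinsic_torsion A g G D D') Lambda3"
begin

definition torsion :: "'m \<Rightarrow> real^'n^'n^'n" where
  "torsion q = intrinsic_torsion A g G D D' q (s q)"

lemma D_linear: "linear_connection A D" and D_metric: "metric_connection A g D" and D_torsion_free: "torsion_free A D"
  using lc by (simp_all add: levi_civita_def)

lemma D'_linear: "linear_connection A D'"
  using gc unfolding G_connection_def by (rule conjunct1)

lemma W_subspace: "subspace W" and W_perp: "T \<in> W \<Longrightarrow> T \<in> V_tensor_perp G"
  and W_invariant: "T \<in> W \<Longrightarrow> a \<in> G \<Longrightarrow> tensor_act a T = T"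
  using W(1) unfolding trivial_submodule_def by blast+

lemma torsion_W: "q \<in> U \<Longrightarrow> torsion q \<in> W"
  and torsion_Lambda3: "q \<in> U \<Longrightarrow> torsion q \<in> Lambda3"
  using W(2) skew s_in unfolding takes_values_in_def torsion_def by blast+

text \<open>The connection form of \<open>D'\<close> has values in the Lie algebra and drops out
  under projection. A frame obtained from \<open>s q\<close> by \<open>a\<close> gives the torsion
  acted on by \<open>transpose a\<close>, which is again the torsion because \<open>W\<close> is
  trivial.\<close>

lemma torsion_eq:
  assumes q: "q \<in> U"
  shows "torsion q $ k = perp_component G (conn_form D q (s q k))"
    and "u \<in> P q \<Longrightarrow> intrinsic_torsion A g G D D' q u = torsion q"
proof -
  define N where "N l = conn_form D q (s q l) - conn_form D' q (s q l)" for l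
  have N: "N l \<in> so" for l
    unfolding N_def
    by (rule subspace_diff[OF subspace_so conn_form_so[OF D_metric D_linear q s_tangent[OF q]]
          subsetD[OF lie_algebra_subset_so G_connection_conn_form[OF gc q s_tangent[OF q]]]])
  have act: "intrinsic_torsion A g G D D' q (frame_act (s q) a) = 
      (\<chi> k. perp_component G (\<Sum>l\<in>UNIV. a $ l $ k *\<^sub>R (transpose a ** N l ** a)))" for a
    unfolding intrinsic_torsion_def frame_components_act[OF D_linear D'_linear q] N_def ..
  have one: "frame_act (s q) (mat 1) = s q"
  proof
    fix j
    have "(\<Sum>i\<in>UNIV. (mat 1 :: real^'n^'n) $ i $ j *\<^sub>R s q i) = (\<Sum>i\<in>UNIV. if i = j then s q j else 0)"
      by (rule sum.cong) (auto simp: mat_def)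
    then show "frame_act (s q) (mat 1) j = s q j" by (simp add: frame_act_def)
  qed
  have torsion_N: "torsion q $ k = perp_component G (N k)" for k
  proof -
    have "(\<Sum>l\<in>UNIV. (mat 1 :: real^'n^'n) $ l $ k *\<^sub>R (transpose (mat 1) ** N l ** mat 1)) = (\<Sum>l\<in>UNIV. if l = k then N k else 0)"
      by (rule sum.cong) (auto simp: transpose_mat, simp_all add: mat_def)
    then have "(\<Sum>l\<in>UNIV. (mat 1 :: real^'n^'n) $ l $ k *\<^sub>R (transpose (mat 1) ** N l ** mat 1)) = N k" by simp
    then show ?thesis unfolding torsion_def using act[of "mat 1"] by (simp add: one)
  qed
  show "torsion q $ k = perp_component G (conn_form D q (s q k))"
    unfolding torsion_N N_def
    by (rule perp_component_diff[OF conn_form_so[OF D_metric D_linear q s_tangent[OF q]]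
          G_connection_conn_form[OF gc q s_tangent[OF q]]])
  show "intrinsic_torsion A g G D D' q u = torsion q" if u: "u \<in> P q"
  proof -
    obtain a where a: "a \<in> G" "u = frame_act (s q) a" using frame_act_s[OF q u] .
    note ta = transpose_in[OF a(1)]
    have transpose_entry: "transpose a $ k $ l = a $ l $ k" for k l by (simp add: transpose_def)
    have "intrinsic_torsion A g G D D' q u = tensor_act (transpose a) (torsion q)"
      unfolding a(2) act tensor_act_def matrix_inv_eq[OF ta] torsion_N
      using perp_component_conj_sum[of "transpose a" N, OF ta N] by (simp add: transpose_entry)
    then show ?thesis using W_invariant[OF torsion_W[OF q] ta] by simp
  qed
qed

text \<open>The connection form of the minimal connection, for arbitrary directions; on the frame
  vectors it is the \<open>\<Omega>\<close> of \<open>torsion_derivative_eq_0\<close>.\<close>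

definition minimal_form :: "'m \<Rightarrow> ('m, 'n) tvec \<Rightarrow> real^'n^'n" where
  "minimal_form q v = conn_form D q v - (\<Sum>k\<in>UNIV. g q v (s q k) *\<^sub>R torsion q $ k)"

lemma minimal_form_frame: "q \<in> U \<Longrightarrow> conn_form D q (s q k) - torsion q $ k \<in> lie_algebra G"
  unfolding torsion_eq(1) by (rule diff_perp_component_in[OF conn_form_so[OF D_metric D_linear _ s_tangent]])

lemma minimal_form_in:
  assumes "q \<in> U" "v \<in> tangent_space A q"
  shows "minimal_form q v \<in> lie_algebra G"
proof -
  have "minimal_form q v = (\<Sum>k\<in>UNIV. g q v (s q k) *\<^sub>R (conn_form D q (s q k) - torsion q $ k))"
    unfolding minimal_form_def conn_form_linear[OF D_linear assms] by (simp add: scaleR_diff_right sum_subtractf)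
  then show ?thesis
    by (simp only:) (intro subspace_sum[OF subspace_lie_algebra] subspace_scale[OF subspace_lie_algebra] minimal_form_frame assms(1))
qed

lemma torsion_smooth: "smooth_fun A U torsion"
proof (rule smooth_fun_cong[OF open_U])
  show "(\<chi> k. conn_form D q (s q k) - lie_proj (conn_form D q (s q k))) = torsion q" if "q \<in> U" for q
    using torsion_eq(1)[OF that] perp_component_eq[OF conn_form_so[OF D_metric D_linear that s_tangent[OF that]]]
    by (simp add: vec_eq_iff)
  show "smooth_fun A U (\<lambda>q. \<chi> k. conn_form D q (s q k) - lie_proj (conn_form D q (s q k)))"
  proof (rule smooth_funI)
    fix c assume c: "c \<in> A"
    note S = open_chart_image[OF c open_U]
    have l: "bounded_linear (\<lambda>X. X - lie_proj X)"
      using linear_lie_proj by (intro bounded_linear_sub bounded_linear_ident) (simp add: linear_conv_bounded_linear)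
    show "smooth_on (snd c ` (U \<inter> fst c)) (\<lambda>x. \<chi> k. conn_form D (chart_inv c x) (s (chart_inv c x) k) -
        lie_proj (conn_form D (chart_inv c x) (s (chart_inv c x) k)))"
    proof (rule smooth_on_vec[OF S], unfold vec_lambda_beta)
      show "smooth_on (snd c ` (U \<inter> fst c)) (\<lambda>x. conn_form D (chart_inv c x) (s (chart_inv c x) k) -
          lie_proj (conn_form D (chart_inv c x) (s (chart_inv c x) k)))" for k
        by (rule smooth_on_bounded_linear[OF l S smooth_funD[OF conn_form_smooth[OF D_linear] c]])
    qed
  qed
qed

text \<open>Torsion-freeness expresses the bracket of frame fields by the Levi-Civita form, so
  \<open>structure_fun_eq\<close> describes the structure functions of the frame.\<close>

lemma frame_bracket:
  assumes c: "c \<in> A" and q: "q \<in> U" "q \<in> fst c"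
  shows "frechet_derivative (\<lambda>y. s (chart_inv c y) l c) (at (snd c q)) (s q k c)
      - frechet_derivative (\<lambda>y. s (chart_inv c y) k c) (at (snd c q)) (s q l c)
    = (\<Sum>i\<in>UNIV. (conn_form D q (s q k) $ i $ l - conn_form D q (s q l) $ i $ k) *\<^sub>R s q i c)"
proof -
  have "D q (s q k) (\<lambda>q. s q l) - D q (s q l) (\<lambda>q. s q k) = lie_bracket A (\<lambda>q. s q k) (\<lambda>q. s q l) q"
    by (rule D_torsion_free[unfolded torsion_free_def, THEN spec, THEN spec, THEN spec, THEN mp, OF conjI[OF s_near s_near], OF q(1) q(1)])
  then have "lie_bracket A (\<lambda>q. s q k) (\<lambda>q. s q l) q =
      (\<Sum>i\<in>UNIV. (conn_form D q (s q k) $ i $ l - conn_form D q (s q l) $ i $ k) *\<^sub>R s q i)"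
    unfolding conn_form_expansion[OF D_linear q(1) s_tangent[OF q(1)]]
    by (simp add: scaleR_diff_left sum_subtractf)
  from fun_cong[OF this, of c] show ?thesis
    unfolding sum_fun_apply scaleR_fun_apply lie_bracket_def using c q(2) by simp
qed

text \<open>In a chart, frame, connection form and torsion become maps on an open subset of
  \<open>real^'n\<close>. Their Jacobi identity is the hypothesis of
  \<open>torsion_derivative_eq_0\<close>; the other hypotheses hold because derivatives stay in the
  vector spaces \<open>W\<close>, \<open>Lambda3\<close> and \<open>lie_algebra G\<close>.\<close>

lemma torsion_derivative:
  assumes c: "c \<in> A" and p: "p \<in> U" "p \<in> fst c"
  shows "((\<lambda>y. torsion (chart_inv c y)) has_derivative (\<lambda>h. 0)) (at (snd c p))"
proof -
  let ?S = "snd c ` (U \<inter> fst c)"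
  define x0 where "x0 = snd c p"
  have S: "open ?S" "x0 \<in> ?S" using open_chart_image[OF c open_U] p by (auto simp: x0_def)
  have chart: "chart_inv c y \<in> U" "chart_inv c y \<in> fst c" "snd c (chart_inv c y) = y" if "y \<in> ?S" for y
    using chart_inv_in[OF c that] chart_chart_inv[OF c] that by blast+
  have x0: "chart_inv c x0 = p" using c p by (simp add: x0_def)
  define E where "E i y = s (chart_inv c y) i c" for i y
  define \<omega> where "\<omega> k y = conn_form D (chart_inv c y) (s (chart_inv c y) k)" for k y
  define X where "X y = torsion (chart_inv c y)" for y
  define d\<omega> where "d\<omega> k = frechet_derivative (\<omega> k) (at x0)" for k
  define dX where "dX = frechet_derivative X (at x0)"
  have E: "smooth_on ?S (E i)" for i
    unfolding E_def by (rule smooth_fieldD(2)[OF s_smooth c])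
  have d\<omega>: "(\<omega> k has_derivative d\<omega> k) (at x0)" for k
    unfolding \<omega>_def d\<omega>_def by (rule smooth_on_has_derivative[OF smooth_funD[OF conn_form_smooth[OF D_linear] c] S(2)])
  have dX: "(X has_derivative dX) (at x0)"
    unfolding X_def dX_def by (rule smooth_on_has_derivative[OF smooth_funD[OF torsion_smooth c] S(2)])
  define C where "C k l i y = \<omega> k y $ i $ l - \<omega> l y $ i $ k" for k l i y
  define C' where "C' k l i h = d\<omega> k h $ i $ l - d\<omega> l h $ i $ k" for k l i h
  have X_in: "X y \<in> W" "X y \<in> Lambda3" if "y \<in> ?S" for y
    unfolding X_def using torsion_W torsion_Lambda3 chart(1)[OF that] by blast+
  have dX_in: "dX h \<in> W" "dX h \<in> Lambda3" for h
    using has_derivative_in_subspace[OF W_subspace S _ dX] has_derivative_in_subspace[OF subspace_Lambda3 S _ dX] X_in by blast+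
  have dX_comp: "((\<lambda>y. X y $ k) has_derivative (\<lambda>h. dX h $ k)) (at x0)" for k
    by (rule bounded_linear.has_derivative[OF bounded_linear_vec_nth dX])
  have \<Omega>: "\<omega> k y - X y $ k \<in> lie_algebra G" if "y \<in> ?S" for k y
    unfolding \<omega>_def X_def by (rule minimal_form_frame[OF chart(1)[OF that]])
  have d\<Omega>: "d\<omega> k h - dX h $ k \<in> lie_algebra G" for k h
    by (rule has_derivative_in_subspace[OF subspace_lie_algebra S \<Omega> has_derivative_diff[OF d\<omega> dX_comp]])
  have jacobi: "C' l m i (E k x0) + C' m k i (E l x0) + C' k l i (E m x0) +
    (\<Sum>p\<in>UNIV. C l m p x0 * C k p i x0 + C m k p x0 * C l p i x0 + C k l p x0 * C m p i x0) = 0" for k l m i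
  proof (rule jacobi_structure[OF S E])
    fix k l y assume y: "y \<in> ?S"
    show "frechet_derivative (E l) (at y) (E k y) - frechet_derivative (E k) (at y) (E l y) = (\<Sum>i\<in>UNIV. C k l i y *\<^sub>R E i y)"
      using frame_bracket[OF c chart(1,2)[OF y], of l k] unfolding chart(3)[OF y] E_def[abs_def] C_def \<omega>_def .
  next
    fix k l i
    have "((\<lambda>y. \<omega> k y $ i $ l) has_derivative (\<lambda>h. d\<omega> k h $ i $ l)) (at x0)" for k i l
      by (intro bounded_linear.has_derivative[OF bounded_linear_vec_nth] d\<omega>)
    then show "(C k l i has_derivative C' k l i) (at x0)"
      unfolding C_def[abs_def] C'_def[abs_def] by (intro has_derivative_diff)
  next
    fix b i assume "(\<Sum>i\<in>UNIV. b i *\<^sub>R E i x0) = 0"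
    then have "(\<Sum>i\<in>UNIV. b i *\<^sub>R s p i) c = 0 c"
      unfolding sum_fun_apply scaleR_fun_apply E_def x0 zero_fun_apply .
    then have "(\<Sum>i\<in>UNIV. b i *\<^sub>R s p i) = 0"
      by (intro tangent_eqI[OF _ _ c p(2)] tangent_intros s_tangent p(1))
    then show "b i = 0"
      using frame_coeff[OF s_orthonormal[OF p(1)], of b i] g_zero[OF s_tangent[OF p(1)]] by simp
  qed
  have "dX (E x x0) = 0" for x
  proof (rule torsion_derivative_eq_0[OF no_inv, where \<Omega> = "\<lambda>y. \<omega> y x0 - X x0 $ y" and T = "X x0"
        and d\<Omega> = "\<lambda>x y. d\<omega> y (E x x0) - dX (E x x0) $ y" and dT = "\<lambda>x. dX (E x x0)"])
    show "structure_fun (\<lambda>y. d\<omega> y (E x x0) - dX (E x x0) $ y) (dX (E x x0)) y z t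
      + structure_fun (\<lambda>x. d\<omega> x (E y x0) - dX (E y x0) $ x) (dX (E y x0)) z x t
      + structure_fun (\<lambda>y. d\<omega> y (E z x0) - dX (E z x0) $ y) (dX (E z x0)) x y t
      + (\<Sum>p\<in>UNIV. structure_fun (\<lambda>y. \<omega> y x0 - X x0 $ y) (X x0) y z p * structure_fun (\<lambda>y. \<omega> y x0 - X x0 $ y) (X x0) x p t
        + structure_fun (\<lambda>y. \<omega> y x0 - X x0 $ y) (X x0) z x p * structure_fun (\<lambda>y. \<omega> y x0 - X x0 $ y) (X x0) y p t
        + structure_fun (\<lambda>y. \<omega> y x0 - X x0 $ y) (X x0) x y p * structure_fun (\<lambda>y. \<omega> y x0 - X x0 $ y) (X x0) z p t) = 0" for x y z t
      unfolding structure_fun_eq[OF dX_in(2)] structure_fun_eq[OF X_in(2)[OF S(2)]]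
      using jacobi[where k = x and l = y and m = z and i = t] unfolding C_def C'_def .
  qed (use \<Omega>[OF S(2)] d\<Omega> X_in[OF S(2)] dX_in W_invariant W_perp in blast)+
  \<comment> \<open>So far only derivatives along the frame vanish. A coordinate direction
    \<open>h\<close> is lifted to a tangent vector at \<open>p\<close> and expanded in the
    frame.\<close>
  moreover have "h = (\<Sum>i\<in>UNIV. g p (tangent_vec c p h) (s p i) *\<^sub>R E i x0)" for h
  proof -
    have "tangent_vec c p h = (\<Sum>i\<in>UNIV. g p (tangent_vec c p h) (s p i) *\<^sub>R s p i)"
      by (rule frame_expansion[OF s_orthonormal[OF p(1)] tangent_vec_in[OF c p(2)]])
    from fun_cong[OF this, of c] show ?thesis
      unfolding tangent_vec_chart[OF c p(2)] sum_fun_apply scaleR_fun_apply E_def x0 .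
  qed
  ultimately have "dX h = 0" for h
  proof -
    assume 0: "\<And>x. dX (E x x0) = 0" and span: "\<And>h. h = (\<Sum>i\<in>UNIV. g p (tangent_vec c p h) (s p i) *\<^sub>R E i x0)"
    note l = has_derivative_linear[OF dX]
    have "dX h = dX (\<Sum>i\<in>UNIV. g p (tangent_vec c p h) (s p i) *\<^sub>R E i x0)" by (rule arg_cong[OF span])
    also have "\<dots> = 0" unfolding linear_sum[OF l] linear_scale[OF l] 0 by simp
    finally show ?thesis .
  qed
  then have "dX = (\<lambda>h. 0)" by (rule ext)
  with dX show ?thesis by (simp add: X_def[abs_def] x0_def)
qed

lemma dir_deriv_torsion:
  assumes "p \<in> U"
  shows "dir_deriv A p v (\<lambda>q. torsion q $ k $ i $ j) = 0"
proof -
  have "((\<lambda>y. torsion (chart_inv (some_chart A p) y) $ k $ i $ j) has_derivative (\<lambda>h. 0 $ k $ i $ j)) (at (snd (some_chart A p) p))"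
    by (intro bounded_linear.has_derivative[OF bounded_linear_vec_nth] torsion_derivative some_chart assms)
  from dir_deriv_eq[OF this] show ?thesis by simp
qed

lemma torsion_entry_smooth: "smooth_fun A U (\<lambda>q. torsion q $ k $ i $ j)"
  by (rule smooth_funI, intro smooth_on_vec_nth open_chart_image open_U, assumption+, rule smooth_funD[OF torsion_smooth])

section \<open>The covariant derivative of the torsion\<close>

abbreviation "S \<equiv> tensor_field_of g P (intrinsic_torsion A g G D D')"

abbreviation "M \<equiv> minimal_connection g P D (intrinsic_torsion A g G D D')"

lemma S_frame:
  assumes "q \<in> U" "v \<in> tangent_space A q" "w \<in> tangent_space A q"
  shows "S q v w = (\<Sum>r\<in>UNIV. (\<Sum>k\<in>UNIV. \<Sum>j\<in>UNIV. g q v (s q k) * g q w (s q j) * torsion q $ k $ r $ j) *\<^sub>R s q r)"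
  by (rule tensor_field_of_frame[where \<tau> = "intrinsic_torsion A g G D D'" and T = "torsion q", OF assms(1) W_invariant[OF torsion_W[OF assms(1)]] torsion_eq(2)[OF assms(1)] assms(2,3)])

lemma S_in: "q \<in> U \<Longrightarrow> v \<in> tangent_space A q \<Longrightarrow> w \<in> tangent_space A q \<Longrightarrow> S q v w \<in> tangent_space A q"
  unfolding S_frame by (intro subspace_sum[OF subspace_tangent] subspace_scale[OF subspace_tangent] s_tangent)

lemma S_coeff:
  assumes "q \<in> U" "v \<in> tangent_space A q" "w \<in> tangent_space A q"
  shows "g q (S q v w) (s q r) = (\<Sum>k\<in>UNIV. \<Sum>j\<in>UNIV. g q v (s q k) * g q w (s q j) * torsion q $ k $ r $ j)"
  unfolding S_frame[OF assms] by (rule frame_coeff[OF s_orthonormal[OF assms(1)]])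

lemma M_in:
  assumes "p \<in> U" "v \<in> tangent_space A p" "smooth_field_near A p Y" "Y p \<in> tangent_space A p"
  shows "M p v Y \<in> tangent_space A p"
  unfolding minimal_connection_def
  by (intro subspace_diff[OF subspace_tangent] conn_in[OF D_linear assms(3,2)] S_in assms)

text \<open>Metric compatibility moves the Levi-Civita derivative from \<open>Y\<close> to the
  frame, skewness of \<open>conn_form\<close> restores the index order, and the subtracted torsion
  turns this form into \<open>minimal_form\<close>.\<close>

lemma M_coeff:
  assumes p: "p \<in> U" and v: "v \<in> tangent_space A p" and Y: "smooth_field_near A p Y" "Y p \<in> tangent_space A p"
  shows "g p (M p v Y) (s p r) = dir_deriv A p v (\<lambda>q. g q (Y q) (s q r))
    + (\<Sum>i\<in>UNIV. minimal_form p v $ r $ i * g p (Y p) (s p i))"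
proof -
  note sT = s_tangent[OF p]
  have DY: "D p v Y \<in> tangent_space A p" by (rule conn_in[OF D_linear Y(1) v])
  have "dir_deriv A p v (\<lambda>q. g q (Y q) (s q r)) = g p (D p v Y) (s p r) + g p (Y p) (D p v (\<lambda>q. s q r))"
    by (rule D_metric[unfolded metric_connection_def, THEN spec, THEN spec, THEN spec, THEN mp,
          OF conjI[OF Y(1) s_near[OF p]], THEN bspec, OF v])
  moreover have "g p (Y p) (D p v (\<lambda>q. s q r)) = (\<Sum>i\<in>UNIV. conn_form D p v $ i $ r * g p (Y p) (s p i))"
    unfolding conn_form_expansion[OF D_linear p v] by (rule g_sum_right[OF sT Y(2)])
  moreover have "g p (M p v Y) (s p r) = g p (D p v Y) (s p r) - g p (S p v (Y p)) (s p r)"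
    unfolding minimal_connection_def by (rule g_diff[OF DY S_in[OF p v Y(2)] sT])
  moreover have "g p (S p v (Y p)) (s p r) = (\<Sum>i\<in>UNIV. (\<Sum>k\<in>UNIV. g p v (s p k) * torsion p $ k $ r $ i) * g p (Y p) (s p i))"
    unfolding S_coeff[OF p v Y(2)] by (subst sum.swap) (simp add: sum_distrib_left sum_distrib_right mult_ac)
  moreover have "conn_form D p v $ i $ r = - conn_form D p v $ r $ i" for i
    by (rule so_skew[OF conn_form_so[OF D_metric D_linear p v]])
  ultimately show ?thesis
    by (simp add: minimal_form_def left_diff_distrib sum_subtractf sum_negf)
qed

text \<open>By \<open>M_coeff\<close>, the minimal derivative is the derivative of components plus
  the action of a matrix of the Lie algebra. The first part obeys the Leibniz rule because the
  torsion has derivative zero in the frame, the second by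
  \<open>invariant_derivation\<close>.\<close>

lemma parallel:
  assumes p: "p \<in> U" and YZ: "smooth_field_near A p Y" "smooth_field_near A p Z" and v: "v \<in> tangent_space A p"
  shows "M p v (\<lambda>q. S q (Y q) (Z q)) - S p (M p v Y) (Z p) - S p (Y p) (M p v Z) = 0"
proof -
  obtain V1 V2 where V12: "open V1" "p \<in> V1" "smooth_field A V1 Y" "open V2" "p \<in> V2" "smooth_field A V2 Z"
    using YZ unfolding smooth_field_near_def by blast
  define V where "V = U \<inter> (V1 \<inter> V2)"
  have V: "open V" "p \<in> V" "V \<subseteq> U" unfolding V_def using V12 open_U p by auto
  have Y: "smooth_field A V Y" by (rule smooth_field_subset[OF V12(3)]) (auto simp: V_def)
  have Z: "smooth_field A V Z" by (rule smooth_field_subset[OF V12(6)]) (auto simp: V_def)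
  define y where "y k q = g q (Y q) (s q k)" for k q
  define z where "z k q = g q (Z q) (s q k)" for k q
  have y: "smooth_fun A V (y k)" for k unfolding y_def[abs_def] by (rule smooth_coeff[OF V(1,3) Y])
  have z: "smooth_fun A V (z k)" for k unfolding z_def[abs_def] by (rule smooth_coeff[OF V(1,3) Z])
  have T: "smooth_fun A V (\<lambda>q. torsion q $ k $ i $ j)" for k i j
    by (rule smooth_fun_subset[OF torsion_entry_smooth V(3)])
  define f where "f r q = (\<Sum>k\<in>UNIV. \<Sum>j\<in>UNIV. y k q * z j q * torsion q $ k $ r $ j)" for r q
  note sm = smooth_fun_mult[OF V(1) smooth_fun_mult[OF V(1) y z] T]
  have f: "smooth_fun A V (f r)" for r
    unfolding f_def[abs_def] by (intro smooth_fun_sum V(1) sm)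
  let ?F = "\<lambda>q. S q (Y q) (Z q)"
  have F_eq: "?F q = (\<Sum>r\<in>UNIV. f r q *\<^sub>R s q r)" if "q \<in> V" for q
    unfolding S_frame[OF subsetD[OF V(3) that] smooth_fieldD(1)[OF Y that] smooth_fieldD(1)[OF Z that]] f_def y_def z_def ..
  have F: "smooth_field A V ?F"
  proof (rule smooth_field_cong[OF V(1)])
    show "smooth_field A V (\<lambda>q. \<Sum>r\<in>UNIV. f r q *\<^sub>R s q r)"
      by (rule smooth_field_sum[OF V(1) f smooth_field_subset[OF s_smooth V(3)]])
  qed (rule F_eq[symmetric])
  have F_coeff: "g q (?F q) (s q r) = f r q" if "q \<in> V" for q r
    unfolding F_eq[OF that] by (rule frame_coeff[OF s_orthonormal[OF subsetD[OF V(3) that]]])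
  have Yp: "Y p \<in> tangent_space A p" and Zp: "Z p \<in> tangent_space A p" and Fp: "?F p \<in> tangent_space A p"
    using smooth_fieldD(1)[OF Y V(2)] smooth_fieldD(1)[OF Z V(2)] smooth_fieldD(1)[OF F V(2)] by blast+
  note F_near = smooth_near_field[OF V(1,2) F]
  note MY = M_in[OF p v YZ(1) Yp] and MZ = M_in[OF p v YZ(2) Zp]
  let ?m = "minimal_form p v"
  \<comment> \<open>The product rule has a third term, with the derivative of the torsion; it is
    zero by \<open>dir_deriv_torsion\<close>.\<close>
  have df: "dir_deriv A p v (f r) =
      (\<Sum>k\<in>UNIV. \<Sum>j\<in>UNIV. (dir_deriv A p v (y k) * z j p + y k p * dir_deriv A p v (z j)) * torsion p $ k $ r $ j)" for r
  proof -
    have "dir_deriv A p v (f r) = (\<Sum>k\<in>UNIV. \<Sum>j\<in>UNIV. dir_deriv A p v (\<lambda>q. y k q * z j q * torsion q $ k $ r $ j))"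
      unfolding f_def[abs_def]
      by (simp only: dir_deriv_sum[OF V(1,2) smooth_fun_sum[OF V(1) sm]] dir_deriv_sum[OF V(1,2) sm])
    also have "\<dots> = (\<Sum>k\<in>UNIV. \<Sum>j\<in>UNIV. (dir_deriv A p v (y k) * z j p + y k p * dir_deriv A p v (z j)) * torsion p $ k $ r $ j)"
      by (simp only: dir_deriv_mult[OF V(1,2) smooth_fun_mult[OF V(1) y z] T] dir_deriv_mult[OF V(1,2) y z]
          dir_deriv_torsion[OF p] mult_zero_right add_0_right)
    finally show ?thesis .
  qed
  have "M p v ?F = S p (M p v Y) (Z p) + S p (Y p) (M p v Z)"
  proof (rule frame_eqI[OF s_orthonormal[OF p] M_in[OF p v F_near Fp]])
    show "S p (M p v Y) (Z p) + S p (Y p) (M p v Z) \<in> tangent_space A p"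
      by (intro subspace_add[OF subspace_tangent] S_in p MY MZ Yp Zp)
    fix r
    have "g p (M p v ?F) (s p r) = dir_deriv A p v (f r) + (\<Sum>i\<in>UNIV. ?m $ r $ i * f i p)"
      unfolding M_coeff[OF p v F_near Fp] F_coeff[OF V(2)]
      using dir_deriv_cong[OF V(1,2) F_coeff[symmetric] f] by simp
    also have "(\<Sum>i\<in>UNIV. ?m $ r $ i * f i p) = (\<Sum>k\<in>UNIV. \<Sum>j\<in>UNIV.
        ((\<Sum>i\<in>UNIV. ?m $ k $ i * y i p) * z j p + y k p * (\<Sum>i\<in>UNIV. ?m $ j $ i * z i p)) * torsion p $ k $ r $ j)"
      unfolding f_def by (rule invariant_derivation[OF W_invariant[OF torsion_W[OF p]] minimal_form_in[OF p v]])
    finally have 1: "g p (M p v ?F) (s p r) = (\<Sum>k\<in>UNIV. \<Sum>j\<in>UNIV. (dir_deriv A p v (y k) * z j p + y k p * dir_deriv A p v (z j)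
        + ((\<Sum>i\<in>UNIV. ?m $ k $ i * y i p) * z j p + y k p * (\<Sum>i\<in>UNIV. ?m $ j $ i * z i p))) * torsion p $ k $ r $ j)"
      unfolding df by (simp only: distrib_right sum.distrib)
    have My: "g p (M p v Y) (s p k) = dir_deriv A p v (y k) + (\<Sum>i\<in>UNIV. ?m $ k $ i * y i p)" for k
      unfolding y_def[abs_def] by (rule M_coeff[OF p v YZ(1) Yp])
    have Mz: "g p (M p v Z) (s p k) = dir_deriv A p v (z k) + (\<Sum>i\<in>UNIV. ?m $ k $ i * z i p)" for k
      unfolding z_def[abs_def] by (rule M_coeff[OF p v YZ(2) Zp])
    have "g p (S p (M p v Y) (Z p) + S p (Y p) (M p v Z)) (s p r) =
        g p (S p (M p v Y) (Z p)) (s p r) + g p (S p (Y p) (M p v Z)) (s p r)"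
      by (rule g_add[OF S_in[OF p MY Zp] S_in[OF p Yp MZ] s_tangent[OF p]])
    also have "\<dots> = (\<Sum>k\<in>UNIV. \<Sum>j\<in>UNIV. (dir_deriv A p v (y k) * z j p + y k p * dir_deriv A p v (z j)
        + ((\<Sum>i\<in>UNIV. ?m $ k $ i * y i p) * z j p + y k p * (\<Sum>i\<in>UNIV. ?m $ j $ i * z i p))) * torsion p $ k $ r $ j)"
      unfolding S_coeff[OF p MY Zp] S_coeff[OF p Yp MZ] My Mz y_def[symmetric] z_def[symmetric] sum.distrib[symmetric]
      by (intro sum.cong refl) (simp add: algebra_simps)
    finally show "g p (M p v ?F) (s p r) = g p (S p (M p v Y) (Z p) + S p (Y p) (M p v Z)) (s p r)"
      using 1 by simp
  qed
  then show ?thesis by (simp only: add_diff_cancel_left' diff_self)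
qed

end

theorem corollary6p3:
  fixes A :: "('m::{t2_space, second_countable_topology}, 'n::finite) atlas"
    and g :: "'m \<Rightarrow> ('m, 'n) tvec \<Rightarrow> ('m, 'n) tvec \<Rightarrow> real"
    and G :: "(real^'n^'n) set"
    and P :: "'m \<Rightarrow> ('m, 'n) frame set"
    and D D' :: "('m, 'n) conn"
    and \<xi> :: "'m \<Rightarrow> ('m, 'n) frame \<Rightarrow> real^'n^'n^'n"
  assumes "G_manifold A g G P"
    and "levi_civita A g D"
    and "G_connection A P D'"
    and "\<xi> = intrinsic_torsion A g G D D'"
    and "\<exists>W. trivial_submodule G W \<and> takes_values_in P \<xi> W"
    and "invariant_vectors G = {0}"
    and "takes_values_in P \<xi> Lambda3"
  shows "parallel_tensor_field A (minimal_connection g P D \<xi>) (tensor_field_of g P \<xi>)"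
proof -
  obtain W where W: "trivial_submodule G W" "takes_values_in P \<xi> W" using assms(5) by blast
  interpret G_structure A g G P
    using assms(1) unfolding G_manifold_def by unfold_locales auto
  show ?thesis
    unfolding parallel_tensor_field_def
  proof (intro allI impI ballI)
    fix p Y Z v
    assume "smooth_field_near A p Y \<and> smooth_field_near A p Z" and v: "v \<in> tangent_space A p"
    then have YZ: "smooth_field_near A p Y" "smooth_field_near A p Z" by blast+
    \<comment> \<open>The claim at \<open>p\<close> is local, so a smooth section of the reduction
      around \<open>p\<close> suffices as frame.\<close>
    obtain U s where U: "open U" "p \<in> U" "\<forall>q\<in>U. s q \<in> P q" "\<forall>i. smooth_field A U (\<lambda>q. s q i)"
      using P_section by blast
    interpret invariant_torsion A g G P U s D D' W
      by unfold_locales (use U W assms(2-4,6,7) in auto)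
    show "minimal_connection g P D \<xi> p v (\<lambda>q. tensor_field_of g P \<xi> q (Y q) (Z q))
        - tensor_field_of g P \<xi> p (minimal_connection g P D \<xi> p v Y) (Z p)
        - tensor_field_of g P \<xi> p (Y p) (minimal_connection g P D \<xi> p v Z) = 0"
      unfolding assms(4) by (rule parallel[OF U(2) YZ v])
  qed
qed

end
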